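(* Let $F$ be a field of characteristic different from $2$. Let $\pi$ be a form over $F$ similar to an anisotropic Pfister form over $F$. Let $q$ be an anisotropic form over $F$ of dimension at least two. Let $F=F_0\subset F_1\subset\ldots\subset F_h$ denote the generic splitting tower of $q$ and $q\simeq q_0,q_1,\ldots,q_h$ the kernel forms of $q$. Suppose that $\pi\otimes q_j$ is anisotropic over $F_j$ for some fixed $j$ satisfying $0\leq j\leq h-1$. Then $i_1(\pi\otimes q_j)\geq(\dim\pi)\,i_{j+1}(q)$. In particular, if $\pi\otimes q$ is anisotropic over $F$, then $i_1(\pi\otimes q)\geq(\dim\pi)\,i_1(q)$.
   Context: "Form" means regular (nondegenerate) quadratic form of finite dimension. For an extension $K/F$, $q_K$ is $q$ viewed over $K$; $\pi\otimes q_j$ over $F_j$ means $\pi_{F_j}\otimes q_j$. Forms $p,q$ over $F$ are similar if $p\simeq aq$ for some $a\in F^\times$. An $n$-fold Pfister form is a form isometric to $\langle 1,a_1\rangle\otimes\cdots\otimes\langle 1,a_n\rangle$ with $a_i\in F^\times$ (the $0$-fold Pfister form is $\langle 1\rangle$). Every form decomposes as $q\simeq q_{\mathrm{an}}\perp i(q)\times\langle 1,-1\rangle$ with $q_{\mathrm{an}}$ anisotropic; $i(q)$ is the Witt index of $q$. For a form $q$ over $F$ with $\dim q=n\geq 2$ and $q\not\simeq\langle 1,-1\rangle$, the function field $F(q)$ is the quotient field of $F[X_1,\ldots,X_n]/(q(X_1,\ldots,X_n))$; if $\dim q\leq 1$ or $q\simeq\langle 1,-1\rangle$, set $F(q)=F$.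 Generic splitting tower: put $F_0=F$, $i_0(q)=i(q)$, $q_0\simeq q_{\mathrm{an}}$, and inductively $F_{j+1}=F_j(q_j)$, $i_{j+1}(q)=i((q_j)_{F_{j+1}})$, $q_{j+1}\simeq((q_j)_{F_{j+1}})_{\mathrm{an}}$, stopping at the first $h$ with $\dim q_h\leq 1$. The tower $F_0\subset\cdots\subset F_h$ is the generic splitting tower of $q$, $q_0,\ldots,q_h$ are its kernel forms, and $i_1(q),\ldots,i_h(q)$ are its higher Witt indices. In particular, for $q$ anisotropic of dimension at least two, $i_1(q)=i(q_{F(q)})$ is its first Witt index; $i_1(\pi\otimes q_j)$ is computed over the base field $F_j$. *)

theory Defs
  imports "Jordan_Normal_Form.Determinant" "HOL-Library.Poly_Mapping"
begin

text \<open>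
  Fields are subfields, given as sets, of an ambient type of class \<^class>\<open>field\<close>. The ambient
  field is only a container, so that the members of a tower of fields are sets of one type and the
  extensions in the tower are inclusions. Any tower of fields arises in this way, for instance
  with its top field as the ambient type.
\<close>

definition is_subfield :: "'a::field set \<Rightarrow> bool" where
  "is_subfield K \<longleftrightarrow>
     1 \<in> K \<and> (\<forall>x\<in>K. \<forall>y\<in>K. x - y \<in> K \<and> x * y \<in> K \<and> inverse x \<in> K)"

definition ring_hom_on :: "'r::comm_ring_1 set \<Rightarrow> 's::comm_ring_1 set \<Rightarrow> ('r \<Rightarrow> 's) \<Rightarrow> bool" where
  "ring_hom_on R S f \<longleftrightarrow>
     (\<forall>x\<in>R. f x \<in> S) \<and> f 1 = 1 \<and> (\<forall>x\<in>R. \<forall>y\<in>R. f (x + y) = f x + f y \<and> f (x * y) = f x * f y)"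


section \<open>Quadratic forms\<close>

text \<open>
  In characteristic different from 2, a regular quadratic form of dimension \<open>n\<close> over \<open>K\<close> is given
  by its Gram matrix, a symmetric invertible \<open>n \<times> n\<close> matrix \<open>q\<close> over \<open>K\<close>; the form is
  \<open>v \<mapsto> v\<^sup>T q v\<close>, so that a diagonal matrix with entries \<open>a\<^sub>1, \<dots>, a\<^sub>n\<close> represents
  \<open>\<langle>a\<^sub>1, \<dots>, a\<^sub>n\<rangle>\<close>. The dimension of the form is \<open>dim_row q\<close>, and it may be 0. For a subfield \<open>K\<close> of
  \<open>L\<close>, the form viewed over \<open>L\<close> has the same matrix; along an embedding \<open>\<phi>\<close> of \<open>K\<close> into \<open>L\<close>, it has
  the matrix \<open>map_mat \<phi> q\<close>.
\<close>

definition quad_form :: "'a::field set \<Rightarrow> 'a mat \<Rightarrow> bool" where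
  "quad_form K q \<longleftrightarrow>
     square_mat q \<and> elements_mat q \<subseteq> K \<and> transpose_mat q = q \<and> det q \<noteq> 0"

definition qf_value :: "'a::field mat \<Rightarrow> 'a vec \<Rightarrow> 'a" where
  "qf_value q v = v \<bullet> (q *\<^sub>v v)"

definition isometric :: "'a::field set \<Rightarrow> 'a mat \<Rightarrow> 'a mat \<Rightarrow> bool" where
  "isometric K p q \<longleftrightarrow> dim_row p = dim_row q \<and>
     (\<exists>P \<in> carrier_mat (dim_row p) (dim_row p).
        elements_mat P \<subseteq> K \<and> det P \<noteq> 0 \<and> transpose_mat P * p * P = q)"

definition similar_forms :: "'a::field set \<Rightarrow> 'a mat \<Rightarrow> 'a mat \<Rightarrow> bool" where
  "similar_forms K p q \<longleftrightarrow> (\<exists>a\<in>K - {0}. isometric K p (a \<cdot>\<^sub>m q))"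

definition anisotropic :: "'a::field set \<Rightarrow> 'a mat \<Rightarrow> bool" where
  "anisotropic K q \<longleftrightarrow>
     (\<forall>v \<in> carrier_vec (dim_row q).
        (\<forall>i<dim_row q. v $ i \<in> K) \<and> qf_value q v = 0 \<longrightarrow> v = 0\<^sub>v (dim_row q))"

definition diag_form :: "'a::field list \<Rightarrow> 'a mat" where
  "diag_form as = mat_diag (length as) (\<lambda>i. as ! i)"

abbreviation hyperbolic_plane :: "'a::field mat" where
  "hyperbolic_plane \<equiv> diag_form [1, -1]"

text \<open>The tensor product is the Kronecker product of the Gram matrices.\<close>

definition tensor_form :: "'a::field mat \<Rightarrow> 'a mat \<Rightarrow> 'a mat" where
  "tensor_form p q =
     (let m = dim_row p; n = dim_row q in
      mat (m * n) (m * n)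
        (\<lambda>(i, j). p $$ (i div n, j div n) * q $$ (i mod n, j mod n)))"

definition is_pfister :: "'a::field set \<Rightarrow> 'a mat \<Rightarrow> bool" where
  "is_pfister K p \<longleftrightarrow> quad_form K p \<and>
     (\<exists>as. set as \<subseteq> K - {0} \<and>
        isometric K p (foldr (\<lambda>a r. tensor_form (diag_form [1, a]) r) as (diag_form [1])))"

definition witt_decomposition :: "'a::field set \<Rightarrow> 'a mat \<Rightarrow> 'a mat \<Rightarrow> nat \<Rightarrow> bool" where
  "witt_decomposition K q p m \<longleftrightarrow>
     quad_form K p \<and> anisotropic K p \<and>
     isometric K q (diag_block_mat (p # replicate m hyperbolic_plane))"

definition witt_index :: "'a::field set \<Rightarrow> 'a mat \<Rightarrow> nat" where
  "witt_index K q = (THE m. \<exists>p. witt_decomposition K q p m)"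

definition anisotropic_part :: "'a::field set \<Rightarrow> 'a mat \<Rightarrow> 'a mat \<Rightarrow> bool" where
  "anisotropic_part K q p \<longleftrightarrow> witt_decomposition K q p (witt_index K q)"


section \<open>Function fields of quadratic forms\<close>

text \<open>
  Multivariate polynomials are finitely supported maps from monomials to coefficients, and a
  monomial is a finitely supported map from variable indices to exponents. The variables
  \<open>X\<^sub>1, \<dots>, X\<^sub>n\<close> have the indices \<open>0, \<dots>, n - 1\<close>.
\<close>

type_synonym 'a mvpoly = "(nat \<Rightarrow>\<^sub>0 nat) \<Rightarrow>\<^sub>0 'a"

definition mv_const :: "'a::field \<Rightarrow> 'a mvpoly" where
  "mv_const c = Poly_Mapping.single 0 c"

definition mv_var :: "nat \<Rightarrow> 'a::field mvpoly" where
  "mv_var i = Poly_Mapping.single (Poly_Mapping.single i 1) 1"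

definition mv_polys :: "'a::field set \<Rightarrow> nat \<Rightarrow> 'a mvpoly set" where
  "mv_polys K n =
     {f. (\<forall>m. Poly_Mapping.lookup f m \<in> K) \<and> (\<forall>m\<in>Poly_Mapping.keys f. Poly_Mapping.keys m \<subseteq> {..<n})}"

definition qf_poly :: "'a::field mat \<Rightarrow> 'a mvpoly" where
  "qf_poly q = (\<Sum>i<dim_row q. \<Sum>j<dim_row q. mv_const (q $$ (i, j)) * mv_var i * mv_var j)"

text \<open>
  \<open>is_function_field K q L \<phi>\<close>: the field \<open>L\<close>, as an extension of \<open>K\<close> along the embedding \<open>\<phi>\<close>, is the
  function field \<open>K(q)\<close>. The function field is determined up to \<open>K\<close>-isomorphism, and \<open>L\<close> ranges over
  all its realisations. The map \<open>\<psi>\<close> below is the composition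
  \<open>K[X\<^sub>1, \<dots>, X\<^sub>n] \<rightarrow> K[X\<^sub>1, \<dots>, X\<^sub>n]/(q) \<rightarrow> L\<close>: its kernel is the ideal generated by \<open>q(X\<^sub>1, \<dots>, X\<^sub>n)\<close>, and \<open>L\<close>
  consists of the quotients of elements of its image.
\<close>

definition is_function_field ::
    "'a::field set \<Rightarrow> 'a mat \<Rightarrow> 'b::field set \<Rightarrow> ('a \<Rightarrow> 'b) \<Rightarrow> bool" where
  "is_function_field K q L \<phi> \<longleftrightarrow>
     is_subfield K \<and> is_subfield L \<and> ring_hom_on K L \<phi> \<and>
     (if dim_row q \<le> 1 \<or> isometric K q hyperbolic_plane then L = \<phi> ` K
      else (let R = mv_polys K (dim_row q) in
            \<exists>\<psi>. ring_hom_on R L \<psi> \<and> (\<forall>c\<in>K. \<psi> (mv_const c) = \<phi> c) \<and>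
                {f\<in>R. \<psi> f = 0} = {qf_poly q * g | g. g \<in> R} \<and>
                L = {\<psi> f / \<psi> g | f g. f \<in> R \<and> g \<in> R \<and> \<psi> g \<noteq> 0}))"


section \<open>Generic splitting towers\<close>

text \<open>
  \<open>Fs 0 \<subset> \<dots> \<subset> Fs h\<close> is the tower and \<open>qs 0, \<dots>, qs h\<close> are the kernel forms; the values of \<open>Fs\<close>
  and \<open>qs\<close> beyond \<open>h\<close> are irrelevant.
\<close>

definition generic_splitting_tower ::
    "'a::field set \<Rightarrow> 'a mat \<Rightarrow> nat \<Rightarrow> (nat \<Rightarrow> 'a set) \<Rightarrow> (nat \<Rightarrow> 'a mat) \<Rightarrow> bool" where
  "generic_splitting_tower F q h Fs qs \<longleftrightarrow>
     Fs 0 = F \<and> anisotropic_part F q (qs 0) \<and>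
     (\<forall>j<h. dim_row (qs j) \<ge> 2 \<and> Fs j \<subseteq> Fs (Suc j) \<and>
        is_function_field (Fs j) (qs j) (Fs (Suc j)) (\<lambda>x. x) \<and>
        anisotropic_part (Fs (Suc j)) (qs j) (qs (Suc j))) \<and>
     dim_row (qs h) \<le> 1"

text \<open>The index \<open>k\<close> is meant to be at least 1.\<close>

definition higher_witt_index :: "(nat \<Rightarrow> 'a::field set) \<Rightarrow> (nat \<Rightarrow> 'a mat) \<Rightarrow> nat \<Rightarrow> nat" where
  "higher_witt_index Fs qs k = witt_index (Fs k) (qs (k - 1))"

text \<open>
  For an anisotropic form \<open>q\<close> over \<open>K\<close> of dimension at least two and a realisation \<open>(L, \<phi>)\<close> of \<open>K(q)\<close>
  in the sense of \<^const>\<open>is_function_field\<close>, this is the first Witt index of \<open>q\<close>.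
\<close>

definition first_witt_index :: "'b::field set \<Rightarrow> ('a::field \<Rightarrow> 'b) \<Rightarrow> 'a mat \<Rightarrow> nat" where
  "first_witt_index L \<phi> q = witt_index L (map_mat \<phi> q)"

end

(*
  Only the following property of the first Witt index m of q is used: q has a totally isotropic subspace of
  dimension m over every extension E over which q is isotropic. (For infinite E, the points over E of an isotropic
  quadric are dense, so a totally isotropic subspace over the function field specialises to E.)

  This property is inherited by <1, -t> q, with 2m in place of m, so no multiplicativity of Pfister forms is needed.
  Indeed let q be anisotropic over E with q(u) = t q(v). The plane spanned by u and v becomes isotropic over some
  E(s), s^2 in E, from which t is a norm, t = N(z). Take a totally isotropic subspace W over E(s) of dimension m and
  write w = Re w + s Im w. Since q(w) = 0, q(Re(z w)) = t q(Re w), and the vectors (Re(z w), Re w) with w in W form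
  a totally isotropic subspace of <1, -t> q over E of dimension 2m.
*)

theory Submission
  imports Defs "HOL-Algebra.Algebraic_Closure_Type"
begin

text \<open>The obstacle is that the two function fields live apart: \<open>F_j(q_j)\<close>, where
  a totally isotropic subspace of dimension \<open>i_{j+1}(q)\<close> is known, and
  \<open>F_j(\<pi> \<otimes> q_j)\<close>, where a larger one for the product is wanted; neither is
  given as an extension of the other. They are linked by polynomials: the subspace over the first
  field gets polynomial coordinates, which are evaluated at a point of the quadric over
  \<open>E\<close>. All fields \<open>E\<close> are subfields of one algebraically closed type, the
  closure of the type containing \<open>L\<close>, so \<open>s\<close> is at hand and
  \<open>E(s)\<close> stays in that type. \<open>F_j\<close> may be finite, but the argument starts
  from the copy of \<open>L\<close> as \<open>E\<close>, which is infinite, and only enlarges it.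
  The doubling step uses the form over \<open>E(s)\<close>, so the claim for the remaining slots is
  proved for all \<open>E\<close> at once. Two cases fall outside the plane argument. If the form is
  already isotropic over \<open>E\<close>, two copies of its subspace are put side by side. If
  \<open>u\<close> and \<open>v\<close> are proportional, \<open>t\<close> is a square, hence a norm
  from any quadratic extension, and any plane through \<open>v\<close> serves.\<close>

lemma subfield_1: "is_subfield K \<Longrightarrow> 1 \<in> K"
  and subfield_diff: "is_subfield K \<Longrightarrow> x \<in> K \<Longrightarrow> y \<in> K \<Longrightarrow> x - y \<in> K"
  and subfield_mult: "is_subfield K \<Longrightarrow> x \<in> K \<Longrightarrow> y \<in> K \<Longrightarrow> x * y \<in> K"
  and subfield_inverse: "is_subfield K \<Longrightarrow> x \<in> K \<Longrightarrow> inverse x \<in> K"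
  by (auto simp: is_subfield_def)

lemma subfield_0: "is_subfield K \<Longrightarrow> 0 \<in> K"
  using subfield_diff[of K 1 1] subfield_1 by auto

lemma subfield_uminus: "is_subfield K \<Longrightarrow> x \<in> K \<Longrightarrow> - x \<in> K"
  using subfield_diff[of K 0 x] subfield_0 by auto

lemma subfield_add: "is_subfield K \<Longrightarrow> x \<in> K \<Longrightarrow> y \<in> K \<Longrightarrow> x + y \<in> K"
  using subfield_diff[of K x "- y"] subfield_uminus by auto

lemma subfield_divide: "is_subfield K \<Longrightarrow> x \<in> K \<Longrightarrow> y \<in> K \<Longrightarrow> x / y \<in> K"
  by (simp add: divide_inverse subfield_mult subfield_inverse)

lemma subfield_sum: "is_subfield K \<Longrightarrow> (\<And>i. i \<in> I \<Longrightarrow> f i \<in> K) \<Longrightarrow> (\<Sum>i\<in>I. f i) \<in> K"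
  by (induction I rule: infinite_finite_induct) (auto intro: subfield_add subfield_0)

lemma subfield_power: "is_subfield K \<Longrightarrow> x \<in> K \<Longrightarrow> x ^ k \<in> K"
  by (induction k) (auto intro: subfield_mult subfield_1)

lemmas subfield_closed = subfield_0 subfield_1 subfield_diff subfield_mult subfield_inverse
  subfield_uminus subfield_add subfield_divide subfield_sum subfield_power

lemma sum_lessThan_add:
  "(\<Sum>i<n + m. f i) = (\<Sum>i<n. f i) + (\<Sum>i<m. f (i + n))" for n m :: nat
  by (induction m) (auto simp: ac_simps)


lemma sum_Times_bool: "(\<Sum>p\<in>I \<times> UNIV. f p) = (\<Sum>k\<in>I. f (k, False) + f (k, True))"
proof -
  have "(\<Sum>p\<in>I \<times> UNIV. f p) = (\<Sum>k\<in>I. \<Sum>\<epsilon>\<in>UNIV. f (k, \<epsilon>))"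
    by (simp add: sum.cartesian_product)
  thus ?thesis by (simp add: UNIV_bool add.commute)
qed


section \<open>Totally isotropic families\<close>

text \<open>Forms are functions of two indices and vectors are functions on \<open>nat\<close>, of
  which only the values below \<open>n\<close> matter. Base change is then composition with the
  embedding.\<close>

definition bil :: "nat \<Rightarrow> (nat \<Rightarrow> nat \<Rightarrow> 'a::field) \<Rightarrow> (nat \<Rightarrow> 'a) \<Rightarrow> (nat \<Rightarrow> 'a) \<Rightarrow> 'a" where
  "bil n Q u v = (\<Sum>i<n. \<Sum>j<n. Q i j * u i * v j)"

definition indep_fam :: "'a::field set \<Rightarrow> nat \<Rightarrow> 'i set \<Rightarrow> ('i \<Rightarrow> nat \<Rightarrow> 'a) \<Rightarrow> bool" where
  "indep_fam K n I W \<longleftrightarrow> (\<forall>c. (\<forall>k\<in>I. c k \<in> K) \<and> (\<forall>j<n. (\<Sum>k\<in>I. c k * W k j) = 0) \<longrightarrow> (\<forall>k\<in>I. c k = 0))"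

text \<open>A totally isotropic subspace is represented by a basis of it. The index set is arbitrary
  because doubled families are indexed by pairs of a number and a Boolean.\<close>

definition iso_fam ::
    "'a::field set \<Rightarrow> nat \<Rightarrow> (nat \<Rightarrow> nat \<Rightarrow> 'a) \<Rightarrow> 'i set \<Rightarrow> ('i \<Rightarrow> nat \<Rightarrow> 'a) \<Rightarrow> bool" where
  "iso_fam K n Q I W \<longleftrightarrow> (\<forall>k\<in>I. \<forall>j<n. W k j \<in> K) \<and>
     (\<forall>k\<in>I. \<forall>l\<in>I. bil n Q (W k) (W l) = 0) \<and> indep_fam K n I W"

definition tot_iso :: "'a::field set \<Rightarrow> nat \<Rightarrow> (nat \<Rightarrow> nat \<Rightarrow> 'a) \<Rightarrow> nat \<Rightarrow> bool" where
  "tot_iso K n Q m \<longleftrightarrow> (\<exists>W. iso_fam K n Q {..<m} W)"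

definition isotr :: "'a::field set \<Rightarrow> nat \<Rightarrow> (nat \<Rightarrow> nat \<Rightarrow> 'a) \<Rightarrow> bool" where
  "isotr K n Q \<longleftrightarrow> (\<exists>v. (\<forall>j<n. v j \<in> K) \<and> (\<exists>j<n. v j \<noteq> 0) \<and> bil n Q v v = 0)"

lemma indep_famD:
  "indep_fam K n I W \<Longrightarrow> (\<And>k. k \<in> I \<Longrightarrow> c k \<in> K) \<Longrightarrow> (\<And>j. j < n \<Longrightarrow> (\<Sum>k\<in>I. c k * W k j) = 0) \<Longrightarrow>
   k \<in> I \<Longrightarrow> c k = 0" unfolding indep_fam_def by blast

lemma bil_cong:
  "(\<And>i j. i < n \<Longrightarrow> j < n \<Longrightarrow> Q i j = Q' i j) \<Longrightarrow> (\<And>i. i < n \<Longrightarrow> u i = u' i) \<Longrightarrow>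
   (\<And>i. i < n \<Longrightarrow> v i = v' i) \<Longrightarrow> bil n Q u v = bil n Q' u' v'"
  by (simp add: bil_def)

lemma bil_lin_left: "bil n Q (\<lambda>j. x * u j + y * v j) w = x * bil n Q u w + y * bil n Q v w"
  by (simp add: bil_def sum.distrib sum_distrib_left algebra_simps)

lemma bil_lin_right: "bil n Q w (\<lambda>j. x * u j + y * v j) = x * bil n Q w u + y * bil n Q w v"
  by (simp add: bil_def sum.distrib sum_distrib_left algebra_simps)

lemma bil_scale_left: "bil n Q (\<lambda>j. x * u j) w = x * bil n Q u w"
  by (simp add: bil_def sum_distrib_left algebra_simps)

lemma bil_scale_right: "bil n Q w (\<lambda>j. x * u j) = x * bil n Q w u"
  by (simp add: bil_def sum_distrib_left algebra_simps)

lemma bil_sum_left: "bil n Q (\<lambda>j. \<Sum>k\<in>I. c k * W k j) w = (\<Sum>k\<in>I. c k * bil n Q (W k) w)"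
proof (induction I rule: infinite_finite_induct)
  case (insert k I)
  then show ?case using bil_lin_left[of n Q "c k" "W k" 1 "\<lambda>j. \<Sum>k\<in>I. c k * W k j" w] by simp
qed (auto simp: bil_def)

lemma bil_sum_right: "bil n Q w (\<lambda>j. \<Sum>k\<in>I. c k * W k j) = (\<Sum>k\<in>I. c k * bil n Q w (W k))"
proof (induction I rule: infinite_finite_induct)
  case (insert k I)
  then show ?case using bil_lin_right[of n Q w "c k" "W k" 1 "\<lambda>j. \<Sum>k\<in>I. c k * W k j"] by simp
qed (auto simp: bil_def)

lemma bil_sym: "(\<And>i j. i < n \<Longrightarrow> j < n \<Longrightarrow> Q i j = Q j i) \<Longrightarrow> bil n Q u v = bil n Q v u"
  unfolding bil_def by (subst sum.swap) (auto intro!: sum.cong)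

lemma bil_closed:
  "is_subfield K \<Longrightarrow> (\<And>i j. i < n \<Longrightarrow> j < n \<Longrightarrow> Q i j \<in> K) \<Longrightarrow> (\<And>i. i < n \<Longrightarrow> u i \<in> K) \<Longrightarrow>
   (\<And>i. i < n \<Longrightarrow> v i \<in> K) \<Longrightarrow> bil n Q u v \<in> K"
  unfolding bil_def by (intro subfield_sum subfield_mult) auto

lemma iso_fam_comb:
  assumes "iso_fam K n Q I W"
  shows "bil n Q (\<lambda>j. \<Sum>k\<in>I. c k * W k j) (\<lambda>j. \<Sum>k\<in>I. d k * W k j) = 0"
  using assms by (simp add: bil_sum_left bil_sum_right iso_fam_def)

lemma iso_fam_reindex:
  assumes "bij_betw f J I" "iso_fam K n Q I W"
  shows "iso_fam K n Q J (W \<circ> f)"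
proof -
  have I: "I = f ` J" and inj: "inj_on f J" using assms(1) by (auto simp: bij_betw_def)
  have *: "indep_fam K n I W" using assms(2) by (simp add: iso_fam_def)
  have "indep_fam K n J (W \<circ> f)" unfolding indep_fam_def
  proof (intro allI impI)
    fix c assume c: "(\<forall>k\<in>J. c k \<in> K) \<and> (\<forall>j<n. (\<Sum>k\<in>J. c k * (W \<circ> f) k j) = 0)"
    define d where "d k = c (the_inv_into J f k)" for k
    have d: "d (f k) = c k" if "k \<in> J" for k using the_inv_into_f_f[OF inj that] by (simp add: d_def)
    have "(\<Sum>k\<in>I. d k * W k j) = (\<Sum>k\<in>J. c k * (W \<circ> f) k j)" for j
      unfolding I by (subst sum.reindex[OF inj]) (auto simp: d intro!: sum.cong)
    moreover have "\<forall>k\<in>I. d k \<in> K" using c d I by auto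
    ultimately have "\<forall>k\<in>I. d k = 0" using *[unfolded indep_fam_def, rule_format, of d] c by auto
    thus "\<forall>k\<in>J. c k = 0" using d I by auto
  qed
  thus ?thesis using assms(2) by (auto simp: iso_fam_def I)
qed

lemma tot_isoI:
  assumes "finite I" "iso_fam K n Q I W"
  shows "tot_iso K n Q (card I)"
proof -
  obtain f where "bij_betw f {..<card I} I"
    using ex_bij_betw_nat_finite[OF assms(1)] by (auto simp: atLeast0LessThan)
  thus ?thesis using assms(2) iso_fam_reindex unfolding tot_iso_def by metis
qed

lemma indep_fam_subset:
  assumes "indep_fam K n I W" "J \<subseteq> I" "finite I" "is_subfield K"
  shows "indep_fam K n J W"
  unfolding indep_fam_def
proof (intro allI impI)
  fix c assume c: "(\<forall>k\<in>J. c k \<in> K) \<and> (\<forall>j<n. (\<Sum>k\<in>J. c k * W k j) = 0)"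
  define d where "d k = (if k \<in> J then c k else 0)" for k
  have "(\<Sum>k\<in>I. d k * W k j) = (\<Sum>k\<in>J. c k * W k j)" for j
    using assms(2,3) by (intro sum.mono_neutral_cong_right) (auto simp: d_def)
  hence "\<forall>k\<in>I. d k = 0"
    using assms(1)[unfolded indep_fam_def, rule_format, of d] c subfield_0[OF assms(4)] by (auto simp: d_def)
  thus "\<forall>k\<in>J. c k = 0" using assms(2) by (metis d_def subsetD)
qed

lemma iso_fam_subset:
  "iso_fam K n Q I W \<Longrightarrow> J \<subseteq> I \<Longrightarrow> finite I \<Longrightarrow> is_subfield K \<Longrightarrow> iso_fam K n Q J W"
  unfolding iso_fam_def using indep_fam_subset by blast

lemma tot_iso_mono: "tot_iso K n Q m \<Longrightarrow> k \<le> m \<Longrightarrow> is_subfield K \<Longrightarrow> tot_iso K n Q k"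
  unfolding tot_iso_def using iso_fam_subset[of K n Q "{..<m}" _ "{..<k}"] by fastforce

lemma tot_iso_1:
  assumes "is_subfield K"
  shows "tot_iso K n Q 1 \<longleftrightarrow> isotr K n Q"
proof
  assume "tot_iso K n Q 1"
  then obtain W :: "nat \<Rightarrow> nat \<Rightarrow> 'a" where W: "iso_fam K n Q {..<1} W" unfolding tot_iso_def by blast
  have "\<exists>j<n. W 0 j \<noteq> 0"
  proof (rule ccontr)
    assume "\<not> ?thesis"
    hence "(1::'a) = 0"
      using W[unfolded iso_fam_def indep_fam_def, THEN conjunct2, THEN conjunct2, rule_format, of "\<lambda>_. 1" 0]
        subfield_1[OF assms] by auto
    thus False by simp
  qed
  thus "isotr K n Q" using W unfolding isotr_def iso_fam_def by (intro exI[of _ "W 0"]) auto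
next
  assume "isotr K n Q"
  then obtain v where "\<forall>j<n. v j \<in> K" "\<exists>j<n. v j \<noteq> 0" "bil n Q v v = 0"
    by (auto simp: isotr_def)
  thus "tot_iso K n Q 1"
    unfolding tot_iso_def iso_fam_def indep_fam_def by (intro exI[of _ "\<lambda>_. v"]) auto
qed

lemma tot_iso_cong:
  assumes "\<And>i j. i < n \<Longrightarrow> j < n \<Longrightarrow> Q i j = Q' i j"
  shows "tot_iso K n Q m = tot_iso K n Q' m"
proof -
  have "bil n Q u v = bil n Q' u v" for u v using assms by (intro bil_cong) auto
  thus ?thesis by (simp add: tot_iso_def iso_fam_def)
qed

lemma isotr_cong:
  assumes "\<And>i j. i < n \<Longrightarrow> j < n \<Longrightarrow> Q i j = Q' i j"
  shows "isotr K n Q = isotr K n Q'"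
proof -
  have "bil n Q u v = bil n Q' u v" for u v using assms by (intro bil_cong) auto
  thus ?thesis by (simp add: isotr_def)
qed

lemma tot_iso_scale:
  assumes "a \<noteq> 0"
  shows "tot_iso K n (\<lambda>i j. a * Q i j) m = tot_iso K n Q m"
proof -
  have "bil n (\<lambda>i j. a * Q i j) u v = a * bil n Q u v" for u v
    by (simp add: bil_def sum_distrib_left algebra_simps)
  thus ?thesis using assms by (simp add: tot_iso_def iso_fam_def)
qed

text \<open>A dual family turns independence into finitely many polynomial identities, which survive
  specialisation; it also yields inverse matrices with entries in \<open>K\<close>. In the inductive
  step, \<open>W m\<close> minus its expansion \<open>\<Sum>l<m. c l * W l\<close> has a nonzero
  coordinate \<open>i\<close>. Reading off that coordinate of the remainder of a vector gives the
  new functional \<open>a\<close>, and multiples of \<open>a\<close> correct the old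
  functionals.\<close>

lemma indep_fam_dual:
  fixes K :: "'a::field set" and m n :: nat
  assumes K: "is_subfield K" and W: "\<And>k j. k < m \<Longrightarrow> j < n \<Longrightarrow> W k j \<in> K" and ind: "indep_fam K n {..<m} W"
  shows "\<exists>A. (\<forall>l<m. \<forall>j<n. A l j \<in> K) \<and> (\<forall>l<m. \<forall>k<m. (\<Sum>j<n. A l j * W k j) = (if k = l then 1 else 0))"
  using W ind
proof (induction m)
  case 0
  show ?case by simp
next
  case (Suc m)
  have "indep_fam K n {..<m} W" using indep_fam_subset[OF Suc.prems(2) _ _ K] by fastforce
  with Suc.IH Suc.prems(1) obtain A where A: "\<And>l j. l < m \<Longrightarrow> j < n \<Longrightarrow> A l j \<in> K"
    "\<And>l k. l < m \<Longrightarrow> k < m \<Longrightarrow> (\<Sum>j<n. A l j * W k j) = (if k = l then 1 else 0)"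
    by (metis less_SucI)
  define c where "c l = (\<Sum>j<n. A l j * W m j)" for l
  have cK: "c l \<in> K" if "l < m" for l
    unfolding c_def using A(1)[OF that] Suc.prems(1) by (intro subfield_sum subfield_mult K) auto
  define r where "r j = W m j - (\<Sum>l<m. c l * W l j)" for j
  have "\<exists>j<n. r j \<noteq> 0"
  proof (rule ccontr)
    assume "\<not> ?thesis"
    hence *: "r j = 0" if "j < n" for j using that by blast
    define e where "e k = (if k = m then 1 else - c k)" for k
    have "(\<Sum>k<Suc m. e k * W k j) = r j" for j by (simp add: e_def r_def sum_negf)
    moreover have "e k \<in> K" if "k \<in> {..<Suc m}" for k
      using cK K that by (auto simp: e_def less_Suc_eq intro: subfield_closed)
    ultimately have "e m = 0" using indep_famD[OF Suc.prems(2), of e m] * by simp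
    thus False by (auto simp: e_def)
  qed
  then obtain i where i: "i < n" "r i \<noteq> 0" by blast
  have rK: "r i \<in> K" unfolding r_def using cK Suc.prems(1) i by (intro subfield_diff subfield_sum subfield_mult K) auto
  define a where "a j = ((if j = i then 1 else 0) - (\<Sum>l<m. W l i * A l j)) / r i" for j
  have aK: "a j \<in> K" if "j < n" for j unfolding a_def using A(1) Suc.prems(1) i that rK K
    by (intro subfield_divide subfield_diff subfield_sum subfield_mult K) (auto intro: subfield_closed)
  have aW: "(\<Sum>j<n. a j * w j) = (w i - (\<Sum>l<m. W l i * (\<Sum>j<n. A l j * w j))) / r i" for w
  proof -
    have "(\<Sum>j<n. a j * w j) = (\<Sum>j<n. (if j = i then w j else 0) - (\<Sum>l<m. W l i * A l j) * w j) / r i"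
      unfolding sum_divide_distrib by (intro sum.cong) (auto simp: a_def algebra_simps)
    also have "(\<Sum>j<n. (if j = i then w j else 0) - (\<Sum>l<m. W l i * A l j) * w j) =
        w i - (\<Sum>j<n. \<Sum>l<m. W l i * A l j * w j)"
      using i by (simp add: sum_subtractf sum_distrib_right)
    also have "(\<Sum>j<n. \<Sum>l<m. W l i * A l j * w j) = (\<Sum>l<m. W l i * (\<Sum>j<n. A l j * w j))"
      by (subst sum.swap) (simp add: sum_distrib_left mult.assoc)
    finally show ?thesis .
  qed
  have aWm: "(\<Sum>j<n. a j * W m j) = 1"
    unfolding aW c_def[symmetric] using i by (simp add: r_def mult.commute)
  have aWk: "(\<Sum>j<n. a j * W k j) = 0" if "k < m" for k
  proof -
    have "(\<Sum>l<m. W l i * (\<Sum>j<n. A l j * W k j)) = (\<Sum>l<m. if l = k then W l i else 0)"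
      using A(2) that by (intro sum.cong) auto
    thus ?thesis unfolding aW using that by simp
  qed
  define A' where "A' l j = (if l = m then a j else A l j - c l * a j)" for l j
  have "\<forall>l<Suc m. \<forall>j<n. A' l j \<in> K"
    using A(1) aK cK by (auto simp: A'_def less_Suc_eq intro!: subfield_closed K)
  moreover have "(\<Sum>j<n. A' l j * W k j) = (if k = l then 1 else 0)" if "l < Suc m" "k < Suc m" for l k
  proof (cases "l = m")
    case True
    thus ?thesis using aWm aWk that by (auto simp: A'_def less_Suc_eq)
  next
    case False
    have "(\<Sum>j<n. A' l j * W k j) = (\<Sum>j<n. A l j * W k j) - c l * (\<Sum>j<n. a j * W k j)"
      using False by (simp add: A'_def left_diff_distrib sum_subtractf sum_distrib_left mult.assoc)
    thus ?thesis using False that A(2)[of l k] aWm aWk by (auto simp: less_Suc_eq c_def)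
  qed
  ultimately show ?case by blast
qed

section \<open>Doubling a form\<close>

text \<open>The Gram matrix of \<open>\<langle>1, a\<rangle> \<otimes> Q\<close>.\<close>

definition dbl :: "nat \<Rightarrow> 'a::field \<Rightarrow> (nat \<Rightarrow> nat \<Rightarrow> 'a) \<Rightarrow> nat \<Rightarrow> nat \<Rightarrow> 'a" where
  "dbl n a Q i j = (if i < n \<and> j < n then Q i j else if n \<le> i \<and> n \<le> j then a * Q (i - n) (j - n) else 0)"

lemma bil_dbl:
  "bil (n + n) (dbl n a Q) u v = bil n Q u v + a * bil n Q (\<lambda>i. u (i + n)) (\<lambda>i. v (i + n))"
  unfolding bil_def sum_lessThan_add sum.distrib by (simp add: dbl_def sum_distrib_left algebra_simps)

text \<open>Meant for \<open>s \<notin> E\<close> with \<open>s * s \<in> E\<close>, where this is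
  the quadratic extension \<open>E(s)\<close>.\<close>

definition adjoin_root :: "'a::field set \<Rightarrow> 'a \<Rightarrow> 'a set" where
  "adjoin_root E s = {a + b * s | a b. a \<in> E \<and> b \<in> E}"

lemma adjoin_root_unique:
  assumes "is_subfield E" "s \<notin> E" "a \<in> E" "b \<in> E" "a' \<in> E" "b' \<in> E" "a + b * s = a' + b' * s"
  shows "a = a' \<and> b = b'"
proof -
  have "b = b'"
  proof (rule ccontr)
    assume "b \<noteq> b'"
    hence "s = (a' - a) / (b - b')" using assms(7) by (simp add: field_simps)
    thus False using assms by (auto intro: subfield_closed)
  qed
  thus ?thesis using assms(7) by simp
qed

lemma subfield_adjoin_root:
  assumes E: "is_subfield E" and s: "s \<notin> E" "s * s \<in> E"
  shows "is_subfield (adjoin_root E s)" "E \<subseteq> adjoin_root E s" "s \<in> adjoin_root E s"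
proof -
  show sub: "E \<subseteq> adjoin_root E s"
  proof
    fix x assume "x \<in> E"
    hence "x = x + 0 * s" "x \<in> E" "0 \<in> E" using E by (auto intro: subfield_closed)
    thus "x \<in> adjoin_root E s" unfolding adjoin_root_def by blast
  qed
  have "s = 0 + 1 * s" by simp
  thus "s \<in> adjoin_root E s" unfolding adjoin_root_def using E subfield_0 subfield_1 by blast
  show "is_subfield (adjoin_root E s)" unfolding is_subfield_def
  proof (intro conjI ballI)
    show "1 \<in> adjoin_root E s" using sub E by (auto intro: subfield_closed)
    fix x y assume "x \<in> adjoin_root E s" "y \<in> adjoin_root E s"
    then obtain a b c d where x: "x = a + b * s" "a \<in> E" "b \<in> E" and y: "y = c + d * s" "c \<in> E" "d \<in> E"
      by (auto simp: adjoin_root_def)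
    have "x - y = (a - c) + (b - d) * s" using x y by (simp add: algebra_simps)
    thus "x - y \<in> adjoin_root E s" using x y E unfolding adjoin_root_def by (blast intro: subfield_closed)
    have "x * y = (a * c + b * d * (s * s)) + (a * d + b * c) * s" using x y by (simp add: algebra_simps)
    thus "x * y \<in> adjoin_root E s" using x y E s unfolding adjoin_root_def by (blast intro: subfield_closed)
    show "inverse x \<in> adjoin_root E s"
    proof (cases "x = 0")
      case True thus ?thesis using sub E by (auto intro: subfield_closed)
    next
      case False
      \<comment> \<open>The norm of \<open>x\<close>; the inverse of \<open>x\<close> is its
        conjugate \<open>a - b * s\<close> divided by \<open>N\<close>.\<close>
      define N where "N = a * a - b * b * (s * s)"
      have "a - b * s \<noteq> 0"
      proof
        assume "a - b * s = 0"
        hence *: "a = 0 \<and> b = 0" using adjoin_root_unique[OF E s(1) x(2,3), of b] False x E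
            adjoin_root_unique[OF E s(1) x(2) subfield_uminus[OF E x(3)], of 0 0] subfield_0[OF E] by auto
        thus False using False x by simp
      qed
      moreover have N: "N = x * (a - b * s)" by (simp add: N_def x algebra_simps)
      ultimately have "inverse x = (a - b * s) / N" using False by (simp add: divide_inverse)
      hence "inverse x = a / N + (- b / N) * s" by (simp add: diff_divide_distrib)
      moreover have "N \<in> E"
        unfolding N_def using subfield_mult[OF E subfield_mult[OF E x(3,3)] s(2)] x E by (auto intro: subfield_closed)
      ultimately show ?thesis using x E unfolding adjoin_root_def by (blast intro: subfield_closed)
    qed
  qed
qed

text \<open>
  The main step. If \<open>Q\<close> is anisotropic over \<open>E\<close> and \<open>t\<close> is the norm of \<open>z = r + y s\<close>, then taking the \<open>E\<close>-part of
  vectors of \<open>E(s)\<^sup>n\<close> in a totally isotropic subspace is injective, and passing from \<open>w\<close> to \<open>z w\<close> multiplies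
  the value of \<open>Q\<close> at the \<open>E\<close>-part by \<open>t\<close>.
\<close>

lemma tot_iso_dbl_adjoin:
  assumes E: "is_subfield E" and s: "s \<notin> E" "s * s \<in> E"
    and Q: "\<And>i j. i < n \<Longrightarrow> j < n \<Longrightarrow> Q i j \<in> E"
    and an: "\<not> isotr E n Q"
    and W: "tot_iso (adjoin_root E s) n Q m"
    and ry: "r \<in> E" "y \<in> E"
  shows "tot_iso E (n + n) (dbl n (- (r * r - s * s * y * y)) Q) (2 * m)"
proof -
  let ?L = "adjoin_root E s"
  let ?d = "s * s"
  have L: "is_subfield ?L" "E \<subseteq> ?L" "s \<in> ?L" using subfield_adjoin_root[OF E s] by auto
  have "\<forall>x\<in>?L. \<exists>p. fst p \<in> E \<and> snd p \<in> E \<and> x = fst p + snd p * s"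
    unfolding adjoin_root_def by auto
  then obtain f where f: "\<And>x. x \<in> ?L \<Longrightarrow> fst (f x) \<in> E \<and> snd (f x) \<in> E \<and> x = fst (f x) + snd (f x) * s"
    by metis
  define re where "re x = fst (f x)" for x
  define im where "im x = snd (f x)" for x
  have reim: "re x \<in> E" "im x \<in> E" "x = re x + im x * s" if "x \<in> ?L" for x
    using f[OF that] by (auto simp: re_def im_def)
  obtain W where W: "iso_fam ?L n Q {..<m} W" using W by (auto simp: tot_iso_def)
  \<comment> \<open>The index \<open>(k, False)\<close> stands for the vector \<open>W k\<close> and
    \<open>(k, True)\<close> for \<open>s\<close> times it; together they span over \<open>E\<close>
    the \<open>E(s)\<close>-space generated by \<open>W\<close>. \<open>A p\<close> and
    \<open>B p\<close> are the components of the vector with respect to \<open>1\<close> and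
    \<open>s\<close>.\<close>
  define A where "A p j = (if snd p then ?d * im (W (fst p) j) else re (W (fst p) j))" for p :: "nat \<times> bool" and j
  define B where "B p j = (if snd p then re (W (fst p) j) else im (W (fst p) j))" for p :: "nat \<times> bool" and j
  \<comment> \<open>The pair of the \<open>E\<close>-parts of \<open>z w\<close> and
    \<open>w\<close>, where \<open>w = A p + B p s\<close> and \<open>z = r + y s\<close>.\<close>
  define U where "U p = (\<lambda>j. if j < n then r * A p j + ?d * y * B p j else A p (j - n))" for p
  let ?I = "{..<m} \<times> (UNIV :: bool set)"
  have WL: "W k j \<in> ?L" if "k < m" "j < n" for k j using W that by (auto simp: iso_fam_def)
  have AB: "A p j \<in> E" "B p j \<in> E" if "p \<in> ?I" "j < n" for p j
    using that WL[of "fst p" j] s(2) reim by (auto simp: A_def B_def intro!: subfield_mult[OF E])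
  have ABW: "A p j + B p j * s = (if snd p then s else 1) * W (fst p) j" if "p \<in> ?I" "j < n" for p j
    using that WL[of "fst p" j] reim(3) by (auto simp: A_def B_def) (metis distrib_left mult.assoc mult.commute add.commute)
  have key: "bil n Q (\<lambda>j. a j + b j * s) (\<lambda>j. a' j + b' j * s) =
      (bil n Q a a' + ?d * bil n Q b b') + (bil n Q a b' + bil n Q b a') * s" for a b a' b'
  proof -
    have "bil n Q (\<lambda>j. 1 * a j + s * b j) (\<lambda>j. 1 * a' j + s * b' j) =
      (bil n Q a a' + ?d * bil n Q b b') + (bil n Q a b' + bil n Q b a') * s"
      unfolding bil_lin_left bil_lin_right by (simp add: algebra_simps)
    thus ?thesis by (simp add: mult.commute)
  qed
  have split: "bil n Q a a' + ?d * bil n Q b b' = 0 \<and> bil n Q a b' + bil n Q b a' = 0"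
    if "bil n Q (\<lambda>j. a j + b j * s) (\<lambda>j. a' j + b' j * s) = 0"
      "\<forall>j<n. a j \<in> E" "\<forall>j<n. b j \<in> E" "\<forall>j<n. a' j \<in> E" "\<forall>j<n. b' j \<in> E" for a b a' b'
    using adjoin_root_unique[OF E s(1), of "bil n Q a a' + ?d * bil n Q b b'" "bil n Q a b' + bil n Q b a'" 0 0]
      that unfolding key by (auto intro!: subfield_closed[OF E] bil_closed[OF E] Q s(2))
  have Iso: "bil n Q (A p) (A q) + ?d * bil n Q (B p) (B q) = 0 \<and> bil n Q (A p) (B q) + bil n Q (B p) (A q) = 0"
    if "p \<in> ?I" "q \<in> ?I" for p q
  proof (rule split)
    have "bil n Q (\<lambda>j. A p j + B p j * s) (\<lambda>j. A q j + B q j * s) =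
      bil n Q (\<lambda>j. (if snd p then s else 1) * W (fst p) j) (\<lambda>j. (if snd q then s else 1) * W (fst q) j)"
      using ABW that by (intro bil_cong) auto
    also have "\<dots> = (if snd p then s else 1) * ((if snd q then s else 1) * bil n Q (W (fst p)) (W (fst q)))"
      by (simp only: bil_scale_left bil_scale_right)
    also have "\<dots> = 0" using W that by (auto simp: iso_fam_def)
    finally show "bil n Q (\<lambda>j. A p j + B p j * s) (\<lambda>j. A q j + B q j * s) = 0" .
  qed (use AB that in auto)
  have "iso_fam E (n + n) (dbl n (- (r * r - ?d * y * y)) Q) ?I U" unfolding iso_fam_def
  proof (intro conjI ballI allI impI)
    fix p j assume "p \<in> ?I" "j < n + n"
    thus "U p j \<in> E" using AB ry s(2) by (auto simp: U_def intro!: subfield_closed[OF E])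
  next
    fix p q assume pq: "p \<in> ?I" "q \<in> ?I"
    have 1: "bil n Q (U p) (U q) = bil n Q (\<lambda>j. r * A p j + ?d * y * B p j) (\<lambda>j. r * A q j + ?d * y * B q j)"
      by (intro bil_cong) (auto simp: U_def)
    have 2: "bil n Q (\<lambda>i. U p (i + n)) (\<lambda>i. U q (i + n)) = bil n Q (A p) (A q)"
      by (intro bil_cong) (auto simp: U_def)
    define x1 x2 x3 x4 where x: "x1 = bil n Q (A p) (A q)" "x2 = bil n Q (B p) (B q)"
      "x3 = bil n Q (A p) (B q)" "x4 = bil n Q (B p) (A q)"
    have e: "x1 = - (?d * x2)" "x4 = - x3" using Iso[OF pq] unfolding x by (auto simp: eq_neg_iff_add_eq_0 add.commute)
    show "bil (n + n) (dbl n (- (r * r - ?d * y * y)) Q) (U p) (U q) = 0"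
      unfolding bil_dbl 1 2 bil_lin_left bil_lin_right x[symmetric] e by (simp add: algebra_simps)
  next
    show "indep_fam E (n + n) ?I U" unfolding indep_fam_def
    proof (intro allI impI)
      fix c assume c: "(\<forall>k\<in>?I. c k \<in> E) \<and> (\<forall>j<n + n. (\<Sum>k\<in>?I. c k * U k j) = 0)"
      define a where "a j = (\<Sum>p\<in>?I. c p * A p j)" for j
      define b where "b j = (\<Sum>p\<in>?I. c p * B p j)" for j
      \<comment> \<open>The second half of \<open>U\<close> makes the \<open>E\<close>-part
        \<open>a\<close> of the combined vector vanish. What remains is \<open>b s\<close>, and its
        isotropy gives \<open>Q(b) = 0\<close>, so \<open>b\<close> vanishes because
        \<open>Q\<close> is anisotropic over \<open>E\<close>.\<close>
      have a0: "a j = 0" if "j < n" for j using c that by (auto simp: a_def U_def dest!: spec[of _ "j + n"])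
      have bE: "b j \<in> E" if "j < n" for j unfolding b_def using AB that c by (intro subfield_closed E) auto
      define e where "e k = c (k, False) + c (k, True) * s" for k
      have w: "a j + b j * s = (\<Sum>k<m. e k * W k j)" if "j < n" for j
      proof -
        have "a j + b j * s = (\<Sum>p\<in>?I. c p * (A p j + B p j * s))"
          by (simp add: a_def b_def sum.distrib sum_distrib_left algebra_simps)
        also have "\<dots> = (\<Sum>p\<in>?I. c p * ((if snd p then s else 1) * W (fst p) j))"
          using ABW that by (intro sum.cong) auto
        also have "\<dots> = (\<Sum>k<m. e k * W k j)" by (simp add: sum_Times_bool e_def algebra_simps)
        finally show ?thesis .
      qed
      have "bil n Q (\<lambda>j. a j + b j * s) (\<lambda>j. a j + b j * s) =
          bil n Q (\<lambda>j. \<Sum>k<m. e k * W k j) (\<lambda>j. \<Sum>k<m. e k * W k j)"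
        using w by (intro bil_cong) auto
      also have "\<dots> = 0" by (rule iso_fam_comb[OF W])
      finally have "bil n Q a a + ?d * bil n Q b b = 0" using split[of a b a b] a0 bE subfield_0[OF E] by simp
      moreover have "bil n Q a a = 0" by (simp add: bil_def a0)
      moreover have "?d \<noteq> 0" using s(1) subfield_0[OF E] by auto
      ultimately have "bil n Q b b = 0" by simp
      hence "b j = 0" if "j < n" for j using an bE that unfolding isotr_def by blast
      hence "\<forall>j<n. (\<Sum>k<m. e k * W k j) = 0" using w a0 by (metis add.right_neutral mult_zero_left)
      moreover have "\<forall>k\<in>{..<m}. e k \<in> ?L" using c by (auto simp: e_def adjoin_root_def)
      ultimately have e0: "\<forall>k\<in>{..<m}. e k = 0" using W unfolding iso_fam_def indep_fam_def by blast
      show "\<forall>p\<in>?I. c p = 0"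
      proof
        fix p assume p: "p \<in> ?I"
        have "c (fst p, False) = 0 \<and> c (fst p, True) = 0"
          using adjoin_root_unique[OF E s(1), of "c (fst p, False)" "c (fst p, True)" 0 0] e0 p c subfield_0[OF E]
          by (auto simp: e_def)
        thus "c p = 0" by (cases p; cases "snd p") auto
      qed
    qed
  qed
  from tot_isoI[OF _ this] show ?thesis by (simp add: mult.commute)
qed

text \<open>The assumption \<open>gen\<close> concerns all \<open>E'\<close> over \<open>E\<close>
  because it is applied to \<open>E\<close> itself or to \<open>E(s)\<close>, according to whether
  \<open>Q\<close> is isotropic over \<open>E\<close>. The ambient field is algebraically closed so
  that it contains \<open>s\<close>. The bound \<open>n \<ge> 2\<close> provides a plane through
  \<open>v\<close> when \<open>u\<close> is a multiple of \<open>v\<close>.\<close>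

lemma tot_iso_dbl:
  fixes Q :: "nat \<Rightarrow> nat \<Rightarrow> 'a::alg_closed_field"
  assumes E: "is_subfield E" and n: "n \<ge> 2"
    and Q: "\<And>i j. i < n \<Longrightarrow> j < n \<Longrightarrow> Q i j \<in> E" "\<And>i j. i < n \<Longrightarrow> j < n \<Longrightarrow> Q i j = Q j i"
    and gen: "\<And>E'. is_subfield E' \<Longrightarrow> E \<subseteq> E' \<Longrightarrow> isotr E' n Q \<Longrightarrow> tot_iso E' n Q m"
    and a: "a \<in> E" and iso: "isotr E (n + n) (dbl n a Q)"
  shows "tot_iso E (n + n) (dbl n a Q) (2 * m)"
proof (cases "isotr E n Q")
  case True
  then obtain W where W: "iso_fam E n Q {..<m} W" using gen[OF E] by (auto simp: tot_iso_def)
  \<comment> \<open>Two copies of \<open>W\<close>, one in each orthogonal summand; the Boolean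
    selects the summand.\<close>
  define U where "U p j = (if snd p then (if j < n then 0 else W (fst p) (j - n)) else (if j < n then W (fst p) j else 0))"
    for p :: "nat \<times> bool" and j
  let ?I = "{..<m} \<times> (UNIV :: bool set)"
  have "iso_fam E (n + n) (dbl n a Q) ?I U" unfolding iso_fam_def
  proof (intro conjI ballI allI impI)
    fix p j assume "p \<in> ?I" "j < n + n"
    thus "U p j \<in> E" using W subfield_0[OF E] by (auto simp: U_def iso_fam_def)
  next
    fix p q assume pq: "p \<in> ?I" "q \<in> ?I"
    have 1: "bil n Q (U p) (U q) = (if snd p \<or> snd q then 0 else bil n Q (W (fst p)) (W (fst q)))"
      by (auto simp: bil_def U_def)
    have 2: "bil n Q (\<lambda>i. U p (i + n)) (\<lambda>i. U q (i + n)) = (if snd p \<and> snd q then bil n Q (W (fst p)) (W (fst q)) else 0)"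
      by (auto simp: bil_def U_def)
    show "bil (n + n) (dbl n a Q) (U p) (U q) = 0" unfolding bil_dbl 1 2 using W pq by (auto simp: iso_fam_def)
  next
    show "indep_fam E (n + n) ?I U" unfolding indep_fam_def
    proof (intro allI impI)
      fix c assume c: "(\<forall>k\<in>?I. c k \<in> E) \<and> (\<forall>j<n + n. (\<Sum>k\<in>?I. c k * U k j) = 0)"
      have cE: "c (k, \<epsilon>) \<in> E" if "k \<in> {..<m}" for k \<epsilon> using c that by blast
      have Wi: "indep_fam E n {..<m} W" using W by (simp add: iso_fam_def)
      have s1: "(\<Sum>k<m. c (k, False) * W k j) = 0" if "j < n" for j
        using c[THEN conjunct2, rule_format, of j] that unfolding sum_Times_bool by (simp add: U_def)
      have 1: "\<forall>k\<in>{..<m}. c (k, False) = 0"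
        using indep_famD[OF Wi, of "\<lambda>k. c (k, False)"] cE s1 by blast
      have s2: "(\<Sum>k<m. c (k, True) * W k j) = 0" if "j < n" for j
        using c[THEN conjunct2, rule_format, of "j + n"] that unfolding sum_Times_bool by (simp add: U_def)
      have 2: "\<forall>k\<in>{..<m}. c (k, True) = 0"
        using indep_famD[OF Wi, of "\<lambda>k. c (k, True)"] cE s2 by blast
      show "\<forall>p\<in>?I. c p = 0"
      proof
        fix p assume "p \<in> ?I"
        thus "c p = 0" using 1 2 by (cases p; cases "snd p") auto
      qed
    qed
  qed
  from tot_isoI[OF _ this] show ?thesis by (simp add: mult.commute)
next
  case False
  note an = False
  have an0: "\<forall>j<n. v j = 0" if "\<forall>j<n. v j \<in> E" "bil n Q v v = 0" for v
    using an that unfolding isotr_def by blast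
  obtain x where x: "\<forall>j<n + n. x j \<in> E" "\<exists>j<n + n. x j \<noteq> 0" "bil (n + n) (dbl n a Q) x x = 0"
    using iso by (auto simp: isotr_def)
  define u v where "u = x" and "v j = x (j + n)" for j
  have uE: "\<forall>j<n. u j \<in> E" and vE: "\<forall>j<n. v j \<in> E" using x by (auto simp: u_def v_def)
  have uv: "bil n Q u u = - a * bil n Q v v" using x(3) unfolding bil_dbl u_def v_def[abs_def] by (simp add: eq_neg_iff_add_eq_0)
  have v0: "\<exists>j<n. v j \<noteq> 0"
  proof (rule ccontr)
    assume *: "\<not> ?thesis"
    hence "bil n Q u u = 0" using uv by (simp add: bil_def)
    hence "\<forall>j<n. u j = 0" using an0 uE by blast
    with * x(2) show False
      by (metis add.commute le_add_diff_inverse2 linorder_not_less nat_add_left_cancel_less u_def v_def)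
  qed
  have Qv: "bil n Q v v \<noteq> 0" using v0 vE an0 by blast
  \<comment> \<open>This works with an arbitrary plane through \<open>v\<close>:
    \<open>s * s\<close> is minus its Gram determinant, so the plane is isotropic over
    \<open>E(s)\<close>, and \<open>s \<notin> E\<close> because \<open>Q\<close> is anisotropic
    over \<open>E\<close>.\<close>
  have sub: thesis if wE: "\<forall>j<n. w j \<in> E" and ind: "\<not> (\<exists>l\<in>E. \<forall>j<n. w j = l * v j)"
      and rl: "\<And>s. s * s = (bil n Q w v)\<^sup>2 - bil n Q w w * bil n Q v v \<Longrightarrow> s * s \<in> E \<Longrightarrow> s \<notin> E \<Longrightarrow> isotr (adjoin_root E s) n Q \<Longrightarrow> thesis"
    for w thesis
  proof -
    obtain s where s: "s * s = (bil n Q w v)\<^sup>2 - bil n Q w w * bil n Q v v"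
      by (metis nth_root_exists zero_less_numeral power2_eq_square)
    have QE: "bil n Q w v \<in> E" "bil n Q w w \<in> E" "bil n Q v v \<in> E"
      using wE vE Q(1) by (auto intro!: bil_closed[OF E])
    have sE: "s * s \<in> E" unfolding s by (intro subfield_closed E QE)
    \<comment> \<open>Solving \<open>Q(w + x v) = 0\<close> for the scalar \<open>x\<close> and
      clearing the denominator \<open>Q(v)\<close> gives this vector.\<close>
    define z where "z j = bil n Q v v * w j + (s - bil n Q w v) * v j" for j
    have vw: "bil n Q v w = bil n Q w v" using bil_sym Q(2) by blast
    have "bil n Q z z = bil n Q v v * (bil n Q v v * bil n Q w w - (bil n Q w v)\<^sup>2 + s * s)"
      unfolding z_def[abs_def] bil_lin_left bil_lin_right vw by (simp add: algebra_simps power2_eq_square)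
    hence z0: "bil n Q z z = 0" unfolding s by simp
    have nz: "\<exists>j<n. z j \<noteq> 0" if s': "s \<in> E \<or> s \<notin> E \<and> s \<in> adjoin_root E s"
    proof (rule ccontr)
      assume "\<not> ?thesis"
      hence *: "z j = 0" if "j < n" for j using that by blast
      have w: "w j = ((bil n Q w v - s) / bil n Q v v) * v j" if "j < n" for j
        using *[OF that] Qv by (simp add: z_def field_simps)
      have "s \<in> E"
      proof -
        obtain j where j: "j < n" "v j \<noteq> 0" using v0 by blast
        have "s = bil n Q w v - w j / v j * bil n Q v v" using w[OF j(1)] j Qv by (simp add: field_simps)
        thus ?thesis using j vE wE QE by (auto intro!: subfield_closed[OF E])
      qed
      hence "(bil n Q w v - s) / bil n Q v v \<in> E" using QE by (intro subfield_closed E)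
      with w ind show False by blast
    qed
    have "s \<notin> E"
    proof
      assume "s \<in> E"
      hence "\<forall>j<n. z j \<in> E" using wE vE QE by (auto simp: z_def intro!: subfield_closed[OF E])
      with an0 z0 nz \<open>s \<in> E\<close> show False by blast
    qed
    note L = subfield_adjoin_root[OF E this sE]
    have "\<forall>j<n. z j \<in> adjoin_root E s"
      using wE vE QE L by (auto simp: z_def intro!: subfield_closed[OF L(1)])
    hence "isotr (adjoin_root E s) n Q" using nz z0 L \<open>s \<notin> E\<close> unfolding isotr_def by blast
    thus thesis using rl[OF s sE] \<open>s \<notin> E\<close> by blast
  qed
  show ?thesis
  proof (cases "\<exists>l\<in>E. \<forall>j<n. u j = l * v j")
    case True
    then obtain l where l: "l \<in> E" "\<forall>j<n. u j = l * v j" by blast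
    have "bil n Q u u = bil n Q (\<lambda>j. l * v j) (\<lambda>j. l * v j)" using l by (intro bil_cong) auto
    hence "(- a) * bil n Q v v = (l * l) * bil n Q v v" using uv by (simp add: bil_scale_left bil_scale_right)
    hence "- a = l * l" using Qv mult_right_cancel by blast
    hence al: "a = - (l * l)" by (simp flip: \<open>- a = l * l\<close>)
    obtain j where j: "j < n" "v j \<noteq> 0" using v0 by blast
    obtain i where i: "i < n" "i \<noteq> j" using n using that[of 0] that[of 1] by fastforce
    \<comment> \<open>Here \<open>t\<close> is the square of \<open>l\<close>, which is the norm of
      \<open>l\<close> from any quadratic extension, so the second vector of the plane is arbitrary.
      This unit vector is not a multiple of \<open>v\<close>, since \<open>v j \<noteq> 0\<close>
      while \<open>w j = 0\<close>.\<close>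
    define w :: "nat \<Rightarrow> 'a" where "w k = (if k = i then 1 else 0)" for k
    have nw: "\<not> (\<exists>l\<in>E. \<forall>j<n. w j = l * v j)"
    proof
      assume "\<exists>l\<in>E. \<forall>j<n. w j = l * v j"
      then obtain c where "\<forall>j<n. w j = c * v j" by blast
      hence "w j = c * v j" "w i = c * v i" using i j by auto
      thus False using i j by (auto simp: w_def)
    qed
    have "\<forall>j<n. w j \<in> E" using E by (auto simp: w_def intro: subfield_closed)
    from this nw obtain s where s: "s * s \<in> E" "s \<notin> E" "isotr (adjoin_root E s) n Q" by (rule sub)
    note L = subfield_adjoin_root[OF E s(2,1)]
    have "tot_iso (adjoin_root E s) n Q m" using gen[OF L(1,2) s(3)] .
    from tot_iso_dbl_adjoin[OF E s(2,1) Q(1) an this l(1) subfield_0[OF E]] show ?thesis using al by simp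
  next
    case False
    with uE obtain s where s: "s * s = (bil n Q u v)\<^sup>2 - bil n Q u u * bil n Q v v" "s * s \<in> E" "s \<notin> E" "isotr (adjoin_root E s) n Q"
      by (rule sub) 
    note L = subfield_adjoin_root[OF E s(3,2)]
    have T: "tot_iso (adjoin_root E s) n Q m" using gen[OF L(1,2) s(4)] .
    have 1: "bil n Q u v / bil n Q v v \<in> E" "1 / bil n Q v v \<in> E"
      using uE vE Q(1) by (auto intro!: subfield_closed[OF E] bil_closed[OF E])
    \<comment> \<open>The element \<open>z = (B(u, v) + s) / Q(v)\<close> has norm
      \<open>Q(u) / Q(v)\<close>, which is \<open>t = -a\<close>.\<close>
    have 2: "- ((bil n Q u v / bil n Q v v) * (bil n Q u v / bil n Q v v) - s * s * (1 / bil n Q v v) * (1 / bil n Q v v)) = a"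
    proof -
      define b q where bq: "b = bil n Q u v" "q = bil n Q v v"
      have "s * s * (1 / q) * (1 / q) = (b * b + a * (q * q)) / (q * q)"
        unfolding s(1) uv bq by (simp add: power2_eq_square)
      also have "\<dots> = (b / q) * (b / q) + a" using Qv by (simp add: add_divide_distrib bq)
      finally show ?thesis unfolding bq by simp
    qed
    show ?thesis using tot_iso_dbl_adjoin[OF E s(3,2) Q(1) an T 1] unfolding 2 .
  qed
qed


section \<open>Evaluation of polynomials\<close>

abbreviation "coef \<equiv> Poly_Mapping.lookup"
abbreviation "supp \<equiv> Poly_Mapping.keys"
abbreviation "monomial \<equiv> Poly_Mapping.single"

text \<open>The set of variables is free because polynomials without the variable 0 play a special
  role: the equation of the quadric is solved for that variable.\<close>

definition polys_in :: "'a::field set \<Rightarrow> nat set \<Rightarrow> 'a mvpoly set" where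
  "polys_in K V = {f. (\<forall>m. coef f m \<in> K) \<and> (\<forall>m\<in>supp f. supp m \<subseteq> V)}"

lemma mv_polys_eq: "mv_polys K n = polys_in K {..<n}"
  by (simp add: mv_polys_def polys_in_def)

lemma polys_in_mono: "V \<subseteq> V' \<Longrightarrow> polys_in K V \<subseteq> polys_in K V'"
  by (auto simp: polys_in_def)

lemma polys_in_add:
  assumes "is_subfield K" "f \<in> polys_in K V" "g \<in> polys_in K V"
  shows "f + g \<in> polys_in K V"
proof -
  have "supp m \<subseteq> V" if "m \<in> supp (f + g)" for m
    using keys_add[of f g] that assms(2,3) unfolding polys_in_def by blast
  thus ?thesis using assms by (auto simp: polys_in_def lookup_add intro: subfield_add)
qed

lemma polys_in_single:
  "is_subfield K \<Longrightarrow> c \<in> K \<Longrightarrow> supp m \<subseteq> V \<Longrightarrow> monomial m c \<in> polys_in K V"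
  by (auto simp: polys_in_def lookup_single when_def intro: subfield_closed split: if_splits)

lemma polys_in_0: "is_subfield K \<Longrightarrow> 0 \<in> polys_in K V"
  by (simp add: polys_in_def subfield_0)

lemma polys_in_1: "is_subfield K \<Longrightarrow> 1 \<in> polys_in K V"
  using polys_in_single[of K 1 0 V] by (simp add: subfield_1)

lemma polys_in_sum:
  "is_subfield K \<Longrightarrow> (\<And>i. i \<in> I \<Longrightarrow> f i \<in> polys_in K V) \<Longrightarrow> (\<Sum>i\<in>I. f i) \<in> polys_in K V"
  by (induction I rule: infinite_finite_induct) (auto intro: polys_in_add polys_in_0)

lemma mvpoly_eq_sum: "f = (\<Sum>m\<in>supp f. monomial m (coef f m))"
proof (rule poly_mapping_eqI)
  fix k
  have "coef (\<Sum>m\<in>supp f. monomial m (coef f m)) k =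
    (\<Sum>m\<in>supp f. if m = k then coef f k else 0)"
    unfolding lookup_sum by (intro sum.cong) (auto simp: lookup_single when_def)
  also have "\<dots> = coef f k" by (simp add: in_keys_iff)
  finally show "coef f k =
    coef (\<Sum>m\<in>supp f. monomial m (coef f m)) k" by simp
qed

lemma mvpoly_mult_eq_sum:
  "f * g = (\<Sum>m\<in>supp f. \<Sum>m'\<in>supp g.
     monomial (m + m') (coef f m * coef g m'))"
  by (subst mvpoly_eq_sum[of f], subst mvpoly_eq_sum[of g]) (simp add: sum_product mult_single)

lemma keys_add_nat: "supp (m + m') = supp m \<union> supp m'"
  for m m' :: "'k \<Rightarrow>\<^sub>0 nat" by (auto simp: in_keys_iff lookup_add)

lemma polys_in_mult:
  assumes "is_subfield K" "f \<in> polys_in K V" "g \<in> polys_in K V"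
  shows "f * g \<in> polys_in K V"
  unfolding mvpoly_mult_eq_sum using assms
  by (intro polys_in_sum polys_in_single) (auto simp: polys_in_def keys_add_nat intro: subfield_closed)

lemma polys_in_const: "is_subfield K \<Longrightarrow> c \<in> K \<Longrightarrow> mv_const c \<in> polys_in K V"
  unfolding mv_const_def by (intro polys_in_single) auto

lemma polys_in_var: "is_subfield K \<Longrightarrow> i \<in> V \<Longrightarrow> mv_var i \<in> polys_in K V"
  unfolding mv_var_def by (intro polys_in_single) (auto intro: subfield_closed)

lemma polys_in_uminus: "is_subfield K \<Longrightarrow> f \<in> polys_in K V \<Longrightarrow> - f \<in> polys_in K V"
  by (auto simp: polys_in_def intro: subfield_closed)

lemma polys_in_diff: "is_subfield K \<Longrightarrow> f \<in> polys_in K V \<Longrightarrow> g \<in> polys_in K V \<Longrightarrow> f - g \<in> polys_in K V"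
  using polys_in_add[of K f V "- g"] polys_in_uminus by auto

lemma polys_in_power: "is_subfield K \<Longrightarrow> f \<in> polys_in K V \<Longrightarrow> f ^ k \<in> polys_in K V"
  by (induction k) (auto intro: polys_in_mult polys_in_1)

lemmas polys_in_closed = polys_in_add polys_in_mult polys_in_const polys_in_var polys_in_uminus
  polys_in_diff polys_in_sum polys_in_0 polys_in_1 polys_in_power

text \<open>A monomial is built up from powers of single variables, one variable at a time. The
  cases for sums and products carry membership in \<open>polys_in K V\<close>, since the
  homomorphisms considered are additive and multiplicative only there.\<close>

lemma polys_in_induct [consumes 2, case_names const var add mult]:
  assumes K: "is_subfield K" and f: "f \<in> polys_in K V"
    and const: "\<And>c. c \<in> K \<Longrightarrow> P (mv_const c)" and var: "\<And>i. i \<in> V \<Longrightarrow> P (mv_var i)"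
    and add: "\<And>f g. f \<in> polys_in K V \<Longrightarrow> g \<in> polys_in K V \<Longrightarrow> P f \<Longrightarrow> P g \<Longrightarrow> P (f + g)"
    and mult: "\<And>f g. f \<in> polys_in K V \<Longrightarrow> g \<in> polys_in K V \<Longrightarrow> P f \<Longrightarrow> P g \<Longrightarrow> P (f * g)"
  shows "P f"
proof -
  have P0: "P 0" using const[OF subfield_0[OF K]] by (simp add: mv_const_def)
  have P1: "P 1" using const[OF subfield_1[OF K]] by (simp add: mv_const_def)
  have var_power: "P (monomial (monomial i e) 1)" if "i \<in> V" for i e
  proof (induction e)
    case (Suc e)
    have eq: "monomial (monomial i (Suc e)) (1::'a) =
        mv_var i * monomial (monomial i e) 1"
      by (simp add: mv_var_def mult_single single_add[symmetric])
    have "mv_var i \<in> polys_in K V" "monomial (monomial i e) 1 \<in> polys_in K V"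
      using that by (auto intro!: polys_in_var polys_in_single K simp: subfield_1[OF K] split: if_splits)
    from mult[OF this var[OF that] Suc] show ?case unfolding eq .
  qed (use P1 in simp)
  have mon: "supp m \<subseteq> V \<Longrightarrow> P (monomial m 1)" for m
  proof (induction m rule: update_induct)
    case (update m i e)
    have eq: "Poly_Mapping.update i e m = monomial i e + m"
      using update(1) by (intro poly_mapping_eqI) (auto simp: lookup_update lookup_add lookup_single in_keys_iff)
    have V: "i \<in> V" "supp m \<subseteq> V" using update unfolding eq keys_add_nat by auto
    hence "monomial (monomial i e) 1 \<in> polys_in K V" "monomial m 1 \<in> polys_in K V"
      by (auto intro!: polys_in_single K simp: subfield_1[OF K] split: if_splits)
    from mult[OF this var_power[OF V(1)] update(3)[OF V(2)]] show ?case unfolding eq by (simp add: mult_single)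
  qed (use P1 in simp)
  have "P (\<Sum>m\<in>A. monomial m (coef f m))" if "finite A" "A \<subseteq> supp f" for A
    using that
  proof (induction A)
    case (insert m A)
    have m: "supp m \<subseteq> V" "coef f m \<in> K" using insert.prems f by (auto simp: polys_in_def)
    have "P (mv_const (coef f m) * monomial m 1)"
      using m K by (intro mult const mon polys_in_const polys_in_single) (auto intro: subfield_1)
    hence "P (monomial m (coef f m))" by (simp add: mv_const_def mult_single)
    moreover have "monomial k (coef f k) \<in> polys_in K V" if "k \<in> A" for k
      using f insert.prems that by (intro polys_in_single K) (auto simp: polys_in_def subset_iff)
    hence "(\<Sum>m\<in>A. monomial m (coef f m)) \<in> polys_in K V" by (intro polys_in_sum K)
    ultimately show ?case using insert m polys_in_single[OF K m(2,1)] by (simp add: add)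
  qed (use P0 in simp)
  from this[OF finite_keys subset_refl] show ?thesis using mvpoly_eq_sum[of f] by simp
qed

section \<open>Homomorphisms on a subset and evaluation at a point\<close>

lemma ring_hom_on_0:
  assumes "ring_hom_on R S f" "0 \<in> R"
  shows "f 0 = 0"
proof -
  have "f (0 + 0) = f 0 + f 0" using assms unfolding ring_hom_on_def by blast
  thus ?thesis by simp
qed

lemma ring_hom_on_add: "ring_hom_on R S f \<Longrightarrow> x \<in> R \<Longrightarrow> y \<in> R \<Longrightarrow> f (x + y) = f x + f y"
  and ring_hom_on_mult: "ring_hom_on R S f \<Longrightarrow> x \<in> R \<Longrightarrow> y \<in> R \<Longrightarrow> f (x * y) = f x * f y"
  and ring_hom_on_1: "ring_hom_on R S f \<Longrightarrow> f 1 = 1"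
  and ring_hom_on_in: "ring_hom_on R S f \<Longrightarrow> x \<in> R \<Longrightarrow> f x \<in> S"
  by (auto simp: ring_hom_on_def)

lemma ring_hom_on_uminus:
  assumes "ring_hom_on R S f" "0 \<in> R" "x \<in> R" "- x \<in> R"
  shows "f (- x) = - f x"
  using ring_hom_on_add[OF assms(1,3,4)] ring_hom_on_0[OF assms(1,2)] by (simp add: eq_neg_iff_add_eq_0 add.commute)

lemma ring_hom_on_sum:
  assumes "ring_hom_on R S f" "0 \<in> R" "\<And>x y. x \<in> R \<Longrightarrow> y \<in> R \<Longrightarrow> x + y \<in> R" "\<And>i. i \<in> I \<Longrightarrow> g i \<in> R"
  shows "f (\<Sum>i\<in>I. g i) = (\<Sum>i\<in>I. f (g i))"
proof -
  have "(\<Sum>i\<in>I. g i) \<in> R \<and> f (\<Sum>i\<in>I. g i) = (\<Sum>i\<in>I. f (g i))" using assms(4)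
    by (induction I rule: infinite_finite_induct)
      (auto simp: ring_hom_on_0[OF assms(1,2)] assms(2,3) ring_hom_on_add[OF assms(1)])
  thus ?thesis ..
qed

lemma ring_hom_on_inj:
  fixes f :: "'a::field \<Rightarrow> 'b::field"
  assumes "ring_hom_on K S f" "is_subfield K" "x \<in> K" "f x = 0"
  shows "x = 0"
proof (rule ccontr)
  assume "x \<noteq> 0"
  hence "f (x * inverse x) = 1" using ring_hom_on_1[OF assms(1)] by simp
  thus False using ring_hom_on_mult[OF assms(1,3) subfield_inverse[OF assms(2,3)]] assms(4) by simp
qed

definition monom_val :: "(nat \<Rightarrow> 'b::field) \<Rightarrow> (nat \<Rightarrow>\<^sub>0 nat) \<Rightarrow> 'b" where
  "monom_val x m = (\<Prod>i\<in>supp m. x i ^ coef m i)"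

text \<open>The coefficients are carried along \<open>\<sigma>\<close> into another type, because
  the points have coordinates in fields over the image of \<open>K\<close>, not over
  \<open>K\<close> itself.\<close>

definition ev :: "('a::field \<Rightarrow> 'b::field) \<Rightarrow> (nat \<Rightarrow> 'b) \<Rightarrow> 'a mvpoly \<Rightarrow> 'b" where
  "ev \<sigma> x f = (\<Sum>m\<in>supp f. \<sigma> (coef f m) * monom_val x m)"

lemma monom_val_superset:
  "finite A \<Longrightarrow> supp m \<subseteq> A \<Longrightarrow> monom_val x m = (\<Prod>i\<in>A. x i ^ coef m i)"
  unfolding monom_val_def by (intro prod.mono_neutral_left) (auto simp: in_keys_iff)

lemma monom_val_add: "monom_val x (m + m') = monom_val x m * monom_val x m'"
proof -
  let ?A = "supp m \<union> supp m'"
  show ?thesis by (subst (1 2 3) monom_val_superset[of ?A])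
      (auto simp: keys_add_nat lookup_add power_add prod.distrib)
qed

context
  fixes K :: "'a::field set" and \<sigma> :: "'a \<Rightarrow> 'b::field" and S :: "'b set"
  assumes K: "is_subfield K" and \<sigma>: "ring_hom_on K S \<sigma>"
begin

lemma hom0: "\<sigma> 0 = 0" by (rule ring_hom_on_0[OF \<sigma> subfield_0[OF K]])

lemma ev_superset:
  "finite A \<Longrightarrow> supp f \<subseteq> A \<Longrightarrow> ev \<sigma> x f = (\<Sum>m\<in>A. \<sigma> (coef f m) * monom_val x m)"
  unfolding ev_def by (intro sum.mono_neutral_left) (auto simp: in_keys_iff hom0)

lemma ev_add:
  assumes "f \<in> polys_in K V" "g \<in> polys_in K V"
  shows "ev \<sigma> x (f + g) = ev \<sigma> x f + ev \<sigma> x g"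
proof -
  let ?A = "supp f \<union> supp g"
  have "\<sigma> (coef (f + g) m) = \<sigma> (coef f m) + \<sigma> (coef g m)" for m
    unfolding lookup_add using assms by (intro ring_hom_on_add[OF \<sigma>]) (auto simp: polys_in_def)
  thus ?thesis
    using keys_add[of f g] by (subst (1 2 3) ev_superset[of ?A]) (auto simp: algebra_simps sum.distrib)
qed

lemma ev_single: "ev \<sigma> x (monomial m c) = \<sigma> c * monom_val x m"
  by (simp add: ev_def hom0)

lemma ev_sum:
  assumes "\<And>i. i \<in> I \<Longrightarrow> f i \<in> polys_in K V"
  shows "ev \<sigma> x (\<Sum>i\<in>I. f i) = (\<Sum>i\<in>I. ev \<sigma> x (f i))"
  using assms
proof (induction I rule: infinite_finite_induct)
  case (insert i I)
  thus ?case using ev_add[of "f i" V "\<Sum>i\<in>I. f i"] polys_in_sum[OF K, of I f V] by simp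
qed (auto simp: ev_def)

lemma ev_mult:
  assumes f: "f \<in> polys_in K V" and g: "g \<in> polys_in K V"
  shows "ev \<sigma> x (f * g) = ev \<sigma> x f * ev \<sigma> x g"
proof -
  have 1: "monomial (m + m') (coef f m * coef g m') \<in> polys_in K V"
    if "m \<in> supp f" "m' \<in> supp g" for m m'
    using f g that by (intro polys_in_single K) (auto simp: polys_in_def keys_add_nat intro: subfield_closed K)
  have "ev \<sigma> x (f * g) = (\<Sum>m\<in>supp f. \<Sum>m'\<in>supp g.
      \<sigma> (coef f m * coef g m') * monom_val x (m + m'))" unfolding mvpoly_mult_eq_sum
    by (subst ev_sum, blast intro: polys_in_sum[OF K] 1) (intro sum.cong refl, subst ev_sum, blast intro: 1, simp add: ev_single)
  also have "\<dots> = (\<Sum>m\<in>supp f. \<Sum>m'\<in>supp g.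
      (\<sigma> (coef f m) * monom_val x m) * (\<sigma> (coef g m') * monom_val x m'))"
    using f g by (intro sum.cong refl) (subst ring_hom_on_mult[OF \<sigma>], auto simp: polys_in_def monom_val_add)
  also have "\<dots> = ev \<sigma> x f * ev \<sigma> x g" by (simp add: ev_def sum_product)
  finally show ?thesis .
qed

lemma ev_const: "ev \<sigma> x (mv_const c) = \<sigma> c"
  unfolding mv_const_def ev_single by (simp add: monom_val_def)

lemma ev_var: "ev \<sigma> x (mv_var i) = x i"
  unfolding mv_var_def ev_single by (simp add: monom_val_def ring_hom_on_1[OF \<sigma>])

lemma ev_ring_hom: "ring_hom_on (polys_in K V) UNIV (ev \<sigma> x)"
  unfolding ring_hom_on_def using ev_add ev_mult ev_const[of x 1] ring_hom_on_1[OF \<sigma>]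
  by (auto simp: mv_const_def)

lemma ev_in:
  assumes f: "f \<in> polys_in K V" and E: "is_subfield E" "\<sigma> ` K \<subseteq> E" "\<And>i. i \<in> V \<Longrightarrow> x i \<in> E"
  shows "ev \<sigma> x f \<in> E"
  using K f
proof (induction rule: polys_in_induct)
  case (add f g) thus ?case using ev_add E by (auto intro: subfield_closed)
next
  case (mult f g) thus ?case using ev_mult E by (auto intro: subfield_closed)
qed (use E in \<open>auto simp: ev_const ev_var\<close>)

end

lemma ev_cong:
  assumes "f \<in> polys_in K V" "\<And>i. i \<in> V \<Longrightarrow> x i = y i"
  shows "ev \<sigma> x f = ev \<sigma> y f"
proof -
  have "monom_val x m = monom_val y m" if "m \<in> supp f" for m
    unfolding monom_val_def using assms that by (intro prod.cong) (auto simp: polys_in_def subset_iff)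
  thus ?thesis unfolding ev_def by (intro sum.cong) auto
qed

text \<open>Uniqueness of base \<open>B\<close> digits makes the substitution of
  \<open>t ^ (B ^ i)\<close> for the variable \<open>i\<close> injective on monomials whose
  exponents are below \<open>B\<close>.\<close>

lemma digits_unique:
  fixes a b :: "nat \<Rightarrow> nat"
  assumes "\<And>i. i < n \<Longrightarrow> a i < B" "\<And>i. i < n \<Longrightarrow> b i < B"
    "(\<Sum>i<n. a i * B ^ i) = (\<Sum>i<n. b i * B ^ i)"
  shows "\<forall>i<n. a i = b i"
  using assms
proof (induction n)
  case (Suc n)
  have less: "(\<Sum>i<n. c i * B ^ i) < B ^ n" if "\<And>i. i < n \<Longrightarrow> c i < B" for c :: "nat \<Rightarrow> nat"
    using that
  proof (induction n)
    case (Suc n)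
    have "(\<Sum>i<Suc n. c i * B ^ i) < B ^ n + c n * B ^ n" using Suc by simp
    also have "\<dots> = Suc (c n) * B ^ n" by simp
    also have "\<dots> \<le> B * B ^ n" using Suc.prems[of n] by (intro mult_right_mono) auto
    finally show ?case by simp
  qed simp
  have "a n = b n"
  proof -
    have B: "B ^ n > 0" using Suc.prems(1)[of n] by simp
    have "a n = (\<Sum>i<Suc n. a i * B ^ i) div B ^ n" using less[of a] Suc.prems(1) B by simp
    also have "\<dots> = b n" unfolding Suc.prems(3) using less[of b] Suc.prems(2) B by simp
    finally show ?thesis .
  qed
  with Suc show ?case by (auto simp: less_Suc_eq)
qed simp

text \<open>Kronecker substitution reduces this to polynomials in one variable.\<close>

lemma ev_nonzero:
  fixes \<sigma> :: "'a::field \<Rightarrow> 'b::field"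
  assumes K: "is_subfield K" and \<sigma>: "ring_hom_on K S \<sigma>" and inf: "infinite (UNIV :: 'b set)"
    and f: "f \<in> polys_in K {..<n}" "f \<noteq> 0"
  shows "\<exists>x. ev \<sigma> x f \<noteq> 0"
proof -
  let ?ks = "supp f"
  \<comment> \<open>One more than the sum of all exponents that occur, hence larger than each of
    them.\<close>
  define B where "B = Suc (\<Sum>m\<in>?ks. \<Sum>i<n. coef m i)"
  have B: "coef m i < B" if "m \<in> ?ks" "i < n" for m i
  proof -
    have "coef m i \<le> (\<Sum>i<n. coef m i)" using that by (intro member_le_sum) auto
    also have "\<dots> \<le> (\<Sum>m\<in>?ks. \<Sum>i<n. coef m i)"
      using that by (intro member_le_sum[of m ?ks "\<lambda>m. \<Sum>i<n. coef m i"]) auto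
    finally show ?thesis by (simp add: B_def)
  qed
  define wt where "wt m = (\<Sum>i<n. coef m i * B ^ i)" for m :: "nat \<Rightarrow>\<^sub>0 nat"
  have kn: "supp m \<subseteq> {..<n}" if "m \<in> ?ks" for m using f that by (auto simp: polys_in_def)
  have inj: "m = m'" if "m \<in> ?ks" "m' \<in> ?ks" "wt m = wt m'" for m m'
  proof (rule poly_mapping_eqI)
    fix i
    have "\<forall>i<n. coef m i = coef m' i"
      using that B by (intro digits_unique[of _ _ B]) (auto simp: wt_def)
    moreover have "coef m i = 0 \<and> coef m' i = 0" if "\<not> i < n"
      using kn[OF \<open>m \<in> ?ks\<close>] kn[OF \<open>m' \<in> ?ks\<close>] that by (auto simp: in_keys_iff)
    ultimately show "coef m i = coef m' i" by metis
  qed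
  define P where "P = (\<Sum>m\<in>?ks. Polynomial.monom (\<sigma> (coef f m)) (wt m))"
  have ev: "ev \<sigma> (\<lambda>i. t ^ (B ^ i)) f = poly P t" for t
  proof -
    have "monom_val (\<lambda>i. t ^ (B ^ i)) m = t ^ wt m" if "m \<in> ?ks" for m
      using kn[OF that] by (subst monom_val_superset[of "{..<n}"])
        (auto simp: wt_def power_sum power_mult[symmetric] mult.commute)
    thus ?thesis unfolding ev_def P_def poly_sum by (intro sum.cong) (auto simp: poly_monom)
  qed
  obtain m0 where m0: "m0 \<in> ?ks" using f(2) by fastforce
  have "Polynomial.coeff P (wt m0) = (\<Sum>m\<in>?ks. if m = m0 then \<sigma> (coef f m) else 0)"
    unfolding P_def coeff_sum using inj m0 by (intro sum.cong) auto
  also have "\<dots> = \<sigma> (coef f m0)" using m0 by simp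
  also have "\<dots> \<noteq> 0" using ring_hom_on_inj[OF \<sigma> K] f m0 by (auto simp: polys_in_def in_keys_iff)
  finally have "P \<noteq> 0" by auto
  hence "finite {t. poly P t = 0}" by (rule poly_roots_finite)
  hence "{t. poly P t = 0} \<noteq> UNIV" using inf by auto
  then obtain t where "poly P t \<noteq> 0" by auto
  thus ?thesis unfolding ev[symmetric] by blast
qed

text \<open>Serves to compose a polynomial with a parametrisation of the quadric as functions: the
  composite is recognised by closure under the ring operations, without expanding it into
  monomials.\<close>

inductive polyfun :: "((nat \<Rightarrow> 'b::field) \<Rightarrow> 'b) \<Rightarrow> bool" where
  const: "polyfun (\<lambda>_. c)"
| coord: "polyfun (\<lambda>w. w i)"
| add: "polyfun f \<Longrightarrow> polyfun g \<Longrightarrow> polyfun (\<lambda>w. f w + g w)"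
| mult: "polyfun f \<Longrightarrow> polyfun g \<Longrightarrow> polyfun (\<lambda>w. f w * g w)"

lemma polyfun_diff:
  assumes "polyfun f" "polyfun g"
  shows "polyfun (\<lambda>w. f w - g w)"
  using polyfun.add[OF assms(1) polyfun.mult[OF polyfun.const[of "-1"] assms(2)]] by simp

lemma polyfun_sum: "(\<And>i. i \<in> I \<Longrightarrow> polyfun (f i)) \<Longrightarrow> polyfun (\<lambda>w. \<Sum>i\<in>I. f i w)"
  by (induction I rule: infinite_finite_induct) (auto intro: polyfun.intros)

lemma polyfun_bil: "(\<And>i. polyfun (u i)) \<Longrightarrow> (\<And>i. polyfun (v i)) \<Longrightarrow> polyfun (\<lambda>w. bil n Q (\<lambda>i. u i w) (\<lambda>i. v i w))"
  unfolding bil_def by (intro polyfun_sum polyfun.intros)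

lemma polyfun_ev:
  assumes K: "is_subfield K" and \<sigma>: "ring_hom_on K S \<sigma>" and f: "f \<in> polys_in K V" and u: "\<And>i. polyfun (u i)"
  shows "polyfun (\<lambda>w. ev \<sigma> (\<lambda>i. u i w) f)"
  using K f by (induction rule: polys_in_induct)
    (auto simp: ev_const[OF K \<sigma>] ev_var[OF K \<sigma>] ev_add[OF K \<sigma>] ev_mult[OF K \<sigma>] intro: polyfun.intros u)

lemma polyfun_poly:
  assumes "polyfun G"
  shows "\<exists>P. \<forall>t. G (x(i := t)) = poly P t"
  using assms
proof induction
  case (const c) show ?case by (intro exI[of _ "[:c:]"]) simp
next
  case (coord j) show ?case by (intro exI[of _ "if i = j then [:0, 1:] else [:x j:]"]) auto
next
  case (add f g) thus ?case by (metis poly_add)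
next
  case (mult f g) thus ?case by (metis poly_mult)
qed

text \<open>The coordinates are freed from \<open>E\<close> one at a time: as a function of
  coordinate \<open>k\<close> alone, \<open>G\<close> is a polynomial in one variable with
  infinitely many zeros. Coordinates from \<open>n\<close> on are arbitrary from the start.\<close>

lemma polyfun_eq_0:
  assumes G: "polyfun G" and E: "infinite E" and 0: "\<And>x. (\<And>i. i < n \<Longrightarrow> x i \<in> E) \<Longrightarrow> G x = 0"
  shows "G x = 0"
proof -
  have "k \<le> n \<Longrightarrow> (\<forall>x. (\<forall>i. k \<le> i \<and> i < n \<longrightarrow> x i \<in> E) \<longrightarrow> G x = 0)" for k
  proof (induction k)
    case (Suc k)
    show ?case
    proof (intro allI impI)
      fix x assume x: "\<forall>i. Suc k \<le> i \<and> i < n \<longrightarrow> x i \<in> E"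
      obtain P where P: "\<And>t. G (x(k := t)) = poly P t" using polyfun_poly[OF G] by blast
      have "poly P t = 0" if "t \<in> E" for t unfolding P[symmetric] using Suc x that
        by (metis Suc_le_lessD fun_upd_apply le_antisym less_imp_le not_less_eq_eq)
      hence "E \<subseteq> {t. poly P t = 0}" by blast
      hence "P = 0" using E poly_roots_finite finite_subset by blast
      thus "G x = 0" using P[of "x k"] by simp
    qed
  qed (use 0 in auto)
  from this[of n] show ?thesis by auto
qed


section \<open>Points on an isotropic quadric\<close>

lemma subfield_2: "is_subfield K \<Longrightarrow> 2 \<in> K"
  using subfield_add[OF _ subfield_1 subfield_1] by (metis one_add_one)

text \<open>The isotropic vectors over \<open>E\<close> span the whole space; \<open>y\<close>
  itself may have coordinates outside \<open>E\<close>. Reflecting a fixed isotropic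
  \<open>v\<close> along \<open>w\<close> gives another isotropic vector, which forces
  \<open>w\<close> to be orthogonal to \<open>y\<close> whenever \<open>w\<close> is not orthogonal
  to \<open>v\<close>. A unit vector orthogonal to \<open>v\<close> is a difference of two vectors
  that are not.\<close>

lemma isotropic_orthogonal_trivial:
  fixes q :: "nat \<Rightarrow> nat \<Rightarrow> 'a::field"
  assumes E: "is_subfield E" and two: "(2::'a) \<noteq> 0"
    and q: "\<And>i j. i < n \<Longrightarrow> j < n \<Longrightarrow> q i j \<in> E" "\<And>i j. i < n \<Longrightarrow> j < n \<Longrightarrow> q i j = q j i"
    and nondeg: "\<And>y. \<forall>i<n. (\<Sum>j<n. q i j * y j) = 0 \<Longrightarrow> \<forall>j<n. y j = 0"
    and iso: "isotr E n q"
    and y: "\<And>v. \<forall>i<n. v i \<in> E \<Longrightarrow> bil n q v v = 0 \<Longrightarrow> bil n q v y = 0"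
  shows "\<forall>j<n. y j = 0"
proof -
  obtain v where v: "\<forall>j<n. v j \<in> E" "\<exists>j<n. v j \<noteq> 0" "bil n q v v = 0"
    using iso by (auto simp: isotr_def)
  have sym: "bil n q a b = bil n q b a" for a b by (intro bil_sym q(2))
  have main: "bil n q w y = 0" if w: "\<forall>i<n. w i \<in> E" "bil n q v w \<noteq> 0" for w
  proof -
    \<comment> \<open>The reflection of \<open>v\<close> along \<open>w\<close>, multiplied by the
      value of the form at \<open>w\<close> so that isotropic \<open>w\<close> are covered
      too.\<close>
    define x where "x i = bil n q w w * v i + (- 2 * bil n q v w) * w i" for i
    have "\<forall>i<n. x i \<in> E"
      unfolding x_def using v w q E by (intro allI impI subfield_closed bil_closed subfield_2) auto
    moreover have "bil n q x x = 0"
      unfolding x_def[abs_def] bil_lin_left bil_lin_right using v(3) sym[of w v] by (simp add: algebra_simps)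
    ultimately have "bil n q x y = 0" by (rule y)
    hence "bil n q w w * bil n q v y + (- 2 * bil n q v w) * bil n q w y = 0"
      unfolding x_def[abs_def] bil_lin_left .
    moreover have "bil n q v y = 0" using y v by blast
    ultimately show ?thesis using w two by simp
  qed
  define e :: "nat \<Rightarrow> nat \<Rightarrow> 'a" where "e i k = (if k = i then 1 else 0)" for i k
  have eE: "\<forall>k<n. e i k \<in> E" for i using E by (auto simp: e_def intro: subfield_closed)
  have be: "bil n q (e i) u = (\<Sum>j<n. q i j * u j)" if "i < n" for i u
  proof -
    have "bil n q (e i) u = (\<Sum>k<n. if k = i then \<Sum>j<n. q k j * u j else 0)"
      unfolding bil_def by (intro sum.cong refl) (auto simp: e_def)
    thus ?thesis using that by simp
  qed
  obtain k where k: "k < n" "bil n q v (e k) \<noteq> 0"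
  proof (rule ccontr)
    assume "\<not> thesis"
    hence "\<forall>i<n. bil n q (e i) v = 0" using that sym by metis
    hence "\<forall>i<n. (\<Sum>j<n. q i j * v j) = 0" by (simp add: be)
    with nondeg v show False by blast
  qed
  have "bil n q (e i) y = 0" if "i < n" for i
  proof (cases "bil n q v (e i) = 0")
    case True
    define w where "w j = 1 * e i j + 1 * e k j" for j
    have "bil n q w y = 0"
    proof (rule main)
      show "\<forall>j<n. w j \<in> E" using eE by (auto simp: w_def intro!: subfield_closed[OF E])
      show "bil n q v w \<noteq> 0" unfolding w_def[abs_def] bil_lin_right using True k by simp
    qed
    moreover have "bil n q (e k) y = 0" using main[OF eE k(2)] .
    ultimately show ?thesis unfolding w_def[abs_def] bil_lin_left by simp
  qed (use main eE in blast)
  hence "\<forall>i<n. (\<Sum>j<n. q i j * y j) = 0" by (simp add: be)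
  thus ?thesis by (rule nondeg)
qed

text \<open>This is a quadratic equation for coordinate \<open>k\<close>, with leading coefficient
  \<open>q k k\<close>.\<close>

lemma ex_isotropic_fun_upd:
  fixes q :: "nat \<Rightarrow> nat \<Rightarrow> 'a::alg_closed_field"
  assumes k: "k < n" and q: "q k k \<noteq> 0"
  shows "\<exists>c. bil n q (x(k := c)) (x(k := c)) = 0"
proof -
  define e :: "nat \<Rightarrow> 'a" where "e i = (if i = k then 1 else 0)" for i
  define x0 where "x0 = x(k := 0)"
  define f where "f i = (if i = 0 then bil n q x0 x0 else if i = 1 then bil n q e x0 + bil n q x0 e else q k k)" for i :: nat
  obtain c where "(\<Sum>i\<le>2. f i * c ^ i) = 0" using alg_closed[of 2 f] q by (auto simp: f_def)
  hence c: "bil n q x0 x0 + (bil n q e x0 + bil n q x0 e) * c + q k k * c\<^sup>2 = 0"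
    by (simp add: f_def numeral_2_eq_2)
  have ee: "bil n q e e = q k k"
  proof -
    have "bil n q e e = (\<Sum>i<n. if i = k then \<Sum>j<n. if j = k then q i j else 0 else 0)"
      unfolding bil_def e_def by (intro sum.cong refl) (simp add: if_distrib cong: if_cong)
    thus ?thesis using k by simp
  qed
  have "x(k := c) = (\<lambda>i. c * e i + 1 * x0 i)" by (auto simp: e_def x0_def)
  hence "bil n q (x(k := c)) (x(k := c)) = bil n q x0 x0 + (bil n q e x0 + bil n q x0 e) * c + q k k * c\<^sup>2"
    by (simp only: bil_lin_left bil_lin_right ee) (simp add: algebra_simps power2_eq_square)
  thus ?thesis using c by auto
qed

text \<open>
  The points \<open>c (q(w) v - 2 b(v, w) w)\<close> with \<open>v\<close> isotropic lie on the quadric and depend polynomially on \<open>(c, w)\<close>, so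
  a polynomial that vanishes at all points over \<open>E\<close> vanishes at all points over the ambient field that are not
  orthogonal to \<open>v\<close>.
\<close>

lemma ex_point_nonvanishing:
  fixes \<sigma> :: "'a::field \<Rightarrow> 'd::alg_closed_field"
  assumes K: "is_subfield K" and \<sigma>: "ring_hom_on K S \<sigma>" and n: "n > 0" and two: "(2::'d) \<noteq> 0"
    and q_def: "q = (\<lambda>i j. \<sigma> (Q i j))"
    and Q: "\<And>i j. i < n \<Longrightarrow> j < n \<Longrightarrow> Q i j \<in> K" "\<And>i j. i < n \<Longrightarrow> j < n \<Longrightarrow> Q i j = Q j i" "Q 0 0 \<noteq> 0"
    and nondeg: "\<And>y. \<forall>i<n. (\<Sum>j<n. q i j * y j) = 0 \<Longrightarrow> \<forall>j<n. y j = 0"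
    and E: "is_subfield E" "\<sigma> ` K \<subseteq> E" "infinite E" and iso: "isotr E n q"
    and N: "N \<in> polys_in K {0<..<n}" "N \<noteq> 0"
  shows "\<exists>x. (\<forall>i<n. x i \<in> E) \<and> bil n q x x = 0 \<and> ev \<sigma> x N \<noteq> 0"
proof (rule ccontr)
  assume "\<not> ?thesis"
  hence van: "ev \<sigma> x N = 0" if "\<forall>i<n. x i \<in> E" "bil n q x x = 0" for x using that by blast
  have qE: "q i j \<in> E" "q i j = q j i" if "i < n" "j < n" for i j
    using Q(1,2)[OF that] E by (auto simp: q_def)
  have "infinite (UNIV :: 'd set)" using E(3) finite_subset[of E UNIV] by blast
  moreover have Nn: "N \<in> polys_in K {..<n}" using N(1) polys_in_mono[of "{0<..<n}" "{..<n}" K] by fastforce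
  ultimately obtain x0 where x0: "ev \<sigma> x0 N \<noteq> 0" using ev_nonzero[OF K \<sigma>] N(2) by metis
  have "q 0 0 \<noteq> 0" using Q n ring_hom_on_inj[OF \<sigma> K, of "Q 0 0"] by (auto simp: q_def)
  \<comment> \<open>\<open>N\<close> does not involve the variable 0, so coordinate 0 can be moved
    until the point lies on the quadric while \<open>N\<close> keeps its nonzero value.\<close>
  then obtain c where c: "bil n q (x0(0 := c)) (x0(0 := c)) = 0"
    using ex_isotropic_fun_upd[of 0 n q x0] n by blast
  define y where "y = x0(0 := c)"
  have evy: "ev \<sigma> y N \<noteq> 0" using ev_cong[OF N(1), of y x0 \<sigma>] x0 by (auto simp: y_def)
  have y: "bil n q y y = 0" using c by (simp add: y_def)
  \<comment> \<open>The zero vector counts as a point over \<open>E\<close> on the quadric, so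
    \<open>N\<close> vanishes there by assumption.\<close>
  have y0: "\<not> (\<forall>j<n. y j = 0)"
  proof
    assume "\<forall>j<n. y j = 0"
    hence "ev \<sigma> y N = ev \<sigma> (\<lambda>_. 0) N" using ev_cong[OF Nn, of y "\<lambda>_. 0" \<sigma>] by auto
    moreover have "ev \<sigma> (\<lambda>_. 0) N = 0" using subfield_0[OF E(1)] by (intro van) (auto simp: bil_def)
    ultimately show False using evy by simp
  qed
  then obtain v where v: "\<forall>i<n. v i \<in> E" "bil n q v v = 0" "bil n q v y \<noteq> 0"
    using isotropic_orthogonal_trivial[OF E(1) two qE nondeg iso, of y] by blast
  \<comment> \<open>The scalar \<open>c\<close> of the parametrisation is stored as coordinate
    \<open>n\<close> of \<open>w\<close>, so that the parameters form a single tuple of length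
    \<open>Suc n\<close>.\<close>
  define u where "u i w = w n * (bil n q w w * v i - (2 * bil n q v w) * w i)" for i and w :: "nat \<Rightarrow> 'd"
  define G where "G w = ev \<sigma> (\<lambda>i. u i w) N" for w
  have "polyfun (u i)" for i
    unfolding u_def by (intro polyfun.mult polyfun_diff polyfun.coord polyfun.const polyfun_bil)
  hence "polyfun G" unfolding G_def[abs_def] by (intro polyfun_ev[OF K \<sigma> N(1)])
  moreover have "G w = 0" if w: "\<And>i. i < Suc n \<Longrightarrow> w i \<in> E" for w unfolding G_def
  proof (rule van)
    show "\<forall>i<n. u i w \<in> E"
      unfolding u_def using w v qE by (intro allI impI subfield_closed E(1) bil_closed subfield_2) auto
    have "bil n q (\<lambda>i. u i w) (\<lambda>i. u i w) =
        bil n q (\<lambda>i. (w n * bil n q w w) * v i + (- w n * (2 * bil n q v w)) * w i)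
          (\<lambda>i. (w n * bil n q w w) * v i + (- w n * (2 * bil n q v w)) * w i)"
      by (intro bil_cong) (auto simp: u_def algebra_simps)
    also have "\<dots> = 0"
      unfolding bil_lin_left bil_lin_right using v(2) bil_sym[of n q w v, OF qE(2)] by (simp add: algebra_simps)
    finally show "bil n q (\<lambda>i. u i w) (\<lambda>i. u i w) = 0" .
  qed
  ultimately have G0: "G w = 0" for w using polyfun_eq_0[OF _ E(3), of G "Suc n" w] by blast
  \<comment> \<open>As \<open>y\<close> is isotropic, the term with \<open>v\<close> drops out of
    the parametrisation, and this scalar turns the other term into \<open>y\<close>.\<close>
  define w where "w = y(n := - 1 / (2 * bil n q v y))"
  have "bil n q w w = bil n q y y" "bil n q v w = bil n q v y" by (intro bil_cong; auto simp: w_def)+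
  hence "u i w = y i" if "i < n" for i using that two v(3) y by (simp add: u_def w_def)
  hence "G w = ev \<sigma> y N" unfolding G_def by (intro ev_cong[OF Nn]) auto
  with G0 evy show False by simp
qed

section \<open>The function field of a quadric\<close>

text \<open>
  The image of \<open>K[X\<^sub>0, \<dots>]\<close> is \<open>S + S X\<^sub>0\<close> with \<open>S\<close> the image of the polynomials without \<open>X\<^sub>0\<close>; \<open>N\<close> is the norm
  of \<open>d\<close>, or its trace if the norm is 0.
\<close>

lemma ex_multiple_without_var0:
  fixes \<psi> :: "'a::field mvpoly \<Rightarrow> 'c::field"
  assumes K: "is_subfield K" and \<psi>: "ring_hom_on (polys_in K {..<n}) M \<psi>" and n: "n > 0"
    and Q: "\<And>i j. i < n \<Longrightarrow> j < n \<Longrightarrow> Q i j \<in> K" "Q 0 0 \<noteq> 0"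
    and iso: "bil n (\<lambda>i j. \<psi> (mv_const (Q i j))) (\<lambda>i. \<psi> (mv_var i)) (\<lambda>i. \<psi> (mv_var i)) = 0"
    and d: "d \<in> polys_in K {..<n}" "\<psi> d \<noteq> 0"
  shows "\<exists>N\<in>polys_in K {0<..<n}. \<exists>g\<in>polys_in K {..<n}. \<psi> N \<noteq> 0 \<and> \<psi> d * \<psi> g = \<psi> N"
proof -
  let ?R = "polys_in K {..<n}" and ?R' = "polys_in K {0<..<n}"
  have R'R: "f \<in> ?R" if "f \<in> ?R'" for f using that polys_in_mono[of "{0<..<n}" "{..<n}" K] by fastforce
  define S where "S = image \<psi> ?R'"
  define \<xi> where "\<xi> = \<psi> (mv_var 0)"
  note hom = ring_hom_on_add[OF \<psi>] ring_hom_on_mult[OF \<psi>]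
  have SI: "\<psi> f \<in> S" if "f \<in> ?R'" for f using that by (auto simp: S_def)
  have S_add: "a + b \<in> S" and S_mult: "a * b \<in> S" if ab: "a \<in> S" "b \<in> S" for a b
  proof -
    obtain f g where "f \<in> ?R'" "g \<in> ?R'" "a = \<psi> f" "b = \<psi> g" using ab unfolding S_def by blast
    thus "a + b \<in> S" "a * b \<in> S"
      using SI[OF polys_in_add[OF K, of f _ g]] SI[OF polys_in_mult[OF K, of f _ g]] hom[OF R'R R'R, of f g]
      by auto
  qed
  have S_const: "\<psi> (mv_const c) \<in> S" if "c \<in> K" for c using that K by (intro SI polys_in_const)
  have S_0: "0 \<in> S" and S_m1: "-1 \<in> S"
  proof -
    have "\<psi> 0 = 0" using ring_hom_on_0[OF \<psi> polys_in_0[OF K]] .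
    thus "0 \<in> S" using SI[OF polys_in_0[OF K]] by simp
    have "\<psi> (- 1) = - \<psi> 1"
      using K by (intro ring_hom_on_uminus[OF \<psi>]) (auto intro: polys_in_closed)
    thus "-1 \<in> S" using SI[OF polys_in_uminus[OF K polys_in_1[OF K]]] ring_hom_on_1[OF \<psi>] by simp
  qed
  have S_uminus: "- a \<in> S" if "a \<in> S" for a using S_mult[OF S_m1 that] by simp
  have S_diff: "a - b \<in> S" if "a \<in> S" "b \<in> S" for a b using S_add[OF that(1) S_uminus[OF that(2)]] by simp
  have S_sum: "(\<Sum>i\<in>I. f i) \<in> S" if "\<And>i. i \<in> I \<Longrightarrow> f i \<in> S" for I and f :: "nat \<Rightarrow> 'c"
    using that by (induction I rule: infinite_finite_induct) (auto intro: S_add S_0)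
  have S_var: "\<psi> (mv_var i) \<in> S" if "0 < i" "i < n" for i using that K by (intro SI polys_in_var) auto
  \<comment> \<open>Divided by the coefficient \<open>Q 0 0\<close>, the equation of the quadric is
    monic of degree two in \<open>\<xi>\<close>.\<close>
  obtain \<alpha> \<beta> where X2: "\<xi> * \<xi> = \<alpha> * \<xi> + \<beta>" and \<alpha>\<beta>: "\<alpha> \<in> S" "\<beta> \<in> S"
  proof -
    obtain n' where n': "n = Suc n'" using n by (cases n) auto
    let ?x = "\<lambda>i. \<psi> (mv_var i)" and ?q = "\<lambda>i j. \<psi> (mv_const (Q i j))"
    define L where "L = (\<Sum>j<n'. ?q 0 (Suc j) * ?x (Suc j)) + (\<Sum>i<n'. ?q (Suc i) 0 * ?x (Suc i))"
    define P where "P = (\<Sum>i<n'. \<Sum>j<n'. ?q (Suc i) (Suc j) * ?x (Suc i) * ?x (Suc j))"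
    have LP: "L \<in> S" "P \<in> S"
      unfolding L_def P_def using Q(1) n' by (auto intro!: S_add S_sum S_mult S_const S_var)
    have "?q 0 0 * (\<xi> * \<xi>) + (L * \<xi> + P) = 0"
      using iso unfolding n' bil_def sum.lessThan_Suc_shift L_def P_def \<xi>_def
      by (simp add: sum.distrib sum_distrib_left sum_distrib_right algebra_simps)
    hence q00: "?q 0 0 * (\<xi> * \<xi>) = - (L * \<xi> + P)" by (rule eq_neg_iff_add_eq_0[THEN iffD2])
    define c where "c = \<psi> (mv_const (inverse (Q 0 0)))"
    have Q0: "Q 0 0 \<in> K" using Q n by blast
    have "c * ?q 0 0 = 1"
    proof -
      have "c * ?q 0 0 = \<psi> (mv_const (inverse (Q 0 0)) * mv_const (Q 0 0))"
        unfolding c_def using Q0 K by (intro hom(2)[symmetric] polys_in_const) (auto intro: subfield_closed)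
      also have "mv_const (inverse (Q 0 0)) * mv_const (Q 0 0) = 1"
        using Q(2) by (simp add: mv_const_def mult_single)
      finally show ?thesis using ring_hom_on_1[OF \<psi>] by simp
    qed
    hence "\<xi> * \<xi> = c * (?q 0 0 * (\<xi> * \<xi>))" by (simp flip: mult.assoc)
    also have "\<dots> = c * (- (L * \<xi> + P))" unfolding q00 ..
    finally have eq: "\<xi> * \<xi> = (- (c * L)) * \<xi> + (- (c * P))" by (simp add: algebra_simps)
    have cS: "c \<in> S" unfolding c_def using Q0 K by (intro S_const) (auto intro: subfield_closed)
    show thesis by (rule that[OF eq]) (intro S_mult S_uminus cS LP)+
  qed
  have "\<exists>a\<in>S. \<exists>b\<in>S. \<psi> f = a + b * \<xi>" if "f \<in> ?R" for f using K that
  proof (induction rule: polys_in_induct)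
    case (const c)
    thus ?case using S_const S_0 by (intro bexI[of _ "\<psi> (mv_const c)"] bexI[of _ 0]) auto
  next
    case (var i)
    show ?case
    proof (cases "i = 0")
      case True
      have "1 \<in> S" using S_uminus[OF S_m1] by simp
      thus ?thesis using S_0 True by (intro bexI[of _ 0] bexI[of _ 1]) (auto simp: \<xi>_def)
    next
      case False
      thus ?thesis using S_var[of i] var S_0 by (intro bexI[of _ "\<psi> (mv_var i)"] bexI[of _ 0]) auto
    qed
  next
    case (add f g)
    then obtain a b a' b' where "a \<in> S" "b \<in> S" "\<psi> f = a + b * \<xi>" "a' \<in> S" "b' \<in> S" "\<psi> g = a' + b' * \<xi>" by blast
    thus ?case using hom(1)[OF add(1,2)] S_add
      by (intro bexI[of _ "a + a'"] bexI[of _ "b + b'"]) (auto simp: algebra_simps)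
  next
    case (mult f g)
    then obtain a b a' b' where *: "a \<in> S" "b \<in> S" "\<psi> f = a + b * \<xi>" "a' \<in> S" "b' \<in> S" "\<psi> g = a' + b' * \<xi>" by blast
    have "\<psi> (f * g) = a * a' + (a * b' + b * a') * \<xi> + b * b' * (\<xi> * \<xi>)"
      unfolding hom(2)[OF mult(1,2)] *(3,6) by (simp add: algebra_simps)
    also have "\<dots> = (a * a' + b * b' * \<beta>) + (a * b' + b * a' + b * b' * \<alpha>) * \<xi>"
      unfolding X2 by (simp add: algebra_simps)
    finally show ?case using * \<alpha>\<beta> by (blast intro: S_add S_mult)
  qed
  from this[OF d(1)] obtain a b where ab: "a \<in> S" "b \<in> S" "\<psi> d = a + b * \<xi>" by blast
  \<comment> \<open>The conjugate of \<open>a + b * \<xi>\<close> is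
    \<open>a + b * \<alpha> - b * \<xi>\<close>; \<open>T\<close> and \<open>N\<close> are the sum
    and the product of the two.\<close>
  define T where "T = 2 * a + b * \<alpha>"
  define N where "N = a * a + a * b * \<alpha> - b * b * \<beta>"
  have TS: "T \<in> S" unfolding T_def mult_2 using ab \<alpha>\<beta> by (intro S_add S_mult)
  have NS: "N \<in> S" unfolding N_def using ab \<alpha>\<beta> by (intro S_add S_mult S_diff)
  have "\<psi> d * (T - \<psi> d) = N + b * b * (\<alpha> * \<xi> + \<beta> - \<xi> * \<xi>)"
    unfolding ab(3) T_def N_def by (simp add: algebra_simps)
  hence rel: "\<psi> d * (T - \<psi> d) = N" using X2 by simp
  obtain t where t: "t \<in> ?R'" "T = \<psi> t" using TS by (auto simp: S_def)
  obtain m where m: "m \<in> ?R'" "N = \<psi> m" using NS by (auto simp: S_def)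
  show ?thesis
  proof (cases "N = 0")
    case False
    have "\<psi> (t + - d) = T - \<psi> d"
      using ring_hom_on_add[OF \<psi>, of t "- d"] ring_hom_on_uminus[OF \<psi> polys_in_0[OF K] d(1)] t R'R d K
      by (auto intro: polys_in_closed)
    moreover have "t + - d \<in> ?R" using t R'R d K by (auto intro!: polys_in_closed)
    ultimately show ?thesis using rel False m by metis
  next
    \<comment> \<open>The product of \<open>\<psi> d\<close> and its conjugate is zero while
      \<open>\<psi> d\<close> is not, so the conjugate is zero and \<open>\<psi> d\<close> equals
      its trace, which comes from a polynomial without the variable 0.\<close>
    case True
    hence "\<psi> d = T" using rel d by auto
    moreover have "\<psi> d * \<psi> 1 = \<psi> d" using ring_hom_on_1[OF \<psi>] by simp
    ultimately show ?thesis using t d polys_in_1[OF K] by metis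
  qed
qed

section \<open>Specialising totally isotropic families\<close>

lemma ex_common_denominator:
  fixes \<psi> :: "'r::comm_ring_1 \<Rightarrow> 'c::field"
  assumes \<psi>: "ring_hom_on R M \<psi>" and R: "1 \<in> R" "\<And>x y. x \<in> R \<Longrightarrow> y \<in> R \<Longrightarrow> x * y \<in> R"
    and A: "finite A" "\<And>z. z \<in> A \<Longrightarrow> \<exists>f\<in>R. \<exists>g\<in>R. \<psi> g \<noteq> 0 \<and> z = \<psi> f / \<psi> g"
  shows "\<exists>d\<in>R. \<psi> d \<noteq> 0 \<and> (\<forall>z\<in>A. \<exists>f\<in>R. \<psi> f = \<psi> d * z)"
  using A
proof (induction A)
  case empty
  show ?case using R ring_hom_on_1[OF \<psi>] by (intro bexI[of _ 1]) auto
next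
  case (insert z A)
  then obtain d where d: "d \<in> R" "\<psi> d \<noteq> 0" "\<And>z. z \<in> A \<Longrightarrow> \<exists>f\<in>R. \<psi> f = \<psi> d * z" by (metis insertCI)
  obtain f g where fg: "f \<in> R" "g \<in> R" "\<psi> g \<noteq> 0" "z = \<psi> f / \<psi> g" using insert.prems by blast
  have dg: "\<psi> (d * g) = \<psi> d * \<psi> g" using ring_hom_on_mult[OF \<psi>] d fg by blast
  have "\<exists>h\<in>R. \<psi> h = \<psi> (d * g) * z'" if "z' \<in> insert z A" for z'
  proof (cases "z' = z")
    case True
    have "\<psi> (d * f) = \<psi> (d * g) * z" using ring_hom_on_mult[OF \<psi>, of d f] d fg dg by simp
    thus ?thesis using True d fg R by blast
  next
    case False
    hence "z' \<in> A" using that by simp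
    then obtain h where h: "h \<in> R" "\<psi> h = \<psi> d * z'" using d(3) by blast
    have "\<psi> (h * g) = \<psi> (d * g) * z'" using ring_hom_on_mult[OF \<psi>, of h g] h fg dg by simp
    thus ?thesis using h fg R by blast
  qed
  moreover have "d * g \<in> R" "\<psi> (d * g) \<noteq> 0" using d fg R dg by auto
  ultimately show ?case by blast
qed

text \<open>Here \<open>d\<close> is a common denominator for the family and for a dual family; the latter keeps the images independent.\<close>

lemma tot_iso_specialize:
  fixes \<psi> :: "'r::comm_ring_1 \<Rightarrow> 'c::field" and Q :: "nat \<Rightarrow> nat \<Rightarrow> 'r"
  assumes M: "is_subfield M" "M = {\<psi> f / \<psi> g | f g. f \<in> R \<and> g \<in> R \<and> \<psi> g \<noteq> 0}"
    and \<psi>: "ring_hom_on R M \<psi>"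
    and R: "0 \<in> R" "1 \<in> R" "\<And>x y. x \<in> R \<Longrightarrow> y \<in> R \<Longrightarrow> x + y \<in> R" "\<And>x y. x \<in> R \<Longrightarrow> y \<in> R \<Longrightarrow> x - y \<in> R"
      "\<And>x y. x \<in> R \<Longrightarrow> y \<in> R \<Longrightarrow> x * y \<in> R"
    and Q: "\<And>i j. i < n \<Longrightarrow> j < n \<Longrightarrow> Q i j \<in> R"
    and W: "tot_iso M n (\<lambda>i j. \<psi> (Q i j)) m"
  shows "\<exists>d\<in>R. \<psi> d \<noteq> 0 \<and> (\<forall>h (E :: 'd::field set). is_subfield E \<longrightarrow> ring_hom_on R E h \<longrightarrow> h d \<noteq> 0 \<longrightarrow>
     (\<forall>f\<in>R. \<psi> f = 0 \<longrightarrow> h f = 0) \<longrightarrow> tot_iso E n (\<lambda>i j. h (Q i j)) m)"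
proof -
  obtain W where W: "iso_fam M n (\<lambda>i j. \<psi> (Q i j)) {..<m} W" using W by (auto simp: tot_iso_def)
  have WM: "W k j \<in> M" if "k < m" "j < n" for k j using W that by (auto simp: iso_fam_def)
  have "indep_fam M n {..<m} W" using W by (simp add: iso_fam_def)
  then obtain A where A: "\<And>l j. l < m \<Longrightarrow> j < n \<Longrightarrow> A l j \<in> M"
      "\<And>l k. l < m \<Longrightarrow> k < m \<Longrightarrow> (\<Sum>j<n. A l j * W k j) = (if k = l then 1 else 0)"
    using indep_fam_dual[OF M(1), of m n W] WM by blast
  let ?A = "(\<lambda>(k, j). W k j) ` ({..<m} \<times> {..<n}) \<union> (\<lambda>(k, j). A k j) ` ({..<m} \<times> {..<n})"
  have "?A \<subseteq> M" using WM A(1) by auto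
  hence "\<exists>f\<in>R. \<exists>g\<in>R. \<psi> g \<noteq> 0 \<and> z = \<psi> f / \<psi> g" if "z \<in> ?A" for z
    using that unfolding M(2) by blast
  hence "\<exists>d\<in>R. \<psi> d \<noteq> 0 \<and> (\<forall>z\<in>?A. \<exists>f\<in>R. \<psi> f = \<psi> d * z)"
    by (intro ex_common_denominator[OF \<psi> R(2,5)]) auto
  then obtain d where d: "d \<in> R" "\<psi> d \<noteq> 0" "\<And>z. z \<in> ?A \<Longrightarrow> \<exists>f\<in>R. \<psi> f = \<psi> d * z" by blast
  have "\<exists>f\<in>R. \<psi> f = \<psi> d * W k j" if "k < m" "j < n" for k j
    using d(3)[of "W k j"] that by force
  then obtain F where F: "\<And>k j. k < m \<Longrightarrow> j < n \<Longrightarrow> F k j \<in> R \<and> \<psi> (F k j) = \<psi> d * W k j" by metis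
  have "\<exists>f\<in>R. \<psi> f = \<psi> d * A k j" if "k < m" "j < n" for k j
    using d(3)[of "A k j"] that by force
  then obtain B where B: "\<And>k j. k < m \<Longrightarrow> j < n \<Longrightarrow> B k j \<in> R \<and> \<psi> (B k j) = \<psi> d * A k j" by metis
  have R_sum: "(\<Sum>i\<in>I. f i) \<in> R" if "\<And>i. i \<in> I \<Longrightarrow> f i \<in> R" for I :: "nat set" and f
    using that by (induction I rule: infinite_finite_induct) (auto intro: R)
  have hom_sum: "h (\<Sum>i\<in>I. f i) = (\<Sum>i\<in>I. h (f i))" if "ring_hom_on R E h" "\<And>i. i \<in> I \<Longrightarrow> f i \<in> R"
    for I :: "nat set" and f and h :: "'r \<Rightarrow> 'e::comm_ring_1" and E
    using ring_hom_on_sum[OF that(1) R(1,3)] that(2) by blast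
  have "tot_iso E n (\<lambda>i j. h (Q i j)) m"
    if E: "is_subfield E" and h: "ring_hom_on R E h" "h d \<noteq> 0" and ker: "\<And>f. f \<in> R \<Longrightarrow> \<psi> f = 0 \<Longrightarrow> h f = 0"
    for h and E :: "'d set"
  proof -
    \<comment> \<open>\<open>h\<close> factors through \<open>\<psi>\<close>, so identities verified
      under \<open>\<psi>\<close> can be transported to \<open>E\<close>.\<close>
    have h_eq: "h f = h g" if "f \<in> R" "g \<in> R" "\<psi> f = \<psi> g" for f g
    proof -
      have "\<psi> f = \<psi> (f - g) + \<psi> g" "h f = h (f - g) + h g"
        using ring_hom_on_add[OF \<psi>, of "f - g" g] ring_hom_on_add[OF h(1), of "f - g" g] that R by auto
      thus ?thesis using ker[of "f - g"] that R by simp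
    qed
    have bil_hom: "g (\<Sum>i<n. \<Sum>j<n. Q i j * F k i * F l j) = bil n (\<lambda>i j. g (Q i j)) (\<lambda>j. g (F k j)) (\<lambda>j. g (F l j))"
      if "k < m" "l < m" "ring_hom_on R T g" for k l and g :: "'r \<Rightarrow> 'e::field" and T
    proof -
      have T: "Q i j * F k i * F l j \<in> R" "Q i j * F k i \<in> R" "Q i j \<in> R" "F k i \<in> R" "F l j \<in> R"
        if "i < n" "j < n" for i j using F Q that \<open>k < m\<close> \<open>l < m\<close> R(5) by auto
      have "g (\<Sum>i<n. \<Sum>j<n. Q i j * F k i * F l j) = (\<Sum>i<n. g (\<Sum>j<n. Q i j * F k i * F l j))"
        using T by (intro hom_sum[OF that(3)] R_sum) auto
      also have "\<dots> = (\<Sum>i<n. \<Sum>j<n. g (Q i j * F k i * F l j))"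
        using T by (intro sum.cong refl hom_sum[OF that(3)]) auto
      also have "\<dots> = (\<Sum>i<n. \<Sum>j<n. g (Q i j) * g (F k i) * g (F l j))"
        using T by (intro sum.cong refl) (simp add: ring_hom_on_mult[OF that(3)])
      finally show ?thesis by (simp add: bil_def)
    qed
    have "iso_fam E n (\<lambda>i j. h (Q i j)) {..<m} (\<lambda>k j. h (F k j))" unfolding iso_fam_def
    proof (intro conjI ballI allI impI)
      fix k j assume "k \<in> {..<m}" "j < n"
      thus "h (F k j) \<in> E" using F ring_hom_on_in[OF h(1)] by auto
    next
      fix k l assume kl: "k \<in> {..<m}" "l \<in> {..<m}"
      have "bil n (\<lambda>i j. \<psi> (Q i j)) (\<lambda>j. \<psi> (F k j)) (\<lambda>j. \<psi> (F l j)) =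
          bil n (\<lambda>i j. \<psi> (Q i j)) (\<lambda>j. \<psi> d * W k j) (\<lambda>j. \<psi> d * W l j)"
        using F kl by (intro bil_cong) auto
      also have "\<dots> = 0" using W kl by (simp add: bil_scale_left bil_scale_right iso_fam_def)
      finally have "\<psi> (\<Sum>i<n. \<Sum>j<n. Q i j * F k i * F l j) = 0" using bil_hom[OF _ _ \<psi>] kl by simp
      moreover have "(\<Sum>i<n. \<Sum>j<n. Q i j * F k i * F l j) \<in> R" using F Q kl R by (intro R_sum) auto
      ultimately have "h (\<Sum>i<n. \<Sum>j<n. Q i j * F k i * F l j) = 0" by (intro ker)
      thus "bil n (\<lambda>i j. h (Q i j)) (\<lambda>j. h (F k j)) (\<lambda>j. h (F l j)) = 0" using bil_hom[OF _ _ h(1)] kl by simp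
    next
      show "indep_fam E n {..<m} (\<lambda>k j. h (F k j))" unfolding indep_fam_def
      proof (intro allI impI ballI)
        fix c l assume c: "(\<forall>k\<in>{..<m}. c k \<in> E) \<and> (\<forall>j<n. (\<Sum>k<m. c k * h (F k j)) = 0)" and l: "l \<in> {..<m}"
        \<comment> \<open>The family and its dual, each multiplied by \<open>d\<close>, pair to
          \<open>d * d\<close> times the identity matrix under \<open>\<psi>\<close>, hence also
          under \<open>h\<close>. Since \<open>h d \<noteq> 0\<close>, this pairing detects every
          coefficient of a linear relation.\<close>
        have BF: "(\<Sum>j<n. h (B l j) * h (F k j)) = (if k = l then h d * h d else 0)" if k: "k < m" for k
        proof -
          have fR: "(\<Sum>j<n. B l j * F k j) \<in> R" using B F k l R by (intro R_sum) auto
          have sum: "g (\<Sum>j<n. B l j * F k j) = (\<Sum>j<n. g (B l j) * g (F k j))" if "ring_hom_on R T g"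
            for g :: "'r \<Rightarrow> 'e::field" and T
            using B F k l R by (subst hom_sum[OF that]) (auto intro!: sum.cong ring_hom_on_mult[OF that])
          have "\<psi> (\<Sum>j<n. B l j * F k j) = \<psi> d * \<psi> d * (\<Sum>j<n. A l j * W k j)"
            unfolding sum[OF \<psi>] using B F k l by (simp add: sum_distrib_left algebra_simps)
          also have "\<dots> = \<psi> (if k = l then d * d else 0)"
            using A(2)[of l k] k l ring_hom_on_mult[OF \<psi> d(1) d(1)] ring_hom_on_0[OF \<psi> R(1)] by auto
          finally have "h (\<Sum>j<n. B l j * F k j) = h (if k = l then d * d else 0)"
            using fR d R by (intro h_eq) auto
          thus ?thesis
            unfolding sum[OF h(1)] using ring_hom_on_mult[OF h(1) d(1) d(1)] ring_hom_on_0[OF h(1) R(1)] by auto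
        qed
        have "0 = (\<Sum>j<n. h (B l j) * (\<Sum>k<m. c k * h (F k j)))" using c by simp
        also have "\<dots> = (\<Sum>k<m. c k * (\<Sum>j<n. h (B l j) * h (F k j)))"
          unfolding sum_distrib_left by (subst sum.swap) (simp add: algebra_simps)
        also have "\<dots> = (\<Sum>k<m. if k = l then c k * (h d * h d) else 0)"
          using BF by (intro sum.cong) auto
        also have "\<dots> = c l * (h d * h d)" using l by simp
        finally show "c l = 0" using h(2) by simp
      qed
    qed
    thus ?thesis unfolding tot_iso_def by blast
  qed
  thus ?thesis using d by blast
qed


section \<open>Gram matrices\<close>

abbreviation gram :: "'a mat \<Rightarrow> nat \<Rightarrow> nat \<Rightarrow> 'a" where
  "gram q \<equiv> (\<lambda>i j. q $$ (i, j))"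

lemma elements_mat_iff: "elements_mat A \<subseteq> K \<longleftrightarrow> (\<forall>i<dim_row A. \<forall>j<dim_col A. A $$ (i, j) \<in> K)"
  by (simp add: elements_mat_def UN_subset_iff image_subset_iff Ball_def)

abbreviation gmap :: "('a \<Rightarrow> 'b) \<Rightarrow> 'a mat \<Rightarrow> nat \<Rightarrow> nat \<Rightarrow> 'b" where
  "gmap \<sigma> q \<equiv> (\<lambda>i j. \<sigma> (q $$ (i, j)))"

lemma mat_mult_index:
  "A \<in> carrier_mat m n \<Longrightarrow> B \<in> carrier_mat n l \<Longrightarrow> i < m \<Longrightarrow> j < l \<Longrightarrow>
   (A * B) $$ (i, j) = (\<Sum>k<n. A $$ (i, k) * B $$ (k, j))" by (simp add: scalar_prod_def atLeast0LessThan)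

lemma mat_mult_closed:
  assumes "is_subfield K" "A \<in> carrier_mat m n" "B \<in> carrier_mat n l" "elements_mat A \<subseteq> K" "elements_mat B \<subseteq> K"
  shows "elements_mat (A * B) \<subseteq> K"
  unfolding elements_mat_iff
proof (intro allI impI)
  fix i j assume ij: "i < dim_row (A * B)" "j < dim_col (A * B)"
  hence "(A * B) $$ (i, j) = (\<Sum>k<n. A $$ (i, k) * B $$ (k, j))"
    using mat_mult_index[OF assms(2,3), of i j] assms(2,3) by simp
  also have "\<dots> \<in> K" using assms ij by (intro subfield_sum subfield_mult) (auto simp: elements_mat_iff)
  finally show "(A * B) $$ (i, j) \<in> K" .
qed

lemma gram_mult:
  assumes "p \<in> carrier_mat n n" "P \<in> carrier_mat n m" "k < m" "l < m"
  shows "(P\<^sup>T * p * P) $$ (k, l) = bil n (gram p) (\<lambda>i. P $$ (i, k)) (\<lambda>i. P $$ (i, l))"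
proof -
  have Pt: "P\<^sup>T \<in> carrier_mat m n" using assms by simp
  have "(P\<^sup>T * p) $$ (k, j) = (\<Sum>i<n. P $$ (i, k) * p $$ (i, j))" if "j < n" for j
    unfolding mat_mult_index[OF Pt assms(1,3) that] using assms by (intro sum.cong) auto
  hence "(P\<^sup>T * p * P) $$ (k, l) = (\<Sum>j<n. (\<Sum>i<n. P $$ (i, k) * p $$ (i, j)) * P $$ (j, l))"
    unfolding mat_mult_index[OF mult_carrier_mat[OF Pt assms(1)] assms(2,3,4)] by simp
  also have "\<dots> = (\<Sum>i<n. \<Sum>j<n. p $$ (i, j) * P $$ (i, k) * P $$ (j, l))"
    unfolding sum_distrib_right by (subst sum.swap) (simp add: mult_ac)
  finally show ?thesis by (simp add: bil_def)
qed

lemma bil_congruence: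
  assumes "p \<in> carrier_mat n n" "P \<in> carrier_mat n m"
  shows "bil n (gram p) (\<lambda>i. \<Sum>j<m. x j * P $$ (i, j)) (\<lambda>i. \<Sum>j<m. y j * P $$ (i, j)) =
    bil m (gram (P\<^sup>T * p * P)) x y"
proof -
  have "bil m (gram (P\<^sup>T * p * P)) x y =
      (\<Sum>i<m. x i * (\<Sum>j<m. y j * bil n (gram p) (\<lambda>k. P $$ (k, i)) (\<lambda>k. P $$ (k, j))))"
    unfolding bil_def[of m] sum_distrib_left by (intro sum.cong refl) (simp add: gram_mult[OF assms])
  thus ?thesis unfolding bil_sum_left bil_sum_right ..
qed

lemma qf_value_bil:
  assumes "q \<in> carrier_mat n n" "v \<in> carrier_vec n"
  shows "qf_value q v = bil n (gram q) (\<lambda>i. v $ i) (\<lambda>i. v $ i)"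
  using assms by (simp add: qf_value_def bil_def scalar_prod_def atLeast0LessThan sum_distrib_left mult_ac)

lemma anisotropic_iff:
  assumes "q \<in> carrier_mat n n"
  shows "anisotropic K q \<longleftrightarrow> \<not> isotr K n (gram q)"
proof
  assume an: "anisotropic K q"
  show "\<not> isotr K n (gram q)"
  proof
    assume "isotr K n (gram q)"
    then obtain v where v: "\<forall>j<n. v j \<in> K" "\<exists>j<n. v j \<noteq> 0" "bil n (gram q) v v = 0" by (auto simp: isotr_def)
    have "qf_value q (vec n v) = bil n (gram q) v v"
      using assms by (subst qf_value_bil[of _ n]) (auto intro!: bil_cong)
    hence "vec n v = 0\<^sub>v n" using an v assms unfolding anisotropic_def by auto
    hence "v j = 0" if "j < n" for j using that by (metis index_vec index_zero_vec(1))
    with v show False by blast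
  qed
next
  assume an: "\<not> isotr K n (gram q)"
  show "anisotropic K q" unfolding anisotropic_def
  proof (intro ballI impI)
    fix v assume v: "v \<in> carrier_vec (dim_row q)" "(\<forall>i<dim_row q. v $ i \<in> K) \<and> qf_value q v = 0"
    hence "\<forall>i<n. v $ i = 0" using an assms qf_value_bil[OF assms, of v] unfolding isotr_def by auto
    thus "v = 0\<^sub>v (dim_row q)" using v assms by (intro eq_vecI) auto
  qed
qed

lemma det_nonzero_inj:
  fixes P :: "'a::field mat"
  assumes "P \<in> carrier_mat n n" "det P \<noteq> 0" "\<And>i. i < n \<Longrightarrow> (\<Sum>j<n. P $$ (i, j) * x j) = 0"
  shows "\<forall>j<n. x j = 0"
proof -
  have "P *\<^sub>v vec n x = 0\<^sub>v n"
    using assms(1,3) by (intro eq_vecI) (auto simp: scalar_prod_def atLeast0LessThan)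
  hence "vec n x = 0\<^sub>v n" using det_0_iff_vec_prod_zero_field[OF assms(1)] assms(2) vec_carrier by blast
  thus ?thesis by (metis index_vec index_zero_vec(1))
qed

text \<open>The dual family of the columns forms a left inverse with entries in \<open>K\<close>.
  Injectivity is required on vectors over \<open>K\<close> only, because that is what anisotropy of
  a form provides.\<close>

lemma ex_inverse_mat:
  fixes P :: "'a::field mat"
  assumes K: "is_subfield K" and P: "P \<in> carrier_mat n n" "elements_mat P \<subseteq> K"
    and inj: "\<And>x. \<forall>j<n. x j \<in> K \<Longrightarrow> \<forall>i<n. (\<Sum>j<n. P $$ (i, j) * x j) = 0 \<Longrightarrow> \<forall>j<n. x j = 0"
  shows "\<exists>A\<in>carrier_mat n n. elements_mat A \<subseteq> K \<and> A * P = 1\<^sub>m n \<and> P * A = 1\<^sub>m n"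
proof -
  have "indep_fam K n {..<n} (\<lambda>k j. P $$ (j, k))" unfolding indep_fam_def
  proof (intro allI impI)
    fix c assume c: "(\<forall>k\<in>{..<n}. c k \<in> K) \<and> (\<forall>j<n. (\<Sum>k<n. c k * P $$ (j, k)) = 0)"
    have 1: "\<forall>j<n. c j \<in> K" using c by blast
    have 2: "\<forall>i<n. (\<Sum>j<n. P $$ (i, j) * c j) = 0" using c by (simp add: mult.commute[of "c _"])
    from inj[OF 1 2] show "\<forall>k\<in>{..<n}. c k = 0" by simp
  qed
  moreover have "P $$ (j, k) \<in> K" if "k < n" "j < n" for k j using P that by (auto simp: elements_mat_iff)
  ultimately have "\<exists>A. (\<forall>l<n. \<forall>j<n. A l j \<in> K) \<and>
      (\<forall>l<n. \<forall>k<n. (\<Sum>j<n. A l j * P $$ (j, k)) = (if k = l then 1 else 0))"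
    by (intro indep_fam_dual[OF K])
  then obtain A where A: "\<And>l j. l < n \<Longrightarrow> j < n \<Longrightarrow> A l j \<in> K"
    "\<And>l k. l < n \<Longrightarrow> k < n \<Longrightarrow> (\<Sum>j<n. A l j * P $$ (j, k)) = (if k = l then 1 else 0)"
    by blast
  define B where "B = mat n n (\<lambda>(l, j). A l j)"
  have B: "B \<in> carrier_mat n n" by (simp add: B_def)
  have "B * P = 1\<^sub>m n"
  proof (rule eq_matI)
    fix i j assume "i < dim_row (1\<^sub>m n :: 'a mat)" "j < dim_col (1\<^sub>m n :: 'a mat)"
    thus "(B * P) $$ (i, j) = 1\<^sub>m n $$ (i, j)"
      using A(2)[of i j] by (subst mat_mult_index[OF B P(1)]) (auto simp: B_def)
  qed (use B P in auto)
  moreover from this have "P * B = 1\<^sub>m n" by (rule mat_mult_left_right_inverse[OF B P(1)])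
  moreover have "elements_mat B \<subseteq> K" using A(1) by (auto simp: elements_mat_iff B_def)
  ultimately show ?thesis using B by blast
qed

lemma det_nonzero_if_inverse:
  fixes P :: "'a::field mat"
  assumes "P \<in> carrier_mat n n" "A \<in> carrier_mat n n" "A * P = 1\<^sub>m n"
  shows "det P \<noteq> 0"
  using det_mult[OF assms(2,1)] assms(3) by auto

lemma ex_inverse_mat_det:
  assumes "is_subfield K" "P \<in> carrier_mat n n" "elements_mat P \<subseteq> K" "det P \<noteq> 0"
  shows "\<exists>A\<in>carrier_mat n n. elements_mat A \<subseteq> K \<and> det A \<noteq> 0 \<and> A * P = 1\<^sub>m n \<and> P * A = 1\<^sub>m n"
proof -
  obtain A where A: "A \<in> carrier_mat n n" "elements_mat A \<subseteq> K" "A * P = 1\<^sub>m n" "P * A = 1\<^sub>m n"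
    using ex_inverse_mat[OF assms(1-3)] det_nonzero_inj[OF assms(2,4)] by blast
  moreover have "det A \<noteq> 0" using det_nonzero_if_inverse[OF A(1) assms(2) A(4)] .
  ultimately show ?thesis by blast
qed

section \<open>Isometry of Gram matrices\<close>

lemma isometric_carrier:
  assumes "isometric K p q" "p \<in> carrier_mat n n"
  shows "q \<in> carrier_mat n n"
proof -
  obtain P where P: "P \<in> carrier_mat n n" "P\<^sup>T * p * P = q"
    using assms by (auto simp: isometric_def)
  have "P\<^sup>T * p * P \<in> carrier_mat n n" using P(1) assms(2) by simp
  thus ?thesis unfolding P(2) .
qed

lemma isometric_refl:
  fixes p :: "'a::field mat"
  assumes "is_subfield K" "p \<in> carrier_mat n n"
  shows "isometric K p p"
proof -
  have n: "dim_row p = n" using assms(2) by simp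
  have "elements_mat (1\<^sub>m n :: 'a mat) \<subseteq> K"
    using assms(1) by (auto simp: elements_mat_iff intro: subfield_closed)
  moreover have "transpose_mat (1\<^sub>m n) * p * 1\<^sub>m n = p"
    unfolding transpose_one using assms(2) by simp
  ultimately show ?thesis unfolding isometric_def n by (intro conjI bexI[of _ "1\<^sub>m n"]) simp_all
qed

lemma isometric_sym:
  assumes K: "is_subfield K" and p: "p \<in> carrier_mat n n" and i: "isometric K p q"
  shows "isometric K q p"
proof -
  obtain P where P: "P \<in> carrier_mat n n" "elements_mat P \<subseteq> K" "det P \<noteq> 0" "P\<^sup>T * p * P = q"
    using i p by (auto simp: isometric_def)
  obtain A where A: "A \<in> carrier_mat n n" "elements_mat A \<subseteq> K" "det A \<noteq> 0" "P * A = 1\<^sub>m n"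
    using ex_inverse_mat_det[OF K P(1-3)] by blast
  have "A\<^sup>T * q * A = (A\<^sup>T * P\<^sup>T) * p * (P * A)"
    unfolding P(4)[symmetric] using A(1) P(1) p by (simp add: assoc_mult_mat[of _ n n _ n _ n])
  also have "A\<^sup>T * P\<^sup>T = transpose_mat (P * A)"
    using A(1) P(1) by (simp add: transpose_mult)
  finally have "A\<^sup>T * q * A = p" using A(4) p by simp
  thus ?thesis unfolding isometric_def using A isometric_carrier[OF i p] p by auto
qed

lemma isometric_trans:
  assumes K: "is_subfield K" and p: "p \<in> carrier_mat n n" and i: "isometric K p q" "isometric K q r"
  shows "isometric K p r"
proof -
  have q: "q \<in> carrier_mat n n" using isometric_carrier[OF i(1) p] .
  obtain P where P: "P \<in> carrier_mat n n" "elements_mat P \<subseteq> K" "det P \<noteq> 0" "P\<^sup>T * p * P = q"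
    using i p by (auto simp: isometric_def)
  obtain A where A: "A \<in> carrier_mat n n" "elements_mat A \<subseteq> K" "det A \<noteq> 0" "A\<^sup>T * q * A = r"
    using i q by (auto simp: isometric_def)
  have "transpose_mat (P * A) * p * (P * A) = r" unfolding A(4)[symmetric] P(4)[symmetric] using A(1) P(1) p
    by (simp add: transpose_mult assoc_mult_mat[of _ n n _ n _ n])
  moreover have "det (P * A) \<noteq> 0" using det_mult[OF P(1) A(1)] P A by simp
  moreover have "elements_mat (P * A) \<subseteq> K" using mat_mult_closed[OF K P(1) A(1)] P A by blast
  ultimately show ?thesis
    unfolding isometric_def using P A p isometric_carrier[OF i(2) q] by (intro conjI bexI[of _ "P * A"]) auto
qed

text \<open>Multiplication by \<open>P\<close> carries a family for \<open>q\<close> to one for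
  \<open>p\<close>; invertibility of \<open>P\<close> preserves independence.\<close>

lemma tot_iso_isometric:
  assumes K: "is_subfield K" and p: "p \<in> carrier_mat n n" and i: "isometric K p q"
    and q: "tot_iso K n (gram q) m"
  shows "tot_iso K n (gram p) m"
proof -
  obtain P where P: "P \<in> carrier_mat n n" "elements_mat P \<subseteq> K" "det P \<noteq> 0" "P\<^sup>T * p * P = q"
    using i p by (auto simp: isometric_def)
  obtain W where W: "iso_fam K n (gram q) {..<m} W" using q by (auto simp: tot_iso_def)
  define U where "U k i = (\<Sum>j<n. W k j * P $$ (i, j))" for k i
  have "bil n (gram p) (U k) (U l) = bil n (gram q) (W k) (W l)" for k l
    unfolding U_def[abs_def] bil_congruence[OF p P(1)] P(4) ..
  moreover have "\<forall>j<n. U k j \<in> K" if "k < m" for k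
    unfolding U_def using W P that K by (auto intro!: subfield_sum subfield_mult simp: iso_fam_def elements_mat_iff)
  moreover have "indep_fam K n {..<m} U" unfolding indep_fam_def
  proof (intro allI impI)
    fix c assume c: "(\<forall>k\<in>{..<m}. c k \<in> K) \<and> (\<forall>j<n. (\<Sum>k<m. c k * U k j) = 0)"
    have "\<forall>j<n. (\<Sum>k<m. c k * W k j) = 0"
    proof (rule det_nonzero_inj[OF P(1,3)])
      fix i assume i: "i < n"
      have "(\<Sum>j<n. P $$ (i, j) * (\<Sum>k<m. c k * W k j)) = (\<Sum>k<m. c k * U k i)"
        unfolding U_def sum_distrib_left by (subst sum.swap) (simp add: mult_ac)
      thus "(\<Sum>j<n. P $$ (i, j) * (\<Sum>k<m. c k * W k j)) = 0" using c i by simp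
    qed
    thus "\<forall>k\<in>{..<m}. c k = 0" using W c unfolding iso_fam_def indep_fam_def by blast
  qed
  ultimately have "iso_fam K n (gram p) {..<m} U" using W unfolding iso_fam_def by simp
  thus ?thesis unfolding tot_iso_def by blast
qed

lemma quad_formD:
  assumes "quad_form K q"
  shows "q \<in> carrier_mat (dim_row q) (dim_row q)" "elements_mat q \<subseteq> K" "q\<^sup>T = q" "det q \<noteq> 0"
    "\<And>i j. i < dim_row q \<Longrightarrow> j < dim_row q \<Longrightarrow> q $$ (i, j) \<in> K"
    "\<And>i j. i < dim_row q \<Longrightarrow> j < dim_row q \<Longrightarrow> q $$ (i, j) = q $$ (j, i)"
proof -
  show q: "q \<in> carrier_mat (dim_row q) (dim_row q)" "elements_mat q \<subseteq> K" "q\<^sup>T = q" "det q \<noteq> 0"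
    using assms by (auto simp: quad_form_def square_mat.simps)
  show "q $$ (i, j) \<in> K" if "i < dim_row q" "j < dim_row q" for i j
    using q(1,2) that unfolding elements_mat_iff by (metis carrier_matD(2))
  show "q $$ (i, j) = q $$ (j, i)" if "i < dim_row q" "j < dim_row q" for i j
  proof -
    have "dim_col q = dim_row q" using q(1) by (metis carrier_matD(2))
    hence "q\<^sup>T $$ (i, j) = q $$ (j, i)" using that by (intro index_transpose_mat(1)) auto
    thus ?thesis unfolding q(3) .
  qed
qed

lemma quad_form_isometric:
  assumes K: "is_subfield K" and p: "quad_form K p" and i: "isometric K p q"
  shows "quad_form K q"
proof -
  define n where "n = dim_row p"
  note p = quad_formD[OF p, folded n_def]
  obtain P where P: "P \<in> carrier_mat n n" "elements_mat P \<subseteq> K" "det P \<noteq> 0" "P\<^sup>T * p * P = q"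
    using i p(1) by (auto simp: isometric_def)
  have Pt: "P\<^sup>T \<in> carrier_mat n n" "elements_mat (P\<^sup>T) \<subseteq> K"
    using P by (auto simp: elements_mat_iff)
  have "q\<^sup>T = q" unfolding P(4)[symmetric] using P(1) p(1) Pt(1) p(3)
    by (simp add: transpose_mult[of _ n n _ n] assoc_mult_mat[of _ n n _ n _ n])
  moreover have "det q \<noteq> 0"
    unfolding P(4)[symmetric] using P(1,3) p(1,4) Pt(1) by (simp add: det_mult[of _ n] det_transpose)
  moreover have "elements_mat q \<subseteq> K" unfolding P(4)[symmetric]
    by (intro mat_mult_closed[OF K mult_carrier_mat[OF Pt(1) p(1)] P(1)] mat_mult_closed[OF K Pt(1) p(1)] P(2) p(2) Pt(2))
  moreover have "square_mat q" using isometric_carrier[OF i p(1)] by simp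
  ultimately show ?thesis unfolding quad_form_def by blast
qed


section \<open>Orthogonal sums and the Witt decomposition\<close>

abbreviation osum :: "'a::zero mat \<Rightarrow> 'a mat \<Rightarrow> 'a mat" where
  "osum p r \<equiv> four_block_mat p (0\<^sub>m (dim_row p) (dim_col r)) (0\<^sub>m (dim_row r) (dim_col p)) r"

abbreviation unary :: "'a \<Rightarrow> 'a mat" where
  "unary a \<equiv> mat 1 1 (\<lambda>_. a)"

lemma isometric_osum:
  assumes K: "is_subfield K" and p: "p \<in> carrier_mat n n" and r: "r \<in> carrier_mat m m" and i: "isometric K p q"
  shows "isometric K (osum p r) (osum q r)"
proof -
  have q: "q \<in> carrier_mat n n" using isometric_carrier[OF i p] .
  obtain P where P: "P \<in> carrier_mat n n" "elements_mat P \<subseteq> K" "det P \<noteq> 0" "P\<^sup>T * p * P = q"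
    using i p by (auto simp: isometric_def)
  define R where "R = four_block_mat P (0\<^sub>m n m) (0\<^sub>m m n) (1\<^sub>m m)"
  have R: "R \<in> carrier_mat (n + m) (n + m)" using P by (auto simp: R_def)
  have Rt: "R\<^sup>T = four_block_mat (P\<^sup>T) (0\<^sub>m n m) (0\<^sub>m m n) (1\<^sub>m m)"
    unfolding R_def using P(1) by (subst transpose_four_block_mat[of _ n n _ m _ m]) auto
  have "R\<^sup>T * osum p r * R = osum q r"
  proof -
    have Pt: "P\<^sup>T \<in> carrier_mat n n" using P by simp
    have 1: "R\<^sup>T * osum p r = four_block_mat (P\<^sup>T * p) (0\<^sub>m n m) (0\<^sub>m m n) r"
      unfolding Rt using P(1) p r Pt by (subst mult_four_block_mat[of _ n n _ m _ m _ _ n _ m]) auto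
    show ?thesis unfolding 1 unfolding R_def using P p r q Pt
      by (subst mult_four_block_mat[of _ n n _ m _ m _ _ n _ m]) auto
  qed
  moreover have "det R \<noteq> 0"
    unfolding R_def using P(1,3) by (subst det_four_block_mat_lower_left_zero[of _ n _ m]) auto
  moreover have "elements_mat R \<subseteq> K"
    using P(1,2) K unfolding R_def elements_mat_iff by (auto intro: subfield_closed)
  ultimately show ?thesis unfolding isometric_def using R p q r by (intro conjI bexI[of _ R]) auto
qed

lemma quad_form_osum_left:
  assumes "quad_form K (osum p r)" "p \<in> carrier_mat n n" "r \<in> carrier_mat m m"
  shows "quad_form K p"
proof -
  note q = quad_formD[OF assms(1)]
  have "det (osum p r) = det p * det r"
    using assms(2,3) by (subst det_four_block_mat_lower_left_zero[of _ n _ m]) auto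
  hence "det p \<noteq> 0" using q(4) by auto
  moreover have "osum p r $$ (i, j) = p $$ (i, j)" if "i < n" "j < n" for i j using assms(2,3) that by simp
  hence "p $$ (i, j) \<in> K" "p $$ (i, j) = p $$ (j, i)" if "i < n" "j < n" for i j
    using q(5)[of i j] q(6)[of i j] that assms(2,3) by auto
  moreover have "p\<^sup>T = p" using assms(2) calculation(3) by (intro eq_matI) auto
  ultimately show ?thesis using assms(2) by (auto simp: quad_form_def elements_mat_iff)
qed

text \<open>One Gram-Schmidt step: \<open>e\<close> replaces a unit vector at a position where
  \<open>e\<close> is nonzero and is moved to the end, and the other unit vectors are made
  orthogonal to it. The last column is recorded in the conclusion so that other vectors can be
  compared with \<open>e\<close> in the new basis.\<close>

lemma ex_split_vector:
  fixes p :: "'a::field mat"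
  assumes K: "is_subfield K" and p: "p \<in> carrier_mat (Suc n) (Suc n)" "elements_mat p \<subseteq> K" "p\<^sup>T = p"
    and e: "\<And>i. i \<le> n \<Longrightarrow> e i \<in> K" and a: "bil (Suc n) (gram p) e e = a" "a \<noteq> 0"
  shows "\<exists>P q. P \<in> carrier_mat (Suc n) (Suc n) \<and> elements_mat P \<subseteq> K \<and> det P \<noteq> 0 \<and> q \<in> carrier_mat n n \<and>
     P\<^sup>T * p * P = osum q (unary a) \<and> (\<forall>i\<le>n. P $$ (i, n) = e i)"
proof -
  let ?B = "bil (Suc n) (gram p)"
  have pK: "p $$ (i, j) \<in> K" "p $$ (i, j) = p $$ (j, i)" if "i < Suc n" "j < Suc n" for i j
    using p that index_transpose_mat(1)[of i p j] by (auto simp: elements_mat_iff)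
  have sym: "?B u v = ?B v u" for u v by (intro bil_sym pK(2))
  have "\<exists>j\<le>n. e j \<noteq> 0"
  proof (rule ccontr)
    assume "\<not> ?thesis"
    hence "?B e e = 0" by (auto simp: bil_def)
    with a show False by simp
  qed
  then obtain j where j: "j \<le> n" "e j \<noteq> 0" by blast
  \<comment> \<open>Enumerates the positions other than \<open>j\<close>.\<close>
  define s where "s k = (if k < j then k else Suc k)" for k
  have s: "s k \<le> n" "s k \<noteq> j" if "k < n" for k using that by (auto simp: s_def)
  have s_inj: "s k = s l \<longleftrightarrow> k = l" for k l by (auto simp: s_def split: if_splits)
  define u where "u k i = (if i = s k then 1 else (0::'a))" for k i
  define b where "b k = - ?B (u k) e / a" for k
  define f where "f k = (if k = n then e else (\<lambda>i. 1 * u k i + b k * e i))" for k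
  have aK: "a \<in> K" unfolding a(1)[symmetric] using e pK K by (intro bil_closed) auto
  have uK: "u k i \<in> K" for k i using K by (auto simp: u_def intro: subfield_closed)
  have bK: "b k \<in> K" for k unfolding b_def using uK e pK aK K by (intro subfield_closed bil_closed) auto
  have fK: "f k i \<in> K" if "i \<le> n" for k i
    using that uK bK e K by (auto simp: f_def intro!: subfield_closed)
  have orth: "?B (f k) e = 0" if "k < n" for k
  proof -
    have fk: "f k = (\<lambda>i. 1 * u k i + b k * e i)" using that by (simp add: f_def)
    show ?thesis unfolding fk bil_lin_left a(1) using a(2) by (simp add: b_def)
  qed
  define P where "P = mat (Suc n) (Suc n) (\<lambda>(i, k). f k i)"
  have P: "P \<in> carrier_mat (Suc n) (Suc n)" "elements_mat P \<subseteq> K"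
    using fK by (auto simp: P_def elements_mat_iff)
  have inj: "\<forall>k<Suc n. x k = 0" if x: "\<forall>i<Suc n. (\<Sum>k<Suc n. P $$ (i, k) * x k) = 0" for x
  proof -
    define y where "y = x n + (\<Sum>k<n. b k * x k)"
    have eq: "(\<Sum>k<n. u k i * x k) + y * e i = 0" if "i \<le> n" for i
    proof -
      have "0 = (\<Sum>k<Suc n. P $$ (i, k) * x k)" using x that by simp
      also have "\<dots> = (\<Sum>k<n. (u k i + b k * e i) * x k) + e i * x n"
        using that by (simp add: P_def f_def)
      also have "\<dots> = (\<Sum>k<n. u k i * x k) + y * e i"
        by (simp add: y_def algebra_simps sum.distrib sum_distrib_left)
      finally show ?thesis by simp
    qed
    have "(\<Sum>k<n. u k j * x k) = 0" using s(2) by (intro sum.neutral) (auto simp: u_def)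
    hence y0: "y = 0" using eq[OF j(1)] j(2) by simp
    have x0: "x l = 0" if "l < n" for l
    proof -
      have "(\<Sum>k<n. u k (s l) * x k) = (\<Sum>k<n. if k = l then x k else 0)"
        by (intro sum.cong) (auto simp: u_def s_inj)
      thus ?thesis using eq[OF s(1)[OF that]] y0 that by simp
    qed
    hence "x n = 0" using y0 by (simp add: y_def)
    thus ?thesis using x0 by (auto simp: less_Suc_eq)
  qed
  obtain A where "A \<in> carrier_mat (Suc n) (Suc n)" "A * P = 1\<^sub>m (Suc n)"
    using ex_inverse_mat[OF K P] inj by blast
  hence det: "det P \<noteq> 0" using det_nonzero_if_inverse[OF P(1)] by blast
  define q where "q = mat n n (\<lambda>(k, l). ?B (f k) (f l))"
  have q: "q \<in> carrier_mat n n" by (simp add: q_def)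
  have "P\<^sup>T * p * P = osum q (unary a)"
  proof (rule eq_matI)
    fix k l assume "k < dim_row (osum q (unary a))" "l < dim_col (osum q (unary a))"
    hence kl: "k < Suc n" "l < Suc n" using q by auto
    have "(P\<^sup>T * p * P) $$ (k, l) = ?B (f k) (f l)"
      unfolding gram_mult[OF p(1) P(1) kl] using kl by (intro bil_cong) (auto simp: P_def)
    also have "\<dots> = (if k < n then if l < n then ?B (f k) (f l) else 0 else if l < n then 0 else a)"
    proof -
      have "f n = e" by (simp add: f_def)
      moreover have "?B e (f l) = 0" if "l < n" using orth[OF that] sym[of e "f l"] by simp
      ultimately show ?thesis using kl orth[of k] a(1) by (cases "k < n"; cases "l < n") (simp_all add: less_Suc_eq)
    qed
    also have "\<dots> = osum q (unary a) $$ (k, l)" using kl q by (auto simp: q_def less_Suc_eq)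
    finally show "(P\<^sup>T * p * P) $$ (k, l) = osum q (unary a) $$ (k, l)" .
  qed (use P p q in auto)
  moreover have "P $$ (i, n) = e i" if "i \<le> n" for i using that by (simp add: P_def f_def)
  ultimately show ?thesis using P q det by blast
qed

section \<open>Splitting off hyperbolic planes\<close>

lemma hyperbolic_plane_carrier: "(hyperbolic_plane :: 'a::field mat) \<in> carrier_mat 2 2"
  by (auto simp: diag_form_def mat_diag_def)

lemma hyperbolic_plane_eq: "osum (unary 1) (unary (-1)) = (hyperbolic_plane :: 'a::field mat)"
  by (rule eq_matI) (auto simp: diag_form_def mat_diag_def less_Suc_eq numeral_2_eq_2)

lemma osum_assoc:
  fixes p :: "'a::field mat"
  assumes "p \<in> carrier_mat n n" "q \<in> carrier_mat m m" "r \<in> carrier_mat l l"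
  shows "osum (osum p q) r = osum p (osum q r)"
  using assms by (intro eq_matI) auto

text \<open>Nondegeneracy gives a \<open>w\<close> that pairs to 1 with the isotropic
  \<open>v\<close>, and a multiple of \<open>v\<close> corrects it to an isotropic \<open>x\<close>.
  Then \<open>v + x / 2\<close> and \<open>v - x / 2\<close> are orthogonal with values 1 and
  -1.\<close>

lemma ex_hyperbolic_pair:
  fixes p :: "'a::field mat"
  assumes K: "is_subfield K" and two: "(2::'a) \<noteq> 0" and p: "quad_form K p" and iso: "isotr K n (gram p)"
    and n: "n = dim_row p"
  shows "\<exists>e f. (\<forall>i<n. e i \<in> K) \<and> (\<forall>i<n. f i \<in> K) \<and> bil n (gram p) e e = 1 \<and> bil n (gram p) f f = -1 \<and>
    bil n (gram p) e f = 0"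
proof -
  note p = quad_formD[OF p, folded n]
  let ?B = "bil n (gram p)"
  have sym: "?B u v = ?B v u" for u v by (intro bil_sym p(6))
  obtain v where v: "\<forall>j<n. v j \<in> K" "\<exists>j<n. v j \<noteq> 0" "?B v v = 0" using iso by (auto simp: isotr_def)
  obtain i where i: "i < n" "(\<Sum>j<n. p $$ (i, j) * v j) \<noteq> 0" using det_nonzero_inj[OF p(1,4), of v] v(2) by blast
  define w0 where "w0 k = (if k = i then 1 else (0::'a))" for k
  have "?B w0 v = (\<Sum>k<n. if k = i then \<Sum>j<n. p $$ (k, j) * v j else 0)"
    unfolding bil_def by (intro sum.cong refl) (auto simp: w0_def)
  hence c: "?B w0 v \<noteq> 0" using i by simp
  define c where "c = ?B w0 v"
  define w where "w k = (1 / c) * w0 k" for k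
  have w0K: "\<forall>k<n. w0 k \<in> K" using K by (auto simp: w0_def intro: subfield_closed)
  hence cK: "c \<in> K" unfolding c_def using v(1) p(5) K by (intro bil_closed) auto
  hence wK: "\<forall>k<n. w k \<in> K" using w0K K by (auto simp: w_def intro!: subfield_closed)
  have wv: "?B w v = 1" unfolding w_def[abs_def] bil_scale_left using c by (simp add: c_def)
  define d where "d = ?B w w"
  have dK: "d \<in> K" unfolding d_def using wK p(5) K by (intro bil_closed) auto
  define x where "x k = 1 * w k + (- d / 2) * v k" for k
  have xv: "?B x v = 1" "?B v x = 1" and xx: "?B x x = 0"
    unfolding x_def[abs_def] bil_lin_left bil_lin_right using wv v(3) sym[of v w] two
    by (simp_all add: d_def[symmetric] field_simps)
  have xK: "\<forall>k<n. x k \<in> K" using wK dK v(1) K by (auto simp: x_def intro!: subfield_closed subfield_2)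
  define e where "e k = 1 * v k + (1 / 2) * x k" for k
  define f where "f k = 1 * v k + (- 1 / 2) * x k" for k
  have "\<forall>k<n. e k \<in> K" "\<forall>k<n. f k \<in> K"
    using xK v(1) K by (auto simp: e_def f_def intro!: subfield_closed subfield_2)
  moreover have "?B e e = 1" "?B f f = -1" "?B e f = 0"
    unfolding e_def[abs_def] f_def[abs_def] bil_lin_left bil_lin_right using xv xx v(3) two
    by (simp_all add: field_simps)
  ultimately show ?thesis by blast
qed

lemma bil_osum_unary:
  assumes "q \<in> carrier_mat n n"
  shows "bil (Suc n) (gram (osum q (unary a))) u v = bil n (gram q) u v + a * u n * v n"
  using assms by (simp add: bil_def sum.distrib)

text \<open>The vector \<open>f\<close> of value -1 is split off first and \<open>e\<close> second,
  so that the two unary blocks end up in the order of \<open>hyperbolic_plane\<close>. In a basis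
  adapted to \<open>f\<close>, orthogonality to \<open>f\<close> means that the last coordinate of
  \<open>e\<close> is zero, so \<open>e\<close> lies in the complement and can be split off
  there.\<close>

lemma ex_split_hyperbolic_plane:
  fixes p :: "'a::field mat"
  assumes K: "is_subfield K" and two: "(2::'a) \<noteq> 0" and p: "quad_form K p" and iso: "isotr K (dim_row p) (gram p)"
  shows "\<exists>n q. dim_row p = n + 2 \<and> q \<in> carrier_mat n n \<and> quad_form K q \<and> isometric K p (osum q hyperbolic_plane)"
proof -
  obtain e f where ef: "\<forall>i<dim_row p. e i \<in> K" "\<forall>i<dim_row p. f i \<in> K" "bil (dim_row p) (gram p) e e = 1"
      "bil (dim_row p) (gram p) f f = -1" "bil (dim_row p) (gram p) e f = 0"
    using ex_hyperbolic_pair[OF K two p iso refl] by blast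
  have "dim_row p \<noteq> 0" using ef(3) by (auto simp: bil_def intro: gr0I)
  then obtain n where n: "dim_row p = Suc n" by (cases "dim_row p") auto
  note ef = ef[unfolded n]
  note pp = quad_formD[OF p, unfolded n]
  obtain P q where P: "P \<in> carrier_mat (Suc n) (Suc n)" "elements_mat P \<subseteq> K" "det P \<noteq> 0" and q: "q \<in> carrier_mat n n"
      and Pq: "P\<^sup>T * p * P = osum q (unary (-1))" and Pf: "\<And>i. i \<le> n \<Longrightarrow> P $$ (i, n) = f i"
    using ex_split_vector[OF K pp(1-3), of f "-1"] ef by (auto simp: less_Suc_eq_le)
  have ipq: "isometric K p (osum q (unary (-1)))" unfolding isometric_def using P Pq pp(1) q by auto
  have Q: "quad_form K (osum q (unary (-1)))" using quad_form_isometric[OF K p ipq] .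
  have qq: "quad_form K q" using quad_form_osum_left[OF Q q, of 1] by simp
  obtain A where A: "A \<in> carrier_mat (Suc n) (Suc n)" "elements_mat A \<subseteq> K" "P * A = 1\<^sub>m (Suc n)"
    using ex_inverse_mat_det[OF K P] by blast
  \<comment> \<open>The coordinates of \<open>e\<close> in the basis formed by the columns of
    \<open>P\<close>.\<close>
  define x where "x j = (\<Sum>k<Suc n. e k * A $$ (j, k))" for j
  have xK: "x j \<in> K" if "j \<le> n" for j
    unfolding x_def using that ef(1) A K by (intro subfield_sum subfield_mult) (auto simp: elements_mat_iff)
  have ex: "e i = (\<Sum>j<Suc n. x j * P $$ (i, j))" if "i < Suc n" for i
  proof -
    have "(\<Sum>j<Suc n. x j * P $$ (i, j)) = (\<Sum>k<Suc n. e k * (\<Sum>j<Suc n. P $$ (i, j) * A $$ (j, k)))"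
      unfolding x_def sum_distrib_right sum_distrib_left by (subst sum.swap) (simp only: mult_ac)
    also have "\<dots> = (\<Sum>k<Suc n. e k * (P * A) $$ (i, k))"
      using mat_mult_index[OF P(1) A(1)] that by (intro sum.cong refl) auto
    also have "\<dots> = (\<Sum>k<Suc n. if k = i then e k else 0)"
      unfolding A(3) using that by (intro sum.cong) auto
    also have "\<dots> = e i" using that by simp
    finally show ?thesis by simp
  qed
  have B: "bil (Suc n) (gram p) (\<lambda>i. \<Sum>j<Suc n. y j * P $$ (i, j)) (\<lambda>i. \<Sum>j<Suc n. z j * P $$ (i, j)) =
      bil n (gram q) y z - y n * z n" for y z
    unfolding bil_congruence[OF pp(1) P(1)] Pq bil_osum_unary[OF q] by simp
  have fx: "f i = (\<Sum>j<Suc n. (if j = n then 1 else 0) * P $$ (i, j))" if "i < Suc n" for i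
    using Pf that by simp
  have "bil (Suc n) (gram p) e f = bil n (gram q) x (\<lambda>j. if j = n then 1 else 0) - x n * 1"
    using B[of x "\<lambda>j. if j = n then 1 else 0"] bil_cong[OF refl ex fx] by simp
  hence xn: "x n = 0" using ef by (simp add: bil_def)
  have "bil (Suc n) (gram p) e e = bil n (gram q) x x - x n * x n"
    using B[of x x] bil_cong[OF refl ex ex] by simp
  hence "bil n (gram q) x x = 1" using ef xn by simp
  moreover from this have "n \<noteq> 0" by (intro notI) (simp add: bil_def)
  then obtain m where m: "n = Suc m" by (cases n) auto
  ultimately obtain R r where R: "R \<in> carrier_mat (Suc m) (Suc m)" "elements_mat R \<subseteq> K" "det R \<noteq> 0" and r: "r \<in> carrier_mat m m"
      and Rr: "R\<^sup>T * q * R = osum r (unary 1)"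
    using ex_split_vector[OF K, of q m x 1] quad_formD[OF qq] q xK m by (auto simp: less_Suc_eq_le)
  have iqr: "isometric K q (osum r (unary 1))" unfolding isometric_def using R Rr q r m by auto
  have "quad_form K (osum r (unary 1))" using quad_form_isometric[OF K qq iqr] .
  hence rr: "quad_form K r" using quad_form_osum_left[OF _ r, of K _ 1] by simp
  have "isometric K p (osum (osum r (unary 1)) (unary (-1)))"
    using isometric_trans[OF K pp(1) ipq isometric_osum[OF K q _ iqr, of _ 1]] by simp
  also have "osum (osum r (unary 1)) (unary (-1)) = osum r (hyperbolic_plane :: 'a mat)"
    unfolding hyperbolic_plane_eq[symmetric] using r by (intro osum_assoc[of _ m _ 1 _ 1]) auto
  finally show ?thesis using r rr n m by auto
qed

text \<open>\<open>diag_block_mat\<close> unfolds at the head of the list, where the anisotropic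
  part stands; inductions on the number of planes have to peel off the last block instead.\<close>

lemma diag_block_replicate_Suc:
  fixes p :: "'a::field mat"
  shows "diag_block_mat (p # replicate (Suc m) hyperbolic_plane) =
     osum (diag_block_mat (p # replicate m hyperbolic_plane)) hyperbolic_plane"
proof -
  have "p # replicate (Suc m) hyperbolic_plane = (p # replicate m hyperbolic_plane) @ [hyperbolic_plane :: 'a mat]"
    by (simp add: replicate_append_same)
  thus ?thesis by (simp only: diag_block_mat_last Let_def)
qed

lemma diag_block_replicate_carrier:
  fixes p :: "'a::field mat"
  assumes "p \<in> carrier_mat n n"
  shows "diag_block_mat (p # replicate m hyperbolic_plane) \<in> carrier_mat (n + 2 * m) (n + 2 * m)"
proof (induction m)
  case (Suc m)
  thus ?case unfolding diag_block_replicate_Suc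
    using four_block_carrier_mat[OF Suc hyperbolic_plane_carrier] by simp
qed (use assms in \<open>simp del: diag_block_mat.simps\<close>)

lemma ex_witt_decomposition:
  fixes p :: "'a::field mat"
  assumes K: "is_subfield K" and two: "(2::'a) \<noteq> 0" and p: "quad_form K p"
  shows "\<exists>q m. witt_decomposition K p q m"
  using p
proof (induction "dim_row p" arbitrary: p rule: less_induct)
  case less
  note pp = quad_formD[OF less.prems]
  show ?case
  proof (cases "isotr K (dim_row p) (gram p)")
    case False
    hence "witt_decomposition K p p 0"
      unfolding witt_decomposition_def using less.prems anisotropic_iff[OF pp(1)] isometric_refl[OF K pp(1)]
      by (simp del: diag_block_mat.simps)
    thus ?thesis by blast
  next
    case True
    then obtain n q where q: "dim_row p = n + 2" "q \<in> carrier_mat n n" "quad_form K q" "isometric K p (osum q hyperbolic_plane)"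
      using ex_split_hyperbolic_plane[OF K two less.prems] by blast
    have "dim_row q < dim_row p" using q by simp
    with less.hyps q(3) obtain r m where r: "witt_decomposition K q r m" by blast
    have "isometric K (osum q hyperbolic_plane) (osum (diag_block_mat (r # replicate m hyperbolic_plane)) hyperbolic_plane)"
      using r by (intro isometric_osum[OF K q(2) hyperbolic_plane_carrier]) (simp add: witt_decomposition_def)
    from isometric_trans[OF K pp(1) q(4) this] have "witt_decomposition K p r (Suc m)"
      using r unfolding witt_decomposition_def diag_block_replicate_Suc by simp
    thus ?thesis by blast
  qed
qed

section \<open>Totally isotropic subspaces and the Witt index\<close>

lemma bil_osum_hyperbolic:
  fixes q :: "'a::field mat"
  assumes "q \<in> carrier_mat n n"
  shows "bil (n + 2) (gram (osum q hyperbolic_plane)) u v =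
    bil n (gram q) u v + u n * v n - u (Suc n) * v (Suc n)"
proof -
  let ?H = "hyperbolic_plane :: 'a mat"
  have H: "?H $$ (0, 0) = 1" "?H $$ (0, Suc 0) = 0" "?H $$ (Suc 0, 0) = 0" "?H $$ (Suc 0, Suc 0) = -1"
    by (auto simp: diag_form_def mat_diag_def)
  have d: "dim_row ?H = 2" "dim_col ?H = 2" using hyperbolic_plane_carrier by auto
  show ?thesis using assms unfolding bil_def by (simp add: sum.distrib H d)
qed

text \<open>The additional vector is the isotropic vector \<open>(1, 1)\<close> of the hyperbolic
  plane.\<close>

lemma tot_iso_osum_hyperbolic:
  assumes K: "is_subfield K" and q: "q \<in> carrier_mat n n" and W: "tot_iso K n (gram q) m"
  shows "tot_iso K (n + 2) (gram (osum q hyperbolic_plane)) (Suc m)"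
proof -
  obtain W where W: "iso_fam K n (gram q) {..<m} W" using W by (auto simp: tot_iso_def)
  define U where "U k j = (if k < m then if j < n then W k j else 0 else if j < n then 0 else 1)" for k j
  have "iso_fam K (n + 2) (gram (osum q hyperbolic_plane)) {..<Suc m} U" unfolding iso_fam_def
  proof (intro conjI ballI allI impI)
    fix k j assume "k \<in> {..<Suc m}" "j < n + 2"
    thus "U k j \<in> K" using W K by (auto simp: U_def iso_fam_def intro: subfield_closed)
  next
    fix k l assume kl: "k \<in> {..<Suc m}" "l \<in> {..<Suc m}"
    have "bil n (gram q) (U k) (U l) = (if k < m \<and> l < m then bil n (gram q) (W k) (W l) else 0)"
      by (auto simp: bil_def U_def)
    thus "bil (n + 2) (gram (osum q hyperbolic_plane)) (U k) (U l) = 0"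
      unfolding bil_osum_hyperbolic[OF q] using W kl by (auto simp: U_def iso_fam_def)
  next
    show "indep_fam K (n + 2) {..<Suc m} U" unfolding indep_fam_def
    proof (intro allI impI)
      fix c assume c: "(\<forall>k\<in>{..<Suc m}. c k \<in> K) \<and> (\<forall>j<n + 2. (\<Sum>k<Suc m. c k * U k j) = 0)"
      have "(\<Sum>k<Suc m. c k * U k n) = 0" using c by simp
      hence cm: "c m = 0" by (simp add: U_def)
      have "(\<Sum>k<m. c k * W k j) = 0" if "j < n" for j
      proof -
        have "(\<Sum>k<Suc m. c k * U k j) = 0" using c that by simp
        thus ?thesis using that by (simp add: U_def)
      qed
      hence "c k = 0" if "k < m" for k
        using indep_famD[of K n "{..<m}" W c k] W c that by (auto simp: iso_fam_def)
      thus "\<forall>k\<in>{..<Suc m}. c k = 0" using cm by (auto simp: less_Suc_eq)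
    qed
  qed
  thus ?thesis unfolding tot_iso_def by blast
qed

text \<open>
  Intersect the subspace with the hyperplane orthogonal to an isotropic vector of the hyperbolic plane and project. If
  it lies in that hyperplane, drop a vector so that the projection becomes injective.
\<close>

lemma tot_iso_osum_hyperbolic_cancel:
  fixes q :: "'a::field mat"
  assumes K: "is_subfield K" and q: "q \<in> carrier_mat n n" and W: "tot_iso K (n + 2) (gram (osum q hyperbolic_plane)) (Suc m)"
  shows "tot_iso K n (gram q) m"
proof -
  let ?N = "n + 2"
  let ?Q = "gram (osum q (hyperbolic_plane :: 'a mat))"
  obtain W where W: "iso_fam K ?N ?Q {..<Suc m} W" using W by (auto simp: tot_iso_def)
  have WK: "W k j \<in> K" if "k < Suc m" "j < n + 2" for k j using W that by (auto simp: iso_fam_def)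
  have Wiso: "bil ?N ?Q (W k) (W l) = 0" if "k < Suc m" "l < Suc m" for k l using W that by (auto simp: iso_fam_def)
  have Wind: "indep_fam K ?N {..<Suc m} W" using W by (auto simp: iso_fam_def)
  \<comment> \<open>The pairing with the isotropic vector \<open>(1, 1)\<close> of the hyperbolic
    plane; on its kernel the plane contributes nothing to the form.\<close>
  define lam where "lam w = w n - w (Suc n)" for w :: "nat \<Rightarrow> 'a"
  have proj: "bil n (gram q) u v = bil ?N ?Q u v" if "lam u = 0" "lam v = 0" for u v
    using that unfolding bil_osum_hyperbolic[OF q] by (simp add: lam_def)
  have ker: "(\<forall>j<?N. v j = 0) \<or> v n \<noteq> 0" if "\<forall>j<n. v j = 0" "lam v = 0" for v
    using that by (auto simp: lam_def less_Suc_eq)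
  have fin: "tot_iso K n (gram q) m"
    if I: "card I = m" "finite I" and V: "\<And>k j. k \<in> I \<Longrightarrow> j < n \<Longrightarrow> V k j \<in> K"
      "\<And>k. k \<in> I \<Longrightarrow> lam (V k) = 0" "\<And>k l. k \<in> I \<Longrightarrow> l \<in> I \<Longrightarrow> bil ?N ?Q (V k) (V l) = 0"
      and ind: "\<And>c. \<forall>k\<in>I. c k \<in> K \<Longrightarrow> \<forall>j<n. (\<Sum>k\<in>I. c k * V k j) = 0 \<Longrightarrow> \<forall>k\<in>I. c k = 0" for I V
  proof -
    have "iso_fam K n (gram q) I V" unfolding iso_fam_def indep_fam_def using V ind proj by auto
    from tot_isoI[OF I(2) this] show ?thesis unfolding I(1) .
  qed
  have l_sum: "lam (\<lambda>j. \<Sum>k\<in>I. c k * V k j) = (\<Sum>k\<in>I. c k * lam (V k))" for I :: "nat set" and c V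
    by (simp add: lam_def sum_subtractf right_diff_distrib)
  show ?thesis
  proof (cases "\<forall>k<Suc m. lam (W k) = 0")
    case True
    show ?thesis
    proof (cases "\<exists>c. (\<forall>k<Suc m. c k \<in> K) \<and> (\<forall>j<n. (\<Sum>k<Suc m. c k * W k j) = 0) \<and> (\<exists>k<Suc m. c k \<noteq> 0)")
      case False
      hence "indep_fam K n {..<Suc m} W" unfolding indep_fam_def by blast
      hence ind: "indep_fam K n {..<m} W" by (rule indep_fam_subset) (use K in auto)
      show ?thesis
      proof (rule fin[of "{..<m}" W])
        fix c assume "\<forall>k\<in>{..<m}. c k \<in> K" "\<forall>j<n. (\<Sum>k<m. c k * W k j) = 0"
        with ind show "\<forall>k\<in>{..<m}. c k = 0" unfolding indep_fam_def by blast
      qed (use WK Wiso True in auto)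
    next
      case ex: True
      then obtain c k0 where c: "\<forall>k<Suc m. c k \<in> K" "\<forall>j<n. (\<Sum>k<Suc m. c k * W k j) = 0" "k0 < Suc m" "c k0 \<noteq> 0" by blast
      \<comment> \<open>A nontrivial combination that projects to zero, hence a nonzero multiple of
        \<open>(1, 1)\<close>. The kernel of the projection is the line through \<open>x\<close>, so
        it suffices to drop a vector \<open>W k0\<close> that occurs in \<open>x\<close>.\<close>
      define x where "x j = (\<Sum>k<Suc m. c k * W k j)" for j
      have "lam x = 0" unfolding x_def[abs_def] l_sum using True by (intro sum.neutral) auto
      hence x: "\<forall>j<n. x j = 0" "lam x = 0" using c(2) unfolding x_def by blast+
      have xn: "x n \<noteq> 0"
      proof
        assume "x n = 0"
        hence "\<forall>j<?N. x j = 0" using ker x by blast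
        hence "c k0 = 0" using indep_famD[OF Wind, of c k0] c by (auto simp: x_def)
        with c show False by simp
      qed
      have xK: "x n \<in> K" unfolding x_def using c(1) WK K by (intro subfield_sum subfield_mult) auto
      show ?thesis
      proof (rule fin[of "{..<Suc m} - {k0}" W])
        fix d assume d: "\<forall>k\<in>{..<Suc m} - {k0}. d k \<in> K" "\<forall>j<n. (\<Sum>k\<in>{..<Suc m} - {k0}. d k * W k j) = 0"
        define y where "y j = (\<Sum>k\<in>{..<Suc m} - {k0}. d k * W k j)" for j
        have "lam y = 0" unfolding y_def[abs_def] l_sum using True by (intro sum.neutral) auto
        hence y: "\<forall>j<n. y j = 0" "lam y = 0" using d(2) unfolding y_def by blast+
        have yK: "y n \<in> K" unfolding y_def using d(1) WK K by (intro subfield_sum subfield_mult) auto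
        define a where "a = y n / x n"
        have yx: "y j = a * x j" if "j < ?N" for j using that x y xn by (auto simp: a_def lam_def less_Suc_eq)
        define g where "g k = (if k = k0 then 0 else d k) - a * c k" for k
        have "(\<Sum>k<Suc m. g k * W k j) = 0" if "j < ?N" for j
        proof -
          have "(\<Sum>k<Suc m. (if k = k0 then 0 else d k) * W k j) = y j"
            unfolding y_def by (intro sum.mono_neutral_cong_right) auto
          hence "(\<Sum>k<Suc m. g k * W k j) = y j - a * x j"
            unfolding g_def left_diff_distrib sum_subtractf x_def sum_distrib_left by (simp add: mult_ac)
          thus ?thesis using yx that by simp
        qed
        moreover have "a \<in> K" using xK yK K by (simp add: a_def subfield_divide)
        hence "g k \<in> K" if "k \<in> {..<Suc m}" for k
          using that d(1) c(1) K by (auto simp: g_def intro!: subfield_closed)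
        ultimately have g0: "g k = 0" if "k < Suc m" for k using indep_famD[OF Wind, of g k] that by blast
        have "a = 0" using g0[OF c(3)] c(4) by (simp add: g_def)
        show "\<forall>k\<in>{..<Suc m} - {k0}. d k = 0"
        proof
          fix k assume "k \<in> {..<Suc m} - {k0}"
          thus "d k = 0" using g0[of k] \<open>a = 0\<close> by (simp add: g_def)
        qed
      qed (use c(3) WK Wiso True in auto)
    qed
  next
    case False
    then obtain k0 where k0: "k0 < Suc m" "lam (W k0) \<noteq> 0" by blast
    \<comment> \<open>Multiples of \<open>W k0\<close> move the other \<open>m\<close> vectors into
      the hyperplane.\<close>
    define r where "r k = - (lam (W k) / lam (W k0))" for k
    define V where "V k j = 1 * W k j + r k * W k0 j" for k j
    have lK: "lam (W k) \<in> K" if "k < Suc m" for k using WK that K by (auto simp: lam_def intro!: subfield_closed)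
    have rK: "r k \<in> K" if "k < Suc m" for k unfolding r_def using lK that k0 K by (intro subfield_closed) auto
    have VK: "V k j \<in> K" if "k < Suc m" "j < ?N" for k j
      unfolding V_def using WK rK that k0 K by (intro subfield_closed) auto
    have V0: "lam (V k) = 0" for k
    proof -
      have "lam (V k) = lam (W k) + r k * lam (W k0)" by (simp add: lam_def V_def algebra_simps)
      thus ?thesis using k0 by (simp add: r_def)
    qed
    have Viso: "bil ?N ?Q (V k) (V l) = 0" if "k < Suc m" "l < Suc m" for k l
      unfolding V_def[abs_def] bil_lin_left bil_lin_right using Wiso that k0 by simp
    show ?thesis
    proof (rule fin[of "{..<Suc m} - {k0}" V])
      fix d assume d: "\<forall>k\<in>{..<Suc m} - {k0}. d k \<in> K" "\<forall>j<n. (\<Sum>k\<in>{..<Suc m} - {k0}. d k * V k j) = 0"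
      define y where "y j = (\<Sum>k\<in>{..<Suc m} - {k0}. d k * V k j)" for j
      have "lam y = 0" unfolding y_def[abs_def] l_sum using V0 by (intro sum.neutral) auto
      hence y: "\<forall>j<n. y j = 0" "lam y = 0" using d(2) unfolding y_def by blast+
      define s where "s = (\<Sum>k\<in>{..<Suc m} - {k0}. d k * r k)"
      define g where "g k = (if k = k0 then s else d k)" for k
      have yg: "y j = (\<Sum>k<Suc m. g k * W k j)" for j
      proof -
        have "(\<Sum>k<Suc m. g k * W k j) = g k0 * W k0 j + (\<Sum>k\<in>{..<Suc m} - {k0}. g k * W k j)"
          using k0(1) by (subst sum.remove[of _ k0]) auto
        also have "(\<Sum>k\<in>{..<Suc m} - {k0}. g k * W k j) = (\<Sum>k\<in>{..<Suc m} - {k0}. d k * W k j)"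
          by (intro sum.cong) (auto simp: g_def)
        also have "g k0 * W k0 j = (\<Sum>k\<in>{..<Suc m} - {k0}. d k * (r k * W k0 j))"
          by (simp add: g_def s_def sum_distrib_right mult.assoc)
        finally show ?thesis by (simp add: y_def V_def algebra_simps sum.distrib)
      qed
      \<comment> \<open>A combination \<open>y\<close> that projects to zero is a multiple of
        \<open>(1, 1)\<close>. It is orthogonal to \<open>W k0\<close>, whereas
        \<open>(1, 1)\<close> is not, so \<open>y\<close> is zero.\<close>
      have "bil ?N ?Q y (W k0) = 0" unfolding yg[abs_def] bil_sum_left using Wiso k0 by simp
      hence "y n * W k0 n - y (Suc n) * W k0 (Suc n) = 0"
        unfolding bil_osum_hyperbolic[OF q] using y(1) by (simp add: bil_def)
      moreover have "y (Suc n) = y n" using y(2) by (simp add: lam_def)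
      ultimately have "y n * lam (W k0) = 0" by (simp add: lam_def algebra_simps)
      hence "\<forall>j<?N. y j = 0" using ker[OF y] k0 by auto
      moreover have "g k \<in> K" if "k \<in> {..<Suc m}" for k
        using that d(1) rK K by (auto simp: g_def s_def intro!: subfield_sum subfield_mult)
      ultimately have g0: "g k = 0" if "k < Suc m" for k
        using indep_famD[OF Wind, of g k] that unfolding yg by blast
      show "\<forall>k\<in>{..<Suc m} - {k0}. d k = 0"
      proof
        fix k assume "k \<in> {..<Suc m} - {k0}"
        thus "d k = 0" using g0[of k] by (simp add: g_def)
      qed
    qed (use k0 VK V0 Viso in auto)
  qed
qed

text \<open>The largest dimension of a totally isotropic subspace is 0 for the anisotropic part and
  rises by exactly one with each hyperbolic plane.\<close>

lemma witt_decomposition_tot_iso: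
  fixes p :: "'a::field mat"
  assumes K: "is_subfield K" and p: "p \<in> carrier_mat n n" and d: "witt_decomposition K p q m"
  shows "tot_iso K n (gram p) k \<longleftrightarrow> k \<le> m"
proof -
  define D where "D m = diag_block_mat (q # replicate m (hyperbolic_plane :: 'a mat))" for m
  define l where "l = dim_row q"
  have q: "q \<in> carrier_mat l l" using d quad_formD(1)[of K q] unfolding witt_decomposition_def l_def by blast
  have D: "D i \<in> carrier_mat (l + 2 * i) (l + 2 * i)" for i using diag_block_replicate_carrier[OF q] by (simp add: D_def)
  have DS: "D (Suc i) = osum (D i) hyperbolic_plane" for i unfolding D_def diag_block_replicate_Suc ..
  have D0: "D 0 = q" by (simp add: D_def del: diag_block_mat.simps)
  have i: "isometric K p (D m)" using d by (simp add: witt_decomposition_def D_def)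
  hence n: "n = l + 2 * m" using p D[of m] by (auto simp: isometric_def)
  have lower: "tot_iso K (l + 2 * i) (gram (D i)) i" for i
  proof (induction i)
    case 0
    show ?case by (simp add: tot_iso_def iso_fam_def indep_fam_def)
  next
    case (Suc i)
    have "l + 2 * Suc i = l + 2 * i + 2" by simp
    thus ?case using tot_iso_osum_hyperbolic[OF K D Suc] unfolding DS by metis
  qed
  have upper: "k \<le> i" if "tot_iso K (l + 2 * i) (gram (D i)) k" for i k using that
  proof (induction i arbitrary: k)
    case 0
    have "\<not> isotr K l (gram q)" using d anisotropic_iff[OF q] by (simp add: witt_decomposition_def)
    thus ?case using 0 tot_iso_mono[OF _ _ K, of l "gram q" k 1] tot_iso_1[OF K, of l "gram q"]
      by (cases k) (auto simp: D0)
  next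
    case (Suc i)
    show ?case
    proof (cases k)
      case (Suc k')
      have eq: "l + 2 * Suc i = l + 2 * i + 2" by simp
      have "tot_iso K (l + 2 * i) (gram (D i)) k'"
        using tot_iso_osum_hyperbolic_cancel[OF K D] Suc.prems[unfolded eq DS Suc] .
      thus ?thesis using Suc.IH Suc by simp
    qed simp
  qed
  have "tot_iso K n (gram p) k \<longleftrightarrow> tot_iso K n (gram (D m)) k"
    using tot_iso_isometric[OF K p i] tot_iso_isometric[OF K _ isometric_sym[OF K p i], of n] isometric_carrier[OF i p] by blast
  thus ?thesis using upper tot_iso_mono[OF lower _ K] n by blast
qed

text \<open>All decompositions have the same number of planes, namely the largest dimension of a
  totally isotropic subspace, so the definite description in \<open>witt_index\<close> denotes
  it.\<close>

lemma witt_index_iff: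
  fixes p :: "'a::field mat"
  assumes K: "is_subfield K" and two: "(2::'a) \<noteq> 0" and p: "quad_form K p"
  shows "tot_iso K (dim_row p) (gram p) k \<longleftrightarrow> k \<le> witt_index K p"
proof -
  note pc = quad_formD(1)[OF p]
  obtain q m where d: "witt_decomposition K p q m" using ex_witt_decomposition[OF assms] by blast
  have "witt_index K p = m" unfolding witt_index_def
  proof (rule the_equality)
    fix m' assume "\<exists>q. witt_decomposition K p q m'"
    then obtain q' where "witt_decomposition K p q' m'" by blast
    thus "m' = m" using witt_decomposition_tot_iso[OF K pc] d by (metis le_antisym order_refl)
  qed (use d in blast)
  thus ?thesis using witt_decomposition_tot_iso[OF K pc d] by simp
qed


section \<open>Tensor products\<close>

lemma tensor_form_carrier:
  "p \<in> carrier_mat m m \<Longrightarrow> q \<in> carrier_mat n n \<Longrightarrow> tensor_form p q \<in> carrier_mat (m * n) (m * n)"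
  by (auto simp: tensor_form_def Let_def)

lemma tensor_form_index:
  "p \<in> carrier_mat m m \<Longrightarrow> q \<in> carrier_mat n n \<Longrightarrow> i < m * n \<Longrightarrow> j < m * n \<Longrightarrow>
   tensor_form p q $$ (i, j) = p $$ (i div n, j div n) * q $$ (i mod n, j mod n)"
  by (auto simp: tensor_form_def Let_def)

lemma div_mod_less:
  fixes i m n :: nat
  assumes "i < m * n"
  shows "i div n < m" "i mod n < n"
proof -
  have "n > 0" using assms by (cases n) auto
  thus "i div n < m" "i mod n < n" using assms by (simp_all add: less_mult_imp_div_less)
qed

text \<open>An index \<open>k\<close> of a Kronecker product encodes the pair
  \<open>(k div n, k mod n)\<close>.\<close>

lemma sum_div_mod:
  "(\<Sum>k<m * n. f (k div n) (k mod n)) = (\<Sum>a<m. \<Sum>b<n. f a b)" for m n :: nat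
proof (induction m)
  case (Suc m)
  have "(\<Sum>k<Suc m * n. f (k div n) (k mod n)) = (\<Sum>k<m * n + n. f (k div n) (k mod n))"
    by (simp add: add.commute)
  also have "\<dots> = (\<Sum>a<m. \<Sum>b<n. f a b) + (\<Sum>b<n. f m b)"
    unfolding sum_lessThan_add Suc by (intro arg_cong2[of _ _ _ _ "(+)"] sum.cong) auto
  finally show ?case by simp
qed simp

text \<open>The mixed-product property: through it, a change of basis of the left factor acts on the
  product as its tensor product with an identity matrix.\<close>

lemma tensor_form_mult:
  assumes A: "A \<in> carrier_mat m m" and B: "B \<in> carrier_mat m m" and C: "C \<in> carrier_mat n n" and D: "D \<in> carrier_mat n n"
  shows "tensor_form (A * B) (C * D) = tensor_form A C * tensor_form B D"
proof -
  note AB = mult_carrier_mat[OF A B] and CD = mult_carrier_mat[OF C D]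
  note AC = tensor_form_carrier[OF A C] and BD = tensor_form_carrier[OF B D]
  note ABCD = tensor_form_carrier[OF AB CD] and P = mult_carrier_mat[OF AC BD]
  show ?thesis
  proof (rule eq_matI)
    fix i j assume "i < dim_row (tensor_form A C * tensor_form B D)" "j < dim_col (tensor_form A C * tensor_form B D)"
    hence ij: "i < m * n" "j < m * n" using P by auto
    note d = div_mod_less[OF ij(1)] div_mod_less[OF ij(2)]
    have "(tensor_form A C * tensor_form B D) $$ (i, j) =
        (\<Sum>k<m * n. (A $$ (i div n, k div n) * C $$ (i mod n, k mod n)) * (B $$ (k div n, j div n) * D $$ (k mod n, j mod n)))"
      unfolding mat_mult_index[OF AC BD ij]
      by (intro sum.cong refl) (simp add: tensor_form_index[OF A C ij(1)] tensor_form_index[OF B D _ ij(2)])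
    also have "\<dots> = (\<Sum>a<m. \<Sum>b<n. (A $$ (i div n, a) * C $$ (i mod n, b)) * (B $$ (a, j div n) * D $$ (b, j mod n)))"
      by (rule sum_div_mod[where f = "\<lambda>a b. (A $$ (i div n, a) * C $$ (i mod n, b)) * (B $$ (a, j div n) * D $$ (b, j mod n))"])
    also have "\<dots> = (\<Sum>a<m. A $$ (i div n, a) * B $$ (a, j div n)) * (\<Sum>b<n. C $$ (i mod n, b) * D $$ (b, j mod n))"
      by (simp add: sum_product mult_ac)
    also have "\<dots> = tensor_form (A * B) (C * D) $$ (i, j)"
      unfolding tensor_form_index[OF AB CD ij] mat_mult_index[OF A B d(1,3)] mat_mult_index[OF C D d(2,4)] ..
    finally show "tensor_form (A * B) (C * D) $$ (i, j) = (tensor_form A C * tensor_form B D) $$ (i, j)" by simp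
  qed (use ABCD P in auto)
qed

lemma tensor_form_transpose:
  assumes A: "A \<in> carrier_mat m m" and B: "B \<in> carrier_mat n n"
  shows "transpose_mat (tensor_form A B) = tensor_form (A\<^sup>T) (B\<^sup>T)"
proof (rule eq_matI)
  have At: "A\<^sup>T \<in> carrier_mat m m" and Bt: "B\<^sup>T \<in> carrier_mat n n" using A B by auto
  note AB = tensor_form_carrier[OF A B] and ABt = tensor_form_carrier[OF At Bt]
  show "dim_row (transpose_mat (tensor_form A B)) = dim_row (tensor_form (A\<^sup>T) (B\<^sup>T))"
    "dim_col (transpose_mat (tensor_form A B)) = dim_col (tensor_form (A\<^sup>T) (B\<^sup>T))"
    using AB ABt by auto
  fix i j assume "i < dim_row (tensor_form (A\<^sup>T) (B\<^sup>T))"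
    "j < dim_col (tensor_form (A\<^sup>T) (B\<^sup>T))"
  hence ij: "i < m * n" "j < m * n" using ABt by auto
  have "transpose_mat (tensor_form A B) $$ (i, j) = tensor_form A B $$ (j, i)" using AB ij by simp
  thus "transpose_mat (tensor_form A B) $$ (i, j) = tensor_form (A\<^sup>T) (B\<^sup>T) $$ (i, j)"
    unfolding tensor_form_index[OF A B ij(2,1)] tensor_form_index[OF At Bt ij] using A B div_mod_less[OF ij(1)] div_mod_less[OF ij(2)]
    by simp
qed

lemma tensor_form_one: "tensor_form (1\<^sub>m m) (1\<^sub>m n) = (1\<^sub>m (m * n) :: 'a::field mat)"
proof (rule eq_matI)
  have I: "(1\<^sub>m m :: 'a mat) \<in> carrier_mat m m" "(1\<^sub>m n :: 'a mat) \<in> carrier_mat n n" by auto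
  show "dim_row (tensor_form (1\<^sub>m m) (1\<^sub>m n) :: 'a mat) = dim_row (1\<^sub>m (m * n) :: 'a mat)"
    "dim_col (tensor_form (1\<^sub>m m) (1\<^sub>m n) :: 'a mat) = dim_col (1\<^sub>m (m * n) :: 'a mat)"
    using tensor_form_carrier[OF I] by auto
  fix i j assume "i < dim_row (1\<^sub>m (m * n) :: 'a mat)" "j < dim_col (1\<^sub>m (m * n) :: 'a mat)"
  hence ij: "i < m * n" "j < m * n" by auto
  have "i = j" if "i div n = j div n" "i mod n = j mod n" using that by (metis div_mult_mod_eq)
  thus "tensor_form (1\<^sub>m m) (1\<^sub>m n) $$ (i, j) = (1\<^sub>m (m * n) :: 'a mat) $$ (i, j)"
    unfolding tensor_form_index[OF I ij] using div_mod_less[OF ij(1)] div_mod_less[OF ij(2)] ij by auto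
qed

lemma tensor_form_closed:
  assumes "is_subfield K" "A \<in> carrier_mat m m" "B \<in> carrier_mat n n" "elements_mat A \<subseteq> K" "elements_mat B \<subseteq> K"
  shows "elements_mat (tensor_form A B) \<subseteq> K"
  unfolding elements_mat_iff
proof (intro allI impI)
  fix i j assume "i < dim_row (tensor_form A B)" "j < dim_col (tensor_form A B)"
  hence ij: "i < m * n" "j < m * n" using tensor_form_carrier[OF assms(2,3)] by auto
  show "tensor_form A B $$ (i, j) \<in> K" unfolding tensor_form_index[OF assms(2,3) ij]
    using assms div_mod_less[OF ij(1)] div_mod_less[OF ij(2)] by (intro subfield_mult) (auto simp: elements_mat_iff)
qed

lemma isometric_tensor_left:
  fixes p :: "'a::field mat"
  assumes K: "is_subfield K" and p: "p \<in> carrier_mat m m" and r: "r \<in> carrier_mat n n" and i: "isometric K p q"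
  shows "isometric K (tensor_form p r) (tensor_form q r)"
proof -
  have q: "q \<in> carrier_mat m m" using isometric_carrier[OF i p] .
  obtain P where P: "P \<in> carrier_mat m m" "elements_mat P \<subseteq> K" "det P \<noteq> 0" "P\<^sup>T * p * P = q"
    using i p by (auto simp: isometric_def)
  obtain A where A: "A \<in> carrier_mat m m" "A * P = 1\<^sub>m m"
    using ex_inverse_mat_det[OF K P(1-3)] by blast
  have I: "(1\<^sub>m n :: 'a mat) \<in> carrier_mat n n" "elements_mat (1\<^sub>m n :: 'a mat) \<subseteq> K"
    using K by (auto simp: elements_mat_iff intro: subfield_closed)
  have Pt: "P\<^sup>T \<in> carrier_mat m m" using P(1) by simp
  define T where "T = tensor_form P (1\<^sub>m n)"
  have T: "T \<in> carrier_mat (m * n) (m * n)" unfolding T_def using tensor_form_carrier[OF P(1) I(1)] .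
  have "tensor_form A (1\<^sub>m n) * T = 1\<^sub>m (m * n)"
    unfolding T_def tensor_form_mult[OF A(1) P(1) I(1) I(1), symmetric] A(2) using tensor_form_one[of m n] I(1) by simp
  hence det: "det T \<noteq> 0" using det_nonzero_if_inverse[OF T tensor_form_carrier[OF A(1) I(1)]] by blast
  have "T\<^sup>T * tensor_form p r * T = tensor_form (P\<^sup>T * p * P) (1\<^sub>m n * r * 1\<^sub>m n)"
    unfolding tensor_form_mult[OF mult_carrier_mat[OF Pt p] P(1) mult_carrier_mat[OF I(1) r] I(1)]
      tensor_form_mult[OF Pt p I(1) r] T_def tensor_form_transpose[OF P(1) I(1)] transpose_one ..
  also have "\<dots> = tensor_form q r" unfolding P(4) using r by simp
  finally have "T\<^sup>T * tensor_form p r * T = tensor_form q r" .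
  moreover have "elements_mat T \<subseteq> K" unfolding T_def by (rule tensor_form_closed[OF K P(1) I(1) P(2) I(2)])
  moreover have "dim_row (tensor_form p r) = m * n" "dim_row (tensor_form q r) = m * n"
    using tensor_form_carrier[OF p r] tensor_form_carrier[OF q r] by auto
  ultimately show ?thesis unfolding isometric_def using T det by (intro conjI bexI[of _ T]) auto
qed

lemma isometric_smult:
  assumes p: "p \<in> carrier_mat n n" and i: "isometric K p q"
  shows "isometric K (a \<cdot>\<^sub>m p) (a \<cdot>\<^sub>m q)"
proof -
  obtain P where P: "P \<in> carrier_mat n n" "elements_mat P \<subseteq> K" "det P \<noteq> 0" "P\<^sup>T * p * P = q"
    using i p by (auto simp: isometric_def)
  have Pt: "P\<^sup>T \<in> carrier_mat n n" using P(1) by simp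
  have "P\<^sup>T * (a \<cdot>\<^sub>m p) * P = a \<cdot>\<^sub>m q"
    unfolding mult_smult_distrib[OF Pt p] mult_smult_assoc_mat[OF mult_carrier_mat[OF Pt p] P(1)] P(4) ..
  moreover have "dim_row (a \<cdot>\<^sub>m p) = n" "dim_row (a \<cdot>\<^sub>m q) = n" using p isometric_carrier[OF i p] by auto
  ultimately show ?thesis unfolding isometric_def using P by (intro conjI bexI[of _ P]) auto
qed

lemma tensor_form_smult:
  fixes p :: "'a::field mat"
  assumes "p \<in> carrier_mat m m" "q \<in> carrier_mat n n"
  shows "tensor_form (a \<cdot>\<^sub>m p) q = a \<cdot>\<^sub>m tensor_form p q"
proof (rule eq_matI)
  have ap: "a \<cdot>\<^sub>m p \<in> carrier_mat m m" using assms by simp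
  note 1 = tensor_form_carrier[OF ap assms(2)] and 2 = tensor_form_carrier[OF assms]
  show "dim_row (tensor_form (a \<cdot>\<^sub>m p) q) = dim_row (a \<cdot>\<^sub>m tensor_form p q)"
    "dim_col (tensor_form (a \<cdot>\<^sub>m p) q) = dim_col (a \<cdot>\<^sub>m tensor_form p q)" using 1 2 by auto
  fix i j assume "i < dim_row (a \<cdot>\<^sub>m tensor_form p q)" "j < dim_col (a \<cdot>\<^sub>m tensor_form p q)"
  hence ij: "i < m * n" "j < m * n" using 2 by auto
  show "tensor_form (a \<cdot>\<^sub>m p) q $$ (i, j) = (a \<cdot>\<^sub>m tensor_form p q) $$ (i, j)"
    using tensor_form_index[OF ap assms(2) ij] tensor_form_index[OF assms ij] 2 ij assms
      div_mod_less[OF ij(1)] div_mod_less[OF ij(2)] by (simp add: mult.assoc)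
qed

text \<open>Both sides decode an index into the same triple, so this is an equality of matrices. It
  isolates the outermost slot of a Pfister form inside a product with \<open>p\<close>.\<close>

lemma tensor_form_assoc:
  fixes p :: "'a::field mat"
  assumes p: "p \<in> carrier_mat m m" and q: "q \<in> carrier_mat n n" and r: "r \<in> carrier_mat l l"
  shows "tensor_form (tensor_form p q) r = tensor_form p (tensor_form q r)"
proof (rule eq_matI)
  note pq = tensor_form_carrier[OF p q] and qr = tensor_form_carrier[OF q r]
  note 1 = tensor_form_carrier[OF pq r] and 2 = tensor_form_carrier[OF p qr]
  show "dim_row (tensor_form (tensor_form p q) r) = dim_row (tensor_form p (tensor_form q r))"
    "dim_col (tensor_form (tensor_form p q) r) = dim_col (tensor_form p (tensor_form q r))"
    using 1 2 by (auto simp: mult.assoc)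
  fix i j assume "i < dim_row (tensor_form p (tensor_form q r))" "j < dim_col (tensor_form p (tensor_form q r))"
  hence ij: "i < m * (n * l)" "j < m * (n * l)" using 2 by auto
  hence ij': "i < m * n * l" "j < m * n * l" by (auto simp: mult.assoc)
  note d = div_mod_less[OF ij'(1)] div_mod_less[OF ij'(2)] and e = div_mod_less[OF ij(1)] div_mod_less[OF ij(2)]
  have dm: "k div (n * l) = k div l div n" "(k mod (n * l)) div l = k div l mod n" "(k mod (n * l)) mod l = k mod l"
    if "k < m * (n * l)" for k
  proof -
    have l: "l > 0" using that by (cases l) auto
    show "k div (n * l) = k div l div n" by (metis div_mult2_eq mult.commute)
    have "k mod (n * l) = l * (k div l mod n) + k mod l" by (metis mod_mult2_eq mult.commute)
    thus "(k mod (n * l)) div l = k div l mod n" "(k mod (n * l)) mod l = k mod l" using l by simp_all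
  qed
  show "tensor_form (tensor_form p q) r $$ (i, j) = tensor_form p (tensor_form q r) $$ (i, j)"
    unfolding tensor_form_index[OF pq r ij'] tensor_form_index[OF p q d(1,3)]
      tensor_form_index[OF p qr ij] tensor_form_index[OF q r e(2,4)] dm[OF ij(1)] dm[OF ij(2)] by (simp only: mult.assoc)
qed

lemma diag_form_carrier: "diag_form as \<in> carrier_mat (length as) (length as)"
  by (simp add: diag_form_def)

lemma binary_carrier: "diag_form [1, a] \<in> carrier_mat 2 2"
  using diag_form_carrier[of "[1, a]"] by (simp add: numeral_2_eq_2)

lemma tensor_form_one_left:
  fixes q :: "'a::field mat"
  assumes q: "q \<in> carrier_mat n n"
  shows "tensor_form (diag_form [1]) q = q"
proof (rule eq_matI)
  have D: "(diag_form [1] :: 'a mat) \<in> carrier_mat 1 1" using diag_form_carrier[of "[1]"] by simp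
  note 1 = tensor_form_carrier[OF D q]
  show "dim_row (tensor_form (diag_form [1]) q) = dim_row q" "dim_col (tensor_form (diag_form [1]) q) = dim_col q"
    using 1 q by auto
  fix i j assume "i < dim_row q" "j < dim_col q"
  hence ij: "i < 1 * n" "j < 1 * n" using q by auto
  show "tensor_form (diag_form [1]) q $$ (i, j) = q $$ (i, j)"
    using tensor_form_index[OF D q ij] ij by (simp add: diag_form_def mat_diag_def)
qed

text \<open>The left index is the number of the block, so the product with a binary diagonal form is
  literally the block matrix \<open>dbl\<close>.\<close>

lemma tensor_form_dbl:
  fixes q :: "'a::field mat"
  assumes q: "q \<in> carrier_mat n n" and ij: "i < n + n" "j < n + n"
  shows "tensor_form (diag_form [1, a]) q $$ (i, j) = dbl n a (gram q) i j"
proof -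
  have dm: "k div n = (if k < n then 0 else 1) \<and> k mod n = (if k < n then k else k - n)" if "k < n + n" for k
    using that by (cases "k < n") (simp_all add: le_div_geq le_mod_geq)
  have ij2: "i < 2 * n" "j < 2 * n" using ij by auto
  show ?thesis unfolding tensor_form_index[OF binary_carrier q ij2] using dm[OF ij(1)] dm[OF ij(2)]
    by (auto simp: dbl_def diag_form_def mat_diag_def)
qed


section \<open>Base change\<close>

lemma hom_sum:
  "is_subfield K \<Longrightarrow> ring_hom_on K S \<phi> \<Longrightarrow> (\<And>i. i \<in> I \<Longrightarrow> f i \<in> K) \<Longrightarrow> \<phi> (\<Sum>i\<in>I. f i) = (\<Sum>i\<in>I. \<phi> (f i))"
  by (rule ring_hom_on_sum) (auto intro: subfield_closed)

lemma hom_two: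
  fixes \<phi> :: "'a::field \<Rightarrow> 'b::field"
  assumes "is_subfield K" "ring_hom_on K S \<phi>" "(2::'a) \<noteq> 0"
  shows "(2::'b) \<noteq> 0"
proof
  assume 2: "(2::'b) = 0"
  have "\<phi> (1 + 1) = 1 + 1"
    using ring_hom_on_add[OF assms(2) subfield_1 subfield_1] ring_hom_on_1[OF assms(2)] assms(1) by simp
  hence "\<phi> 2 = 0" using 2 by simp
  thus False using ring_hom_on_inj[OF assms(2,1) subfield_2] assms by blast
qed

lemma map_mat_mult_hom:
  assumes K: "is_subfield K" and \<phi>: "ring_hom_on K S \<phi>"
    and A: "A \<in> carrier_mat m n" "elements_mat A \<subseteq> K" and B: "B \<in> carrier_mat n l" "elements_mat B \<subseteq> K"
  shows "map_mat \<phi> (A * B) = map_mat \<phi> A * map_mat \<phi> B"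
proof (rule eq_matI)
  have A': "map_mat \<phi> A \<in> carrier_mat m n" and B': "map_mat \<phi> B \<in> carrier_mat n l" using A B by auto
  fix i j assume "i < dim_row (map_mat \<phi> A * map_mat \<phi> B)" "j < dim_col (map_mat \<phi> A * map_mat \<phi> B)"
  hence ij: "i < m" "j < l" using A B by auto
  have AB: "A $$ (i, k) \<in> K" "B $$ (k, j) \<in> K" if "k < n" for k
    using A B ij that by (auto simp: elements_mat_iff)
  have "map_mat \<phi> (A * B) $$ (i, j) = \<phi> ((A * B) $$ (i, j))" using A B ij by simp
  also have "\<dots> = \<phi> (\<Sum>k<n. A $$ (i, k) * B $$ (k, j))" unfolding mat_mult_index[OF A(1) B(1) ij] ..
  also have "\<dots> = (\<Sum>k<n. \<phi> (A $$ (i, k) * B $$ (k, j)))" using AB K by (intro hom_sum[OF K \<phi>] subfield_mult) auto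
  also have "\<dots> = (\<Sum>k<n. \<phi> (A $$ (i, k)) * \<phi> (B $$ (k, j)))" using AB by (intro sum.cong refl ring_hom_on_mult[OF \<phi>]) auto
  also have "\<dots> = (map_mat \<phi> A * map_mat \<phi> B) $$ (i, j)"
    unfolding mat_mult_index[OF A' B' ij] using A B ij by (intro sum.cong) auto
  finally show "map_mat \<phi> (A * B) $$ (i, j) = (map_mat \<phi> A * map_mat \<phi> B) $$ (i, j)" .
qed (use A B in auto)

lemma map_mat_one_hom:
  assumes "is_subfield K" "ring_hom_on K S \<phi>"
  shows "map_mat \<phi> (1\<^sub>m n) = 1\<^sub>m n"
  using ring_hom_on_1[OF assms(2)] ring_hom_on_0[OF assms(2) subfield_0[OF assms(1)]] by (intro eq_matI) auto

lemma elements_map_mat_hom: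
  "ring_hom_on K L \<phi> \<Longrightarrow> elements_mat A \<subseteq> K \<Longrightarrow> elements_mat (map_mat \<phi> A) \<subseteq> L"
  by (auto simp: elements_mat_map ring_hom_on_def)

text \<open>\<open>\<phi>\<close> is a homomorphism on \<open>K\<close> only. An inverse with
  entries in \<open>K\<close> is mapped to an inverse of the image.\<close>

lemma map_mat_det_nonzero:
  fixes A :: "'a::field mat" and \<phi> :: "'a \<Rightarrow> 'b::field"
  assumes K: "is_subfield K" and \<phi>: "ring_hom_on K L \<phi>" and A: "A \<in> carrier_mat n n" "elements_mat A \<subseteq> K" "det A \<noteq> 0"
  shows "det (map_mat \<phi> A) \<noteq> 0"
proof -
  obtain B where B: "B \<in> carrier_mat n n" "elements_mat B \<subseteq> K" "B * A = 1\<^sub>m n"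
    using ex_inverse_mat_det[OF K A] by blast
  have "map_mat \<phi> B * map_mat \<phi> A = 1\<^sub>m n"
    using map_mat_mult_hom[OF K \<phi> B(1,2) A(1,2)] map_mat_one_hom[OF K \<phi>] B(3) by simp
  thus ?thesis using A B by (intro det_nonzero_if_inverse[of _ n "map_mat \<phi> B"]) auto
qed

lemma quad_form_map:
  fixes q :: "'a::field mat" and \<phi> :: "'a \<Rightarrow> 'b::field"
  assumes K: "is_subfield K" and \<phi>: "ring_hom_on K L \<phi>" and q: "quad_form K q"
  shows "quad_form L (map_mat \<phi> q)"
proof -
  note qq = quad_formD[OF q]
  have "transpose_mat (map_mat \<phi> q) = map_mat \<phi> (q\<^sup>T)" by (rule map_mat_transpose)
  hence "transpose_mat (map_mat \<phi> q) = map_mat \<phi> q" unfolding qq(3) .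
  moreover have "dim_col q = dim_row q" using qq(1) by (metis carrier_matD(2))
  hence "square_mat (map_mat \<phi> q)" by simp
  ultimately show ?thesis
    unfolding quad_form_def using map_mat_det_nonzero[OF K \<phi> qq(1,2,4)] elements_map_mat_hom[OF \<phi> qq(2)]
    by (intro conjI)
qed

lemma isometric_map:
  fixes p :: "'a::field mat" and \<phi> :: "'a \<Rightarrow> 'b::field"
  assumes K: "is_subfield K" and \<phi>: "ring_hom_on K L \<phi>" and p: "p \<in> carrier_mat n n" "elements_mat p \<subseteq> K"
    and i: "isometric K p q"
  shows "isometric L (map_mat \<phi> p) (map_mat \<phi> q)"
proof -
  obtain P where P: "P \<in> carrier_mat n n" "elements_mat P \<subseteq> K" "det P \<noteq> 0" "P\<^sup>T * p * P = q"
    using i p by (auto simp: isometric_def)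
  have Pt: "P\<^sup>T \<in> carrier_mat n n" "elements_mat (P\<^sup>T) \<subseteq> K"
    using P by (auto simp: elements_mat_iff)
  have "map_mat \<phi> q = map_mat \<phi> (P\<^sup>T) * map_mat \<phi> p * map_mat \<phi> P"
    unfolding P(4)[symmetric]
      map_mat_mult_hom[OF K \<phi> mult_carrier_mat[OF Pt(1) p(1)] mat_mult_closed[OF K Pt(1) p(1) Pt(2) p(2)] P(1,2)]
      map_mat_mult_hom[OF K \<phi> Pt p] ..
  hence "transpose_mat (map_mat \<phi> P) * map_mat \<phi> p * map_mat \<phi> P = map_mat \<phi> q"
    by (simp add: map_mat_transpose)
  moreover have "dim_row (map_mat \<phi> p) = n" "dim_row (map_mat \<phi> q) = n"
    using p isometric_carrier[OF i p(1)] by auto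
  ultimately show ?thesis
    unfolding isometric_def using P map_mat_det_nonzero[OF K \<phi> P(1-3)] elements_map_mat_hom[OF \<phi> P(2)]
    by (intro conjI bexI[of _ "map_mat \<phi> P"]) auto
qed

text \<open>A vector over \<open>K\<close> that \<open>q\<close> maps to zero has value zero, so it
  is zero by anisotropy, and \<open>q\<close> is injective on vectors over \<open>K\<close>. This is
  how the tensor product is seen to be nondegenerate.\<close>

lemma quad_form_if_anisotropic:
  assumes K: "is_subfield K" and q: "q \<in> carrier_mat n n" "elements_mat q \<subseteq> K" "q\<^sup>T = q"
    and an: "anisotropic K q"
  shows "quad_form K q"
proof -
  obtain A where "A \<in> carrier_mat n n" "A * q = 1\<^sub>m n"
  proof -
    have "\<forall>j<n. x j = 0" if x: "\<forall>j<n. x j \<in> K" "\<forall>i<n. (\<Sum>j<n. q $$ (i, j) * x j) = 0" for x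
    proof -
      have "bil n (gram q) x x = (\<Sum>i<n. x i * (\<Sum>j<n. q $$ (i, j) * x j))"
        by (simp add: bil_def sum_distrib_left mult_ac)
      hence "bil n (gram q) x x = 0" using x(2) by simp
      thus ?thesis using an x(1) unfolding anisotropic_iff[OF q(1)] isotr_def by blast
    qed
    from ex_inverse_mat[OF K q(1,2) this] show thesis using that by blast
  qed
  hence "det q \<noteq> 0" using det_nonzero_if_inverse[OF q(1)] by blast
  moreover have "square_mat q" using q(1) by simp
  ultimately show ?thesis unfolding quad_form_def using q(2,3) by (intro conjI)
qed

lemma tot_iso_gram_map:
  assumes "q \<in> carrier_mat n n"
  shows "tot_iso K n (gram (map_mat \<phi> q)) m = tot_iso K n (gmap \<phi> q) m"
  using assms by (intro tot_iso_cong) auto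


section \<open>Genericity of the function field\<close>

lemma ring_hom_on_power:
  assumes "ring_hom_on R S f" "1 \<in> R" "\<And>x y. x \<in> R \<Longrightarrow> y \<in> R \<Longrightarrow> x * y \<in> R" "x \<in> R"
  shows "f (x ^ k) = f x ^ k"
proof -
  have "x ^ k \<in> R \<and> f (x ^ k) = f x ^ k"
    using assms by (induction k) (auto simp: ring_hom_on_1 ring_hom_on_mult)
  thus ?thesis ..
qed

text \<open>Serves both homomorphisms out of the polynomial ring: \<open>\<psi>\<close> into the
  function field, where it describes the generic point, and evaluation at a point.\<close>

lemma qf_poly_hom:
  assumes K: "is_subfield K" and h: "ring_hom_on (polys_in K V) S h" and V: "{..<n} \<subseteq> V"
    and p: "p \<in> carrier_mat n n" "elements_mat p \<subseteq> K"
  shows "qf_poly p \<in> polys_in K V"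
    "h (qf_poly p) = bil n (\<lambda>i j. h (mv_const (p $$ (i, j)))) (\<lambda>i. h (mv_var i)) (\<lambda>i. h (mv_var i))"
proof -
  let ?R = "polys_in K V"
  have n: "dim_row p = n" using p(1) by simp
  have c: "mv_const (p $$ (i, j)) \<in> ?R" if "i < n" "j < n" for i j
    using p that by (intro polys_in_const[OF K]) (auto simp: elements_mat_iff)
  have v: "mv_var i \<in> ?R" if "i < n" for i using V that by (intro polys_in_var[OF K]) auto
  have cv: "mv_const (p $$ (i, j)) * mv_var i \<in> ?R" "mv_const (p $$ (i, j)) * mv_var i * mv_var j \<in> ?R"
    if "i < n" "j < n" for i j using c[OF that] v[OF that(1)] v[OF that(2)] by (auto intro: polys_in_mult[OF K])
  show "qf_poly p \<in> ?R" unfolding qf_poly_def n using cv by (intro polys_in_sum[OF K]) auto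
  have hs: "h (\<Sum>i\<in>I. f i) = (\<Sum>i\<in>I. h (f i))" if "\<And>i. i \<in> I \<Longrightarrow> f i \<in> ?R" for I :: "nat set" and f
    using polys_in_0[OF K] polys_in_add[OF K] that by (intro ring_hom_on_sum[OF h])
  have "h (qf_poly p) = (\<Sum>i<n. h (\<Sum>j<n. mv_const (p $$ (i, j)) * mv_var i * mv_var j))"
    unfolding qf_poly_def n using cv by (intro hs polys_in_sum[OF K]) auto
  also have "\<dots> = (\<Sum>i<n. \<Sum>j<n. h (mv_const (p $$ (i, j)) * mv_var i * mv_var j))"
    using cv by (intro sum.cong refl hs) auto
  also have "\<dots> = (\<Sum>i<n. \<Sum>j<n. h (mv_const (p $$ (i, j))) * h (mv_var i) * h (mv_var j))"
    using c v cv by (intro sum.cong refl) (simp add: ring_hom_on_mult[OF h])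
  finally show "h (qf_poly p) = bil n (\<lambda>i j. h (mv_const (p $$ (i, j)))) (\<lambda>i. h (mv_var i)) (\<lambda>i. h (mv_var i))"
    by (simp add: bil_def)
qed

lemma ev_qf_poly:
  assumes K: "is_subfield K" and \<sigma>: "ring_hom_on K S \<sigma>" and p: "p \<in> carrier_mat n n" "elements_mat p \<subseteq> K"
  shows "ev \<sigma> x (qf_poly p) = bil n (gmap \<sigma> p) x x"
  using qf_poly_hom(2)[OF K ev_ring_hom[OF K \<sigma>] subset_refl p] by (simp add: ev_const[OF K \<sigma>] ev_var[OF K \<sigma>])

text \<open>Otherwise a unit vector would be isotropic. A nonzero coefficient at the square of
  variable 0 allows the quadric to be solved for that variable.\<close>

lemma anisotropic_diag_nonzero:
  fixes p :: "'a::field mat"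
  assumes K: "is_subfield K" and p: "p \<in> carrier_mat n n" "anisotropic K p" and k: "k < n"
  shows "p $$ (k, k) \<noteq> 0"
proof
  assume 0: "p $$ (k, k) = 0"
  define e where "e i = (if i = k then 1 else (0::'a))" for i
  have "bil n (gram p) e e = (\<Sum>i<n. if i = k then \<Sum>j<n. if j = k then p $$ (i, j) else 0 else 0)"
    unfolding bil_def e_def by (intro sum.cong refl) (simp add: if_distrib cong: if_cong)
  hence "bil n (gram p) e e = 0" using k 0 by simp
  moreover have "\<forall>j<n. e j \<in> K" using K by (auto simp: e_def intro: subfield_closed)
  moreover have "\<exists>j<n. e j \<noteq> 0" using k by (intro exI[of _ k]) (simp add: e_def)
  ultimately show False using p(2) unfolding anisotropic_iff[OF p(1)] isotr_def by blast
qed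

text \<open>The vector \<open>(1, 1)\<close> is isotropic in the hyperbolic plane. This rules out
  the degenerate branch in the definition of the function field.\<close>

lemma not_isometric_hyperbolic_plane:
  fixes p :: "'a::field mat"
  assumes K: "is_subfield K" and p: "p \<in> carrier_mat n n" "anisotropic K p"
  shows "\<not> isometric K p hyperbolic_plane"
proof
  assume i: "isometric K p hyperbolic_plane"
  hence n: "n = 2" using p(1) hyperbolic_plane_carrier by (auto simp: isometric_def)
  have "bil 2 (gram (hyperbolic_plane :: 'a mat)) (\<lambda>_. 1) (\<lambda>_. 1) = 0"
    by (simp add: bil_def numeral_2_eq_2 diag_form_def mat_diag_def)
  hence "isotr K 2 (gram (hyperbolic_plane :: 'a mat))"
    unfolding isotr_def using subfield_1[OF K] by (intro exI[of _ "\<lambda>_. 1"]) (auto intro: exI[of _ 0])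
  hence "isotr K n (gram p)" using tot_iso_isometric[OF K p(1) i, of 1] unfolding tot_iso_1[OF K] n by blast
  thus False using p(2) anisotropic_iff[OF p(1)] by blast
qed

lemma function_fieldE:
  fixes p :: "'a::field mat" and M :: "'c::field set"
  assumes ff: "is_function_field K p M \<chi>" and p: "p \<in> carrier_mat n n" "anisotropic K p" "n \<ge> 2"
  obtains \<psi> where "is_subfield K" "is_subfield M" "ring_hom_on K M \<chi>" "ring_hom_on (polys_in K {..<n}) M \<psi>"
    "\<And>c. c \<in> K \<Longrightarrow> \<psi> (mv_const c) = \<chi> c"
    "\<And>f. f \<in> polys_in K {..<n} \<Longrightarrow> \<psi> f = 0 \<longleftrightarrow> (\<exists>g\<in>polys_in K {..<n}. f = qf_poly p * g)"
    "M = {\<psi> f / \<psi> g | f g. f \<in> polys_in K {..<n} \<and> g \<in> polys_in K {..<n} \<and> \<psi> g \<noteq> 0}"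
proof -
  let ?R = "polys_in K {..<n}"
  have K: "is_subfield K" using ff by (simp add: is_function_field_def)
  have n: "dim_row p = n" using p by simp
  have "\<not> (dim_row p \<le> 1 \<or> isometric K p hyperbolic_plane)"
    using not_isometric_hyperbolic_plane[OF K p(1,2)] p(3) n by auto
  with ff obtain \<psi> where *: "is_subfield M" "ring_hom_on K M \<chi>" "ring_hom_on ?R M \<psi>" "\<forall>c\<in>K. \<psi> (mv_const c) = \<chi> c"
    and ker: "{f\<in>?R. \<psi> f = 0} = {qf_poly p * g | g. g \<in> ?R}"
    and M: "M = {\<psi> f / \<psi> g | f g. f \<in> ?R \<and> g \<in> ?R \<and> \<psi> g \<noteq> 0}"
    unfolding is_function_field_def mv_polys_eq n Let_def by auto
  have "\<psi> f = 0 \<longleftrightarrow> (\<exists>g\<in>?R. f = qf_poly p * g)" if "f \<in> ?R" for f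
    using that ker by blast
  thus thesis using that K * M by blast
qed

text \<open>The family over \<open>M\<close> acquires polynomial coordinates after multiplication by
  a denominator \<open>d\<close>. Evaluation at a point \<open>x\<close> over \<open>E\<close> on
  the quadric kills the kernel of \<open>\<psi>\<close> and so specialises the family, provided
  \<open>d\<close> does not vanish at \<open>x\<close>. The point is chosen to avoid the zeros of
  \<open>N\<close> instead, a multiple of \<open>d\<close> modulo the quadric that is free of
  variable 0, because for such polynomials suitable points are available.\<close>

lemma tot_iso_of_function_field:
  fixes p :: "'a::field mat" and M :: "'c::field set" and \<sigma> :: "'a \<Rightarrow> 'd::alg_closed_field"
  assumes ff: "is_function_field K p M \<chi>" and p: "quad_form K p" "anisotropic K p" "dim_row p \<ge> 2"
    and W: "tot_iso M (dim_row p) (gmap \<chi> p) m"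
    and \<sigma>: "ring_hom_on K S \<sigma>" and two: "(2::'d) \<noteq> 0"
    and E: "is_subfield E" "\<sigma> ` K \<subseteq> E" "infinite E" and iso: "isotr E (dim_row p) (gmap \<sigma> p)"
  shows "tot_iso E (dim_row p) (gmap \<sigma> p) m"
proof -
  define n where "n = dim_row p"
  note p' = quad_formD[OF p(1), folded n_def] and n2 = p(3)[folded n_def]
  note W = W[folded n_def] and iso = iso[folded n_def]
  let ?R = "polys_in K {..<n}"
  obtain \<psi> where K: "is_subfield K" and M: "is_subfield M" and \<chi>: "ring_hom_on K M \<chi>" and \<psi>: "ring_hom_on ?R M \<psi>"
    and \<psi>c: "\<And>c. c \<in> K \<Longrightarrow> \<psi> (mv_const c) = \<chi> c"
    and ker: "\<And>f. f \<in> ?R \<Longrightarrow> \<psi> f = 0 \<longleftrightarrow> (\<exists>g\<in>?R. f = qf_poly p * g)"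
    and Meq: "M = {\<psi> f / \<psi> g | f g. f \<in> ?R \<and> g \<in> ?R \<and> \<psi> g \<noteq> 0}"
    using function_fieldE[OF ff p'(1) p(2) n2] by blast
  define Q where "Q i j = mv_const (p $$ (i, j))" for i j
  have QR: "Q i j \<in> ?R" if "i < n" "j < n" for i j unfolding Q_def using p'(5)[OF that] by (rule polys_in_const[OF K])
  have "tot_iso M n (\<lambda>i j. \<psi> (Q i j)) m"
    using W tot_iso_cong[of n "\<lambda>i j. \<psi> (Q i j)" "\<lambda>i j. \<chi> (p $$ (i, j))" M m] \<psi>c p'(5) by (simp add: Q_def)
  note spec = tot_iso_specialize[OF M Meq \<psi> polys_in_0[OF K] polys_in_1[OF K] polys_in_add[OF K] polys_in_diff[OF K] polys_in_mult[OF K] QR this]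
  then obtain d where d: "d \<in> ?R" "\<psi> d \<noteq> 0" and sp: "\<And>h (E :: 'd set). is_subfield E \<Longrightarrow> ring_hom_on ?R E h \<Longrightarrow>
      h d \<noteq> 0 \<Longrightarrow> \<forall>f\<in>?R. \<psi> f = 0 \<longrightarrow> h f = 0 \<Longrightarrow> tot_iso E n (\<lambda>i j. h (Q i j)) m" by blast
  have n0: "0 < n" using n2 by simp
  have p00: "p $$ (0, 0) \<noteq> 0" using anisotropic_diag_nonzero[OF K p'(1) p(2) n0] .
  have qR: "qf_poly p \<in> ?R" using qf_poly_hom(1)[OF K \<psi> subset_refl p'(1,2)] .
  have "\<psi> (qf_poly p) = 0" using ker[OF qR] polys_in_1[OF K] by (metis mult_1_right)
  hence "bil n (\<lambda>i j. \<psi> (mv_const (p $$ (i, j)))) (\<lambda>i. \<psi> (mv_var i)) (\<lambda>i. \<psi> (mv_var i)) = 0"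
    unfolding qf_poly_hom(2)[OF K \<psi> subset_refl p'(1,2)] .
  from ex_multiple_without_var0[OF K \<psi> n0 p'(5) p00 this d]
  obtain N g where N: "N \<in> polys_in K {0<..<n}" "\<psi> N \<noteq> 0" and g: "g \<in> ?R" "\<psi> d * \<psi> g = \<psi> N" by blast
  have NR: "N \<in> ?R" using N(1) polys_in_mono[of "{0<..<n}" "{..<n}" K] by fastforce
  have N0: "N \<noteq> 0" using N(2) ring_hom_on_0[OF \<psi> polys_in_0[OF K]] by blast
  have det: "det (map_mat \<sigma> p) \<noteq> 0" using map_mat_det_nonzero[OF K \<sigma> p'(1,2,4)] .
  have nondeg: "\<forall>j<n. y j = 0" if "\<forall>i<n. (\<Sum>j<n. \<sigma> (p $$ (i, j)) * y j) = 0" for y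
    using that p'(1) by (intro det_nonzero_inj[OF _ det]) auto
  obtain x where x: "\<forall>i<n. x i \<in> E" "bil n (gmap \<sigma> p) x x = 0" "ev \<sigma> x N \<noteq> 0"
    using ex_point_nonvanishing[OF K \<sigma> n0 two refl p'(5,6) p00 nondeg E iso N(1) N0] by blast
  let ?h = "ev \<sigma> x"
  have h: "ring_hom_on ?R E ?h"
    using ev_ring_hom[OF K \<sigma>, of "{..<n}" x] ev_in[OF K \<sigma> _ E(1,2), of _ "{..<n}" x] x(1)
    unfolding ring_hom_on_def by auto
  have hker: "?h f = 0" if f: "f \<in> ?R" "\<psi> f = 0" for f
  proof -
    obtain g where g: "g \<in> ?R" "f = qf_poly p * g" using ker[OF f(1)] f(2) by blast
    show ?thesis unfolding g(2) ring_hom_on_mult[OF h qR g(1)] ev_qf_poly[OF K \<sigma> p'(1,2)] x(2) by simp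
  qed
  have "?h d \<noteq> 0"
  proof
    assume hd: "?h d = 0"
    have dg: "d * g \<in> ?R" using d g by (intro polys_in_mult[OF K])
    \<comment> \<open>\<open>N - d * g\<close> lies in the kernel of \<open>\<psi>\<close> and
      therefore vanishes at \<open>x\<close>; if \<open>d\<close> vanished there as well, so would
      \<open>N\<close>.\<close>
    have "\<psi> N = \<psi> (N - d * g) + \<psi> (d * g)"
      using ring_hom_on_add[OF \<psi> polys_in_diff[OF K NR dg] dg] by simp
    hence "\<psi> (N - d * g) = 0" using ring_hom_on_mult[OF \<psi> d(1) g(1)] g(2) by simp
    hence "?h (N - d * g) = 0" using hker polys_in_diff[OF K NR dg] by blast
    moreover have "?h N = ?h (N - d * g) + ?h (d * g)"
      using ring_hom_on_add[OF h polys_in_diff[OF K NR dg] dg] by simp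
    ultimately show False using x(3) ring_hom_on_mult[OF h d(1) g(1)] hd by simp
  qed
  hence "tot_iso E n (\<lambda>i j. ?h (Q i j)) m" using sp[OF E(1) h] hker by blast
  thus ?thesis unfolding Q_def ev_const[OF K \<sigma>] n_def .
qed

text \<open>Over an algebraic closure the quadric has points with any prescribed coordinate 1, so a
  polynomial in variable 1 alone that lies in the kernel of \<open>\<psi>\<close> vanishes at every
  \<open>t\<close>. Hence the image of this variable is nonzero, which makes the generic point a
  nonzero isotropic vector, and its powers are pairwise distinct, which makes \<open>L\<close>
  infinite.\<close>

lemma function_field_infinite_isotropic:
  fixes p :: "'a::field mat" and L :: "'b::field set"
  assumes ff: "is_function_field K p L \<phi>" and p: "p \<in> carrier_mat n n" "elements_mat p \<subseteq> K" "anisotropic K p" "n \<ge> 2"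
  shows "infinite L" "isotr L n (gmap \<phi> p)"
proof -
  let ?R = "polys_in K {..<n}"
  obtain \<psi> where K: "is_subfield K" and L: "is_subfield L" and \<phi>: "ring_hom_on K L \<phi>" and \<psi>: "ring_hom_on ?R L \<psi>"
    and \<psi>c: "\<And>c. c \<in> K \<Longrightarrow> \<psi> (mv_const c) = \<phi> c"
    and ker: "\<And>f. f \<in> ?R \<Longrightarrow> \<psi> f = 0 \<longleftrightarrow> (\<exists>g\<in>?R. f = qf_poly p * g)"
    using function_fieldE[OF ff p(1,3,4)] by blast
  have n: "0 < n" "1 < n" using p(4) by auto
  have \<sigma>: "ring_hom_on K UNIV (\<lambda>x. to_ac (\<phi> x))" using \<phi> by (simp add: ring_hom_on_def)
  have qR: "qf_poly p \<in> ?R" using qf_poly_hom(1)[OF K \<psi> subset_refl p(1,2)] .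
  have X: "mv_var 1 \<in> ?R" using n by (intro polys_in_var[OF K]) auto
  have "p $$ (0, 0) \<noteq> 0" "p $$ (0, 0) \<in> K"
    using anisotropic_diag_nonzero[OF K p(1,3) n(1)] p n by (auto simp: elements_mat_iff)
  hence p00: "to_ac (\<phi> (p $$ (0, 0))) \<noteq> 0" using ring_hom_on_inj[OF \<phi> K] by auto
  have van: "\<exists>x. ev (\<lambda>x. to_ac (\<phi> x)) x f = 0 \<and> x 1 = t" if f: "f \<in> ?R" "\<psi> f = 0" for f t
  proof -
    obtain g where g: "g \<in> ?R" "f = qf_poly p * g" using ker[OF f(1)] f(2) by blast
    obtain c where c: "bil n (\<lambda>i j. to_ac (\<phi> (p $$ (i, j)))) ((\<lambda>_. t)(0 := c)) ((\<lambda>_. t)(0 := c)) = 0"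
      using ex_isotropic_fun_upd[of 0 n "\<lambda>i j. to_ac (\<phi> (p $$ (i, j)))" "\<lambda>_. t"] n p00 by blast
    have "ev (\<lambda>x. to_ac (\<phi> x)) ((\<lambda>_. t)(0 := c)) f = 0"
      unfolding g(2) ev_mult[OF K \<sigma> qR g(1)] ev_qf_poly[OF K \<sigma> p(1,2)] c by simp
    thus ?thesis by (intro exI[of _ "(\<lambda>_. t)(0 := c)"]) simp
  qed
  have X0: "\<psi> (mv_var 1) \<noteq> 0"
  proof
    assume "\<psi> (mv_var 1) = 0"
    from van[OF X this, of 1] show False by (auto simp: ev_var[OF K \<sigma>])
  qed
  have "\<psi> (qf_poly p) = 0" using ker[OF qR] polys_in_1[OF K] by (metis mult_1_right)
  hence "bil n (\<lambda>i j. \<psi> (mv_const (p $$ (i, j)))) (\<lambda>i. \<psi> (mv_var i)) (\<lambda>i. \<psi> (mv_var i)) = 0"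
    unfolding qf_poly_hom(2)[OF K \<psi> subset_refl p(1,2)] .
  moreover have "\<psi> (mv_const (p $$ (i, j))) = \<phi> (p $$ (i, j))" if "i < n" "j < n" for i j
    using p that by (intro \<psi>c) (auto simp: elements_mat_iff)
  ultimately have "bil n (gmap \<phi> p) (\<lambda>i. \<psi> (mv_var i)) (\<lambda>i. \<psi> (mv_var i)) = 0"
    by (simp add: bil_def)
  moreover have "\<psi> (mv_var i) \<in> L" if "i < n" for i
    using that by (intro ring_hom_on_in[OF \<psi>] polys_in_var[OF K]) auto
  ultimately show "isotr L n (gmap \<phi> p)"
    unfolding isotr_def using X0 n by (intro exI[of _ "\<lambda>i. \<psi> (mv_var i)"]) blast
  show "infinite L"
  proof
    assume fin: "finite L"
    have "\<psi> (mv_var 1 ^ k) \<in> L" for k using polys_in_power[OF K X] by (intro ring_hom_on_in[OF \<psi>])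
    hence "range (\<lambda>k. \<psi> (mv_var 1 ^ k)) \<subseteq> L" by blast
    hence "\<not> inj (\<lambda>k::nat. \<psi> (mv_var 1 ^ k))"
      using fin finite_subset range_inj_infinite by blast
    then obtain a0 b0 :: nat where ab0: "a0 \<noteq> b0" "\<psi> (mv_var 1 ^ a0) = \<psi> (mv_var 1 ^ b0)"
      unfolding inj_def by blast
    define a b where "a = min a0 b0" and "b = max a0 b0"
    have ab: "a < b" "\<psi> (mv_var 1 ^ a) = \<psi> (mv_var 1 ^ b)"
      using ab0 by (auto simp: a_def b_def min_def max_def)
    \<comment> \<open>The coefficients of \<open>T ^ b - T ^ a - 1\<close>; at a root
      \<open>t\<close> the difference of the two powers is 1. Writing them as a sum of three terms
      also covers \<open>a = 0\<close>.\<close>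
    define f where "f i = (if i = b then 1 else 0) - (if i = a then 1 else 0) - (if i = 0 then 1 else (0 :: 'b alg_closure))" for i
    obtain t where "(\<Sum>i\<le>b. f i * t ^ i) = 0" using alg_closed[of b f] ab(1) by (auto simp: f_def)
    moreover have "(\<Sum>i\<le>b. f i * t ^ i) = t ^ b - t ^ a - 1"
      unfolding f_def left_diff_distrib sum_subtractf if_distrib[of "\<lambda>x. x * _"] using ab(1)
      by (simp cong: if_cong)
    ultimately have t: "t ^ b - t ^ a \<noteq> 0" by auto
    let ?f = "mv_var 1 ^ b - mv_var 1 ^ a"
    have R: "mv_var 1 ^ b \<in> ?R" "mv_var 1 ^ a \<in> ?R" "?f \<in> ?R"
      using X by (auto intro: polys_in_power[OF K] polys_in_diff[OF K])
    have "\<psi> (mv_var 1 ^ b) = \<psi> ?f + \<psi> (mv_var 1 ^ a)" using ring_hom_on_add[OF \<psi> R(3,2)] by simp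
    hence "\<psi> ?f = 0" using ab(2) by simp
    from van[OF R(3) this] obtain x where x: "ev (\<lambda>x. to_ac (\<phi> x)) x ?f = 0" "x 1 = t" by blast
    note h = ev_ring_hom[OF K \<sigma>, of "{..<n}" x]
    have "ev (\<lambda>x. to_ac (\<phi> x)) x (mv_var 1 ^ b) = ev (\<lambda>x. to_ac (\<phi> x)) x (mv_var 1 ^ a)"
      using ring_hom_on_add[OF h R(3,2)] x(1) by simp
    moreover have "ev (\<lambda>x. to_ac (\<phi> x)) x (mv_var 1 ^ k) = t ^ k" for k
      using ring_hom_on_power[OF h polys_in_1[OF K] polys_in_mult[OF K], of "mv_var 1" k] X x(2)
      by (simp add: ev_var[OF K \<sigma>])
    ultimately show False using t by simp
  qed
qed


section \<open>Multiples of Pfister forms\<close>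

abbreviation pfister :: "'a::field list \<Rightarrow> 'a mat" where
  "pfister as \<equiv> foldr (\<lambda>a r. tensor_form (diag_form [1, a]) r) as (diag_form [1])"

lemma pfister_carrier: "(pfister as :: 'a::field mat) \<in> carrier_mat (2 ^ length as) (2 ^ length as)"
proof (induction "as")
  case Nil
  show ?case using diag_form_carrier[of "[1 :: 'a]"] by simp
next
  case (Cons a as)
  from tensor_form_carrier[OF binary_carrier Cons] show ?case by simp
qed

lemma pfister_closed:
  assumes K: "is_subfield K" and "set as \<subseteq> K"
  shows "elements_mat (pfister as) \<subseteq> K"
  using assms(2)
proof (induction "as")
  case Nil
  show ?case using K by (auto simp: elements_mat_iff diag_form_def mat_diag_def intro: subfield_closed)
next
  case (Cons a as)
  have "elements_mat (diag_form [1, a]) \<subseteq> K"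
    using K Cons.prems by (auto simp: elements_mat_iff diag_form_def mat_diag_def less_Suc_eq intro: subfield_closed)
  from tensor_form_closed[OF K binary_carrier pfister_carrier this] Cons show ?case by simp
qed

lemma pfister_sym: "transpose_mat (pfister as) = (pfister as :: 'a::field mat)"
proof (induction "as")
  case Nil
  show ?case by (intro eq_matI) (auto simp: diag_form_def mat_diag_def)
next
  case (Cons a as)
  have "transpose_mat (diag_form [1, a] :: 'a mat) = diag_form [1, a]"
    by (intro eq_matI) (auto simp: diag_form_def mat_diag_def)
  thus ?case using Cons by (simp add: tensor_form_transpose[OF binary_carrier pfister_carrier])
qed

text \<open>Each slot doubles the dimension. \<open>E\<close> is generalised in the induction
  because doubling for the outermost slot calls on the claim for the remaining slots over fields
  containing \<open>E\<close>; these are again infinite.\<close>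

lemma tot_iso_pfister_tensor:
  fixes p :: "'a::field mat" and \<sigma> :: "'a \<Rightarrow> 'd::alg_closed_field"
  assumes K: "is_subfield K" and \<sigma>: "ring_hom_on K S \<sigma>" and p: "quad_form K p" "dim_row p \<ge> 2"
    and gen: "\<And>E. is_subfield E \<Longrightarrow> \<sigma> ` K \<subseteq> E \<Longrightarrow> infinite E \<Longrightarrow> isotr E (dim_row p) (gmap \<sigma> p) \<Longrightarrow>
      tot_iso E (dim_row p) (gmap \<sigma> p) m"
    and asK0: "set as \<subseteq> K" and E: "is_subfield E" "\<sigma> ` K \<subseteq> E" "infinite E"
    and iso: "isotr E (2 ^ length as * dim_row p) (gmap \<sigma> (tensor_form (pfister as) p))"
  shows "tot_iso E (2 ^ length as * dim_row p) (gmap \<sigma> (tensor_form (pfister as) p)) (2 ^ length as * m)"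
  using asK0 E iso
proof (induction "as" arbitrary: E)
  case Nil
  have eq: "tensor_form (pfister []) p = p" using tensor_form_one_left[OF quad_formD(1)[OF p(1)]] by simp
  show ?case using gen[OF Nil(2-4)] Nil(5) unfolding eq by simp
next
  case (Cons a as)
  define n where "n = 2 ^ length as * dim_row p"
  define T where "T = tensor_form (pfister as) p"
  note pp = quad_formD[OF p(1)]
  have asK: "set as \<subseteq> K" "a \<in> K" using Cons.prems by auto
  have T: "T \<in> carrier_mat n n" unfolding T_def n_def by (rule tensor_form_carrier[OF pfister_carrier pp(1)])
  have TK: "elements_mat T \<subseteq> K" unfolding T_def
    by (rule tensor_form_closed[OF K pfister_carrier pp(1) pfister_closed[OF K asK(1)] pp(2)])
  have Tt: "T\<^sup>T = T" unfolding T_def tensor_form_transpose[OF pfister_carrier pp(1)] pfister_sym pp(3) ..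
  have TK': "T $$ (i, j) \<in> K" "T $$ (i, j) = T $$ (j, i)" if "i < n" "j < n" for i j
  proof -
    show "T $$ (i, j) \<in> K" using T TK that by (auto simp: elements_mat_iff)
    have "T\<^sup>T $$ (i, j) = T $$ (j, i)" using T that by (intro index_transpose_mat(1)) auto
    thus "T $$ (i, j) = T $$ (j, i)" unfolding Tt .
  qed
  have eqT: "tensor_form (pfister (a # as)) p = tensor_form (diag_form [1, a]) T"
    unfolding T_def using tensor_form_assoc[OF binary_carrier pfister_carrier pp(1)] by simp
  have N: "2 ^ length (a # as) * dim_row p = n + n" by (simp add: n_def)
  have dbl: "\<sigma> (tensor_form (pfister (a # as)) p $$ (i, j)) = dbl n (\<sigma> a) (gmap \<sigma> T) i j"
    if "i < n + n" "j < n + n" for i j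
    unfolding eqT tensor_form_dbl[OF T that] using that asK TK'(1) ring_hom_on_mult[OF \<sigma>]
      ring_hom_on_0[OF \<sigma> subfield_0[OF K]] by (auto simp: dbl_def)
  let ?D = "dbl n (\<sigma> a) (gmap \<sigma> T)" and ?P = "\<lambda>i j. \<sigma> (tensor_form (pfister (a # as)) p $$ (i, j))"
  have isotr_eq: "isotr E (n + n) ?P = isotr E (n + n) ?D" by (intro isotr_cong dbl)
  have tot_iso_eq: "tot_iso E (n + n) ?P k = tot_iso E (n + n) ?D k" for k by (intro tot_iso_cong dbl)
  have "tot_iso E (n + n) ?D (2 * (2 ^ length as * m))"
  proof (rule tot_iso_dbl[OF Cons.prems(2)])
    have "2 ^ length as * dim_row p \<ge> 1 * dim_row p" by (intro mult_right_mono) auto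
    thus "2 \<le> n" unfolding n_def using p(2) by linarith
    show "\<sigma> (T $$ (i, j)) \<in> E" if "i < n" "j < n" for i j using TK'(1)[OF that] Cons.prems(3) by blast
    show "\<sigma> (T $$ (i, j)) = \<sigma> (T $$ (j, i))" if "i < n" "j < n" for i j using TK'(2)[OF that] by simp
    show "\<sigma> a \<in> E" using asK(2) Cons.prems(3) by blast
    show "isotr E (n + n) ?D" using Cons.prems(5) unfolding N isotr_eq .
  next
    fix E' assume E': "is_subfield E'" "E \<subseteq> E'" and i: "isotr E' n (gmap \<sigma> T)"
    have "infinite E'" using E'(2) Cons.prems(4) finite_subset by blast
    moreover have "\<sigma> ` K \<subseteq> E'" using E'(2) Cons.prems(3) by blast
    ultimately show "tot_iso E' n (gmap \<sigma> T) (2 ^ length as * m)"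
      using Cons.IH[OF asK(1) E'(1)] i unfolding T_def n_def by blast
  qed
  moreover have "2 ^ length (a # as) * m = 2 * (2 ^ length as * m)" by simp
  ultimately show ?case unfolding N tot_iso_eq by metis
qed

section \<open>Passage to the algebraic closure and back\<close>

lemma to_ac_bil: "to_ac (bil n Q u v) = bil n (\<lambda>i j. to_ac (Q i j)) (\<lambda>i. to_ac (u i)) (\<lambda>i. to_ac (v i))"
  by (simp add: bil_def to_ac_sum)

lemma isotr_to_ac:
  assumes "isotr L n Q"
  shows "isotr (to_ac ` L) n (\<lambda>i j. to_ac (Q i j))"
proof -
  obtain v where "\<forall>j<n. v j \<in> L" "\<exists>j<n. v j \<noteq> 0" "bil n Q v v = 0" using assms by (auto simp: isotr_def)
  thus ?thesis unfolding isotr_def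
    using to_ac_bil[of n Q v v] by (intro exI[of _ "\<lambda>i. to_ac (v i)"]) auto
qed

text \<open>The entries of the family lie in the image of \<open>L\<close> and not just somewhere in
  the closure, so they can be pulled back along the injective \<open>to_ac\<close>.\<close>

lemma tot_iso_to_acD:
  assumes "tot_iso (to_ac ` L) n (\<lambda>i j. to_ac (Q i j)) m"
  shows "tot_iso L n Q m"
proof -
  obtain W where W: "iso_fam (to_ac ` L) n (\<lambda>i j. to_ac (Q i j)) {..<m} W" using assms by (auto simp: tot_iso_def)
  define V where "V k j = of_ac (W k j)" for k j
  have V: "to_ac (V k j) = W k j" "V k j \<in> L" if "k < m" "j < n" for k j
  proof -
    have "W k j \<in> to_ac ` L" using W that by (auto simp: iso_fam_def)
    then obtain x where "x \<in> L" "W k j = to_ac x" by blast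
    thus "to_ac (V k j) = W k j" "V k j \<in> L" by (auto simp: V_def)
  qed
  have "iso_fam L n Q {..<m} V" unfolding iso_fam_def
  proof (intro conjI ballI allI impI)
    fix k l assume kl: "k \<in> {..<m}" "l \<in> {..<m}"
    have "to_ac (bil n Q (V k) (V l)) = bil n (\<lambda>i j. to_ac (Q i j)) (W k) (W l)"
      unfolding to_ac_bil using V kl by (intro bil_cong) auto
    also have "\<dots> = 0" using W kl by (auto simp: iso_fam_def)
    finally show "bil n Q (V k) (V l) = 0" by simp
  next
    show "indep_fam L n {..<m} V" unfolding indep_fam_def
    proof (intro allI impI)
      fix c assume c: "(\<forall>k\<in>{..<m}. c k \<in> L) \<and> (\<forall>j<n. (\<Sum>k<m. c k * V k j) = 0)"
      have "(\<Sum>k<m. to_ac (c k) * W k j) = 0" if "j < n" for j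
      proof -
        have "(\<Sum>k<m. to_ac (c k) * W k j) = to_ac (\<Sum>k<m. c k * V k j)"
          unfolding to_ac_sum to_ac_mult using V that by (intro sum.cong) auto
        thus ?thesis using c that by simp
      qed
      hence "to_ac (c k) = 0" if "k < m" for k
        using indep_famD[of "to_ac ` L" n "{..<m}" W "\<lambda>k. to_ac (c k)" k] W c that by (auto simp: iso_fam_def)
      thus "\<forall>k\<in>{..<m}. c k = 0" by simp
    qed
  qed (use V in auto)
  thus ?thesis unfolding tot_iso_def by blast
qed

text \<open>The fields \<open>K\<close>, \<open>L\<close> and \<open>M\<close> lie in three types.
  Isotropy of the product over \<open>L\<close> is carried to the copy \<open>E\<close> of
  \<open>L\<close> in the algebraic closure and from there, by an isometry and removal of the factor
  \<open>a\<close>, to the product with the Pfister form. The totally isotropic subspace found there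
  travels the same way back.\<close>

lemma first_witt_index_tensor_ge:
  fixes p :: "'a::field mat" and L :: "'b::field set" and M :: "'c::field set"
  assumes K: "is_subfield K" and two: "(2::'a) \<noteq> 0"
    and \<pi>: "quad_form K \<pi>" "isometric K \<pi> (a \<cdot>\<^sub>m \<rho>)" "a \<in> K" "a \<noteq> 0"
    and \<rho>: "isometric K \<rho> (pfister as)" "set as \<subseteq> K"
    and p: "quad_form K p" "anisotropic K p" "dim_row p \<ge> 2"
    and an: "anisotropic K (tensor_form \<pi> p)"
    and L: "is_function_field K (tensor_form \<pi> p) L \<phi>" and M: "is_function_field K p M \<chi>"
  shows "dim_row \<pi> * witt_index M (map_mat \<chi> p) \<le> witt_index L (map_mat \<phi> (tensor_form \<pi> p))"
proof -
  define r where "r = (2::nat) ^ length as"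
  define n where "n = dim_row p"
  define T where "T = tensor_form \<pi> p"
  define U where "U = tensor_form (pfister as) p"
  define i where "i = witt_index M (map_mat \<chi> p)"
  note pp = quad_formD[OF p(1), folded n_def]
  have Pf: "pfister as \<in> carrier_mat r r" unfolding r_def by (rule pfister_carrier)
  have \<rho>r: "dim_row \<rho> = r" using \<rho>(1) Pf by (auto simp: isometric_def)
  have \<pi>r: "dim_row \<pi> = r" using \<pi>(2) \<rho>r by (auto simp: isometric_def)
  note \<pi>\<pi> = quad_formD[OF \<pi>(1), unfolded \<pi>r]
  have a\<rho>: "a \<cdot>\<^sub>m \<rho> \<in> carrier_mat r r" using isometric_carrier[OF \<pi>(2) \<pi>\<pi>(1)] .
  have "dim_row \<rho> = r" "dim_col \<rho> = r" using carrier_matD[OF a\<rho>] by simp_all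
  hence \<rho>c: "\<rho> \<in> carrier_mat r r" by (rule carrier_matI)
  have T: "T \<in> carrier_mat (r * n) (r * n)" unfolding T_def by (rule tensor_form_carrier[OF \<pi>\<pi>(1) pp(1)])
  have U: "U \<in> carrier_mat (r * n) (r * n)" unfolding U_def by (rule tensor_form_carrier[OF Pf pp(1)])
  have TK: "elements_mat T \<subseteq> K" unfolding T_def by (rule tensor_form_closed[OF K \<pi>\<pi>(1) pp(1) \<pi>\<pi>(2) pp(2)])
  have "T\<^sup>T = T" unfolding T_def tensor_form_transpose[OF \<pi>\<pi>(1) pp(1)] \<pi>\<pi>(3) pp(3) ..
  hence Tq: "quad_form K T" using quad_form_if_anisotropic[OF K T TK] an by (simp add: T_def)
  have TU: "isometric K T (a \<cdot>\<^sub>m U)"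
  proof -
    have "isometric K \<pi> (a \<cdot>\<^sub>m pfister as)"
      using isometric_trans[OF K \<pi>\<pi>(1) \<pi>(2) isometric_smult[OF \<rho>c \<rho>(1)]] .
    from isometric_tensor_left[OF K \<pi>\<pi>(1) pp(1) this]
    show ?thesis unfolding T_def U_def tensor_form_smult[OF Pf pp(1)] .
  qed
  have rn: "2 \<le> r * n"
  proof -
    have "1 * n \<le> r * n" by (intro mult_right_mono) (auto simp: r_def)
    thus ?thesis using p(3) unfolding n_def by linarith
  qed
  have Lf: "is_subfield L" and \<phi>: "ring_hom_on K L \<phi>" and Mf: "is_subfield M" and \<chi>: "ring_hom_on K M \<chi>"
    using L M by (auto simp: is_function_field_def)
  define \<sigma> where "\<sigma> x = to_ac (\<phi> x)" for x
  define E where "E = to_ac ` L"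
  have \<sigma>: "ring_hom_on K E \<sigma>" using \<phi> by (auto simp: ring_hom_on_def \<sigma>_def E_def)
  hence \<sigma>K: "\<sigma> ` K \<subseteq> E" by (auto simp: ring_hom_on_def)
  have E: "is_subfield E" unfolding is_subfield_def E_def
  proof (intro conjI ballI)
    show "1 \<in> to_ac ` L" using subfield_1[OF Lf] by (metis imageI to_ac_1)
    fix x y assume "x \<in> to_ac ` L" "y \<in> to_ac ` L"
    then obtain u v where "u \<in> L" "v \<in> L" "x = to_ac u" "y = to_ac v" by blast
    thus "x - y \<in> to_ac ` L" "x * y \<in> to_ac ` L" "inverse x \<in> to_ac ` L"
      using subfield_diff[OF Lf, of u v] subfield_mult[OF Lf, of u v] subfield_inverse[OF Lf, of u]
      by (auto simp flip: to_ac_diff to_ac_mult to_ac_inverse)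
  qed
  have two_b: "(2::'b) \<noteq> 0" by (rule hom_two[OF K \<phi> two])
  have two_c: "(2::'c) \<noteq> 0" by (rule hom_two[OF K \<chi> two])
  have two_d: "(2::'b alg_closure) \<noteq> 0" by (rule hom_two[OF K \<sigma> two])
  note LI = function_field_infinite_isotropic[OF L[folded T_def] T TK an[folded T_def] rn]
  have "inj_on to_ac L" by (rule inj_on_subset[OF inj_to_ac]) simp
  hence Einf: "infinite E" using LI(1) finite_imageD unfolding E_def by blast
  have "tot_iso M n (gram (map_mat \<chi> p)) i"
    using witt_index_iff[OF Mf two_c quad_form_map[OF K \<chi> p(1)], of i] by (simp add: i_def n_def)
  hence W: "tot_iso M (dim_row p) (gmap \<chi> p) i" unfolding tot_iso_gram_map[OF pp(1)] unfolding n_def .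
  have TUm: "isometric E (map_mat \<sigma> T) (map_mat \<sigma> (a \<cdot>\<^sub>m U))" by (rule isometric_map[OF K \<sigma> T TK TU])
  have mT: "map_mat \<sigma> T \<in> carrier_mat (r * n) (r * n)" using T by simp
  have aU: "a \<cdot>\<^sub>m U \<in> carrier_mat (r * n) (r * n)" using U by simp
  have \<sigma>a: "\<sigma> a \<noteq> 0" using ring_hom_on_inj[OF \<sigma> K \<pi>(3)] \<pi>(4) by blast
  have UK: "elements_mat U \<subseteq> K" unfolding U_def
    by (rule tensor_form_closed[OF K Pf pp(1) pfister_closed[OF K \<rho>(2)] pp(2)])
  have scale: "tot_iso E (r * n) (gram (map_mat \<sigma> (a \<cdot>\<^sub>m U))) k \<longleftrightarrow> tot_iso E (r * n) (gmap \<sigma> U) k" for k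
  proof -
    have "tot_iso E (r * n) (gram (map_mat \<sigma> (a \<cdot>\<^sub>m U))) k \<longleftrightarrow> tot_iso E (r * n) (\<lambda>i j. \<sigma> a * \<sigma> (U $$ (i, j))) k"
    proof (intro tot_iso_cong)
      fix i j assume ij: "i < r * n" "j < r * n"
      have "U $$ (i, j) \<in> K" using UK U ij by (auto simp: elements_mat_iff)
      thus "map_mat \<sigma> (a \<cdot>\<^sub>m U) $$ (i, j) = \<sigma> a * \<sigma> (U $$ (i, j))"
        using U ij ring_hom_on_mult[OF \<sigma> \<pi>(3)] by simp
    qed
    thus ?thesis using tot_iso_scale[OF \<sigma>a] by simp
  qed
  have T_iff: "tot_iso E (r * n) (gmap \<sigma> T) k \<longleftrightarrow> tot_iso E (r * n) (gmap \<sigma> U) k" for k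
    using tot_iso_isometric[OF E mT TUm, of k] tot_iso_isometric[OF E _ isometric_sym[OF E mT TUm], of "r * n" k]
      isometric_carrier[OF TUm mT] unfolding scale tot_iso_gram_map[OF T, symmetric] by blast
  have "isotr E (r * n) (gmap \<sigma> T)" using isotr_to_ac[OF LI(2)] by (simp add: E_def \<sigma>_def)
  hence "isotr E (r * n) (gmap \<sigma> U)" using T_iff[of 1] unfolding tot_iso_1[OF E] by blast
  hence "tot_iso E (r * n) (gmap \<sigma> U) (r * i)"
    using tot_iso_pfister_tensor[OF K \<sigma> p(1,3) tot_iso_of_function_field[OF M p W \<sigma> two_d] \<rho>(2) E \<sigma>K Einf]
    unfolding r_def n_def U_def by blast
  hence "tot_iso E (r * n) (gmap \<sigma> T) (r * i)" using T_iff by blast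
  hence "tot_iso L (r * n) (gmap \<phi> T) (r * i)" unfolding E_def \<sigma>_def by (rule tot_iso_to_acD)
  hence "tot_iso L (r * n) (gram (map_mat \<phi> T)) (r * i)" unfolding tot_iso_gram_map[OF T] .
  hence "r * i \<le> witt_index L (map_mat \<phi> T)"
    using witt_index_iff[OF Lf two_b quad_form_map[OF K \<phi> Tq], of "r * i"] T by simp
  thus ?thesis by (simp add: \<pi>r i_def T_def)
qed

section \<open>Levels of the generic splitting tower\<close>

lemma isometric_mono: "isometric F p q \<Longrightarrow> F \<subseteq> K \<Longrightarrow> isometric K p q"
  unfolding isometric_def by blast

lemma quad_form_mono: "quad_form F q \<Longrightarrow> F \<subseteq> K \<Longrightarrow> quad_form K q"
  unfolding quad_form_def by blast

lemma generic_splitting_tower_step: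
  assumes "generic_splitting_tower F q h Fs qs" "j < h"
  shows "F \<subseteq> Fs j" "is_subfield (Fs j)" "quad_form (Fs j) (qs j)" "anisotropic (Fs j) (qs j)" "dim_row (qs j) \<ge> 2"
    "is_function_field (Fs j) (qs j) (Fs (Suc j)) (\<lambda>x. x)"
proof -
  note t = assms(1)[unfolded generic_splitting_tower_def]
  have "j \<le> h \<Longrightarrow> F \<subseteq> Fs j \<and> quad_form (Fs j) (qs j) \<and> anisotropic (Fs j) (qs j)" for j
  proof (induction j)
    case 0
    thus ?case using t by (auto simp: anisotropic_part_def witt_decomposition_def)
  next
    case (Suc j)
    hence "Fs j \<subseteq> Fs (Suc j)" "anisotropic_part (Fs (Suc j)) (qs j) (qs (Suc j))" using t by auto
    thus ?case using Suc by (auto simp: anisotropic_part_def witt_decomposition_def)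
  qed
  thus "F \<subseteq> Fs j" "quad_form (Fs j) (qs j)" "anisotropic (Fs j) (qs j)" using assms(2) by auto
  show "is_function_field (Fs j) (qs j) (Fs (Suc j)) (\<lambda>x. x)" "dim_row (qs j) \<ge> 2" using t assms(2) by auto
  thus "is_subfield (Fs j)" by (simp add: is_function_field_def)
qed

theorem theorem2p4:
  fixes F :: "'a::field set" and \<pi> \<rho> q :: "'a mat"
  assumes "is_subfield F" and "CHAR('a) \<noteq> 2"
    and "quad_form F \<pi>"
    and "is_pfister F \<rho>" and "anisotropic F \<rho>" and "similar_forms F \<pi> \<rho>"
    and "quad_form F q" and "anisotropic F q" and "dim_row q \<ge> 2"
  shows "(\<forall>h Fs qs j (L :: 'b::field set) \<phi>.
            generic_splitting_tower F q h Fs qs \<and> j < h \<and>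
            anisotropic (Fs j) (tensor_form \<pi> (qs j)) \<and>
            is_function_field (Fs j) (tensor_form \<pi> (qs j)) L \<phi> \<longrightarrow>
            first_witt_index L \<phi> (tensor_form \<pi> (qs j)) \<ge> dim_row \<pi> * higher_witt_index Fs qs (Suc j))
       \<and> (\<forall>(L :: 'b::field set) \<phi> (M :: 'c::field set) \<chi>.
            anisotropic F (tensor_form \<pi> q) \<and>
            is_function_field F (tensor_form \<pi> q) L \<phi> \<and> is_function_field F q M \<chi> \<longrightarrow>
            first_witt_index L \<phi> (tensor_form \<pi> q) \<ge> dim_row \<pi> * first_witt_index M \<chi> q)"
proof -
  have two: "(2::'a) \<noteq> 0"
  proof
    assume "(2::'a) = 0"
    hence "of_nat 2 = (0::'a)" by simp
    hence "CHAR('a) dvd 2" using of_nat_eq_0_iff_char_dvd by blast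
    hence "CHAR('a) = 1 \<or> CHAR('a) = 2" using two_is_prime_nat by (auto simp: prime_nat_iff)
    thus False using assms(2) by simp
  qed
  obtain a where a: "a \<in> F" "a \<noteq> 0" "isometric F \<pi> (a \<cdot>\<^sub>m \<rho>)" using assms(6) by (auto simp: similar_forms_def)
  obtain "as" where asF: "set as \<subseteq> F" "isometric F \<rho> (pfister as)" using assms(4) by (auto simp: is_pfister_def)
  note main = first_witt_index_tensor_ge[OF _ two quad_form_mono[OF assms(3)] isometric_mono[OF a(3)] _ a(2)
      isometric_mono[OF asF(2)] order_trans[OF asF(1)]]
  have "dim_row \<pi> * higher_witt_index Fs qs (Suc j) \<le> first_witt_index L \<phi> (tensor_form \<pi> (qs j))"
    if t: "generic_splitting_tower F q h Fs qs" "j < h" and an: "anisotropic (Fs j) (tensor_form \<pi> (qs j))"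
      and L: "is_function_field (Fs j) (tensor_form \<pi> (qs j)) L \<phi>" for h Fs qs j and L :: "'b set" and \<phi>
  proof -
    \<comment> \<open>The next field \<open>Fs (Suc j)\<close> is itself a realisation of the
      function field of \<open>qs j\<close>, with the inclusion as embedding, so the higher Witt
      index at \<open>Suc j\<close> is the first Witt index of \<open>qs j\<close>.\<close>
    note s = generic_splitting_tower_step[OF t]
    have "map_mat (\<lambda>x. x) (qs j) = qs j" by (intro eq_matI) auto
    thus ?thesis
      using main[OF s(2) s(1) s(1) _ s(1) s(1) s(3-5) an L s(6)] a(1) s(1)
      by (auto simp: first_witt_index_def higher_witt_index_def)
  qed
  moreover have "dim_row \<pi> * first_witt_index M \<chi> q \<le> first_witt_index L \<phi> (tensor_form \<pi> q)"
    if "anisotropic F (tensor_form \<pi> q)" "is_function_field F (tensor_form \<pi> q) L \<phi>" "is_function_field F q M \<chi>"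
    for L :: "'b set" and \<phi> and M :: "'c set" and \<chi>
    using main[OF assms(1) order_refl order_refl a(1) order_refl order_refl assms(7-9) that]
    by (simp add: first_witt_index_def)
  ultimately show ?thesis by blast
qed

end
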